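(* Let $N\ge3$. Assume that $V\in L^\infty(\mathbb{R}^N)$ satisfies $\lim_{|x|\to\infty}V(x)=V^\infty>0$, that $p\in C(\mathbb{R}^N)$ satisfies $2<p^-:=\inf_{\mathbb{R}^N}p\le\sup_{\mathbb{R}^N}p=:p^+<2^*$ and $\lim_{|x|\to\infty}p(x)=p^\infty$, and that both $V$ and $p$ are radially symmetric in $\mathbb{R}^N$. Moreover, assume that $$\lambda_1<\left(\frac{p^-}{p^\infty}\right)^{2/p^\infty}\lambda_1^\infty.$$ Then, for every minimizer $w$ of $J$ on $\mathcal{M}$ (i.e. every $w\in\mathcal{M}$ with $J(w)=\lambda_1$), there exist a line $L$ through $0$ and a function $\widetilde{w}:L\times[0,\infty)\to\mathbb{R}$ such that $$w(x)=\widetilde{w}\big(P_L(x),|x-P_L(x)|\big),\quad x\in\mathbb{R}^N,$$ where $P_L:\mathbb{R}^N\to L$ denotes the orthogonal projection onto $L$.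
   Context: All functions are real valued. $2^*=2N/(N-2)$ for $N\ge3$. For $u\in H^1(\mathbb{R}^N)$ set $$J(u)=\int_{\mathbb{R}^N}\left(|\nabla u|^2+V(x)u^2\right)dx,\qquad I(u)=\inf\Big\{\gamma>0:\int_{\mathbb{R}^N}\Big|\frac{u(x)}{\gamma}\Big|^{p(x)}\frac{dx}{p(x)}\le1\Big\},$$ $\mathcal{M}=\{u\in H^1(\mathbb{R}^N): I(u)=1\}$ and $\lambda_1=\inf_{u\in\mathcal{M}}J(u)$. Also set $$J^\infty(u)=\int_{\mathbb{R}^N}\left(|\nabla u|^2+V^\infty u^2\right)dx,\qquad I^\infty(u)=\left[\int_{\mathbb{R}^N}|u(x)|^{p^\infty}\frac{dx}{p^\infty}\right]^{1/p^\infty},$$ $\mathcal{M}^\infty=\{u\in H^1(\mathbb{R}^N): I^\infty(u)=1\}$ and $\lambda_1^\infty=\inf_{u\in\mathcal{M}^\infty}J^\infty(u)$. Minimizers are (as elements of $H^1$) identified with their continuous representatives. *)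

theory Defs
  imports "HOL-Analysis.Analysis"
begin

section \<open>Test functions and weak gradients\<close>

fun Ck_function :: "nat \<Rightarrow> ('a::euclidean_space \<Rightarrow> real) \<Rightarrow> bool" where
  "Ck_function 0 f \<longleftrightarrow> continuous_on UNIV f"
| "Ck_function (Suc k) f \<longleftrightarrow>
     (\<forall>x. f differentiable (at x)) \<and>
     (\<forall>b\<in>Basis. Ck_function k (\<lambda>x. frechet_derivative f (at x) b))"

definition test_function :: "('a::euclidean_space \<Rightarrow> real) \<Rightarrow> bool" where
  "test_function \<phi> \<longleftrightarrow> (\<forall>k. Ck_function k \<phi>) \<and> compact (closure {x. \<phi> x \<noteq> 0})"

definition square_integrable :: "('a::euclidean_space \<Rightarrow> 'b::euclidean_space) \<Rightarrow> bool" where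
  "square_integrable f \<longleftrightarrow>
     f \<in> borel_measurable lebesgue \<and> integrable lebesgue (\<lambda>x. (norm (f x))\<^sup>2)"

definition L2_weak_gradient :: "('a::euclidean_space \<Rightarrow> real) \<Rightarrow> ('a \<Rightarrow> 'a) \<Rightarrow> bool" where
  "L2_weak_gradient u g \<longleftrightarrow> square_integrable g \<and>
     (\<forall>\<phi>. test_function \<phi> \<longrightarrow> (\<forall>b\<in>Basis.
        (\<integral>x. u x * frechet_derivative \<phi> (at x) b \<partial>lebesgue) =
        - (\<integral>x. (g x \<bullet> b) * \<phi> x \<partial>lebesgue)))"

text \<open>Elements of $H^1$ are represented by functions, not by classes modulo equality almost
  everywhere. For a function in \<open>H1\<close> the weak gradient is determined almost everywhere, so
  the choice made in \<open>weak_gradient\<close> does not affect integrals.\<close>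

definition H1 :: "('a::euclidean_space \<Rightarrow> real) set" where
  "H1 = {u. square_integrable u \<and> (\<exists>g. L2_weak_gradient u g)}"

definition weak_gradient :: "('a::euclidean_space \<Rightarrow> real) \<Rightarrow> 'a \<Rightarrow> 'a" where
  "weak_gradient u = (SOME g. L2_weak_gradient u g)"

section \<open>The constrained minimization problems\<close>

definition J :: "('a::euclidean_space \<Rightarrow> real) \<Rightarrow> ('a \<Rightarrow> real) \<Rightarrow> real" where
  "J V u = (\<integral>x. (norm (weak_gradient u x))\<^sup>2 + V x * (u x)\<^sup>2 \<partial>lebesgue)"

text \<open>The Luxemburg norm takes values in \<open>ennreal\<close>, so that the infimum of the
  empty set is \<open>\<infinity>\<close>; the modular is a nonnegative integral and may be infinite as well.\<close>

definition Lux :: "('a::euclidean_space \<Rightarrow> real) \<Rightarrow> ('a \<Rightarrow> real) \<Rightarrow> ennreal" where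
  "Lux p u = (INF \<gamma>\<in>{\<gamma>::real. \<gamma> > 0 \<and>
     (\<integral>\<^sup>+x. ennreal (\<bar>u x / \<gamma>\<bar> powr p x / p x) \<partial>lebesgue) \<le> 1}. ennreal \<gamma>)"

definition M :: "('a::euclidean_space \<Rightarrow> real) \<Rightarrow> ('a \<Rightarrow> real) set" where
  "M p = {u \<in> H1. Lux p u = 1}"

definition lambda1 :: "('a::euclidean_space \<Rightarrow> real) \<Rightarrow> ('a \<Rightarrow> real) \<Rightarrow> real" where
  "lambda1 V p = (INF u\<in>M p. J V u)"

definition J_inf :: "real \<Rightarrow> ('a::euclidean_space \<Rightarrow> real) \<Rightarrow> real" where
  "J_inf Vinf u = (\<integral>x. (norm (weak_gradient u x))\<^sup>2 + Vinf * (u x)\<^sup>2 \<partial>lebesgue)"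

text \<open>If the integral diverges, the Bochner integral, and hence \<open>I_inf\<close>, is $0$, so such
  functions do not belong to \<open>M_inf\<close>.\<close>

definition I_inf :: "real \<Rightarrow> ('a::euclidean_space \<Rightarrow> real) \<Rightarrow> real" where
  "I_inf pinf u = (\<integral>x. \<bar>u x\<bar> powr pinf / pinf \<partial>lebesgue) powr (1 / pinf)"

definition M_inf :: "real \<Rightarrow> ('a::euclidean_space \<Rightarrow> real) set" where
  "M_inf pinf = {u \<in> H1. I_inf pinf u = 1}"

text \<open>The first argument only carries the type of the underlying space.\<close>

definition lambda1_inf :: "'a::euclidean_space itself \<Rightarrow> real \<Rightarrow> real \<Rightarrow> real" where
  "lambda1_inf _ Vinf pinf = (INF u\<in>(M_inf pinf :: ('a \<Rightarrow> real) set). J_inf Vinf u)"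

section \<open>Hypotheses and symmetry\<close>

definition essentially_bounded :: "('a::euclidean_space \<Rightarrow> real) \<Rightarrow> bool" where
  "essentially_bounded f \<longleftrightarrow>
     f \<in> borel_measurable lebesgue \<and> (\<exists>C. AE x in lebesgue. \<bar>f x\<bar> \<le> C)"

text \<open>Limit at infinity and radial symmetry of an element of $L^\infty$ are insensitive to
  null sets, hence the versions almost everywhere.\<close>

definition ess_tendsto_at_infinity :: "('a::euclidean_space \<Rightarrow> real) \<Rightarrow> real \<Rightarrow> bool" where
  "ess_tendsto_at_infinity f l \<longleftrightarrow>
     (\<forall>\<epsilon>>0. \<exists>R. AE x in lebesgue. norm x \<ge> R \<longrightarrow> \<bar>f x - l\<bar> < \<epsilon>)"

definition ess_radial :: "('a::euclidean_space \<Rightarrow> real) \<Rightarrow> bool" where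
  "ess_radial f \<longleftrightarrow> (\<exists>h. AE x in lebesgue. f x = h (norm x))"

definition radial :: "('a::euclidean_space \<Rightarrow> real) \<Rightarrow> bool" where
  "radial f \<longleftrightarrow> (\<exists>h. \<forall>x. f x = h (norm x))"

definition orth_proj :: "'a::euclidean_space set \<Rightarrow> 'a \<Rightarrow> 'a" where
  "orth_proj L x = (THE y. y \<in> L \<and> (\<forall>z\<in>L. orthogonal (x - y) z))"

end

theory Submission
  imports Defs "HOL-Computational_Algebra.Polynomial"
begin

text \<open>
The reason for the symmetry is that a minimizer can be compared with its reflections. Let \<open>\<sigma>\<close> be the
reflection at the hyperplane orthogonal to a unit vector \<open>e\<close>. The polarization of \<open>W\<close> takes at two
mirror points the same two values as \<open>W\<close>, the larger one on the side that \<open>e\<close> points to. As \<open>V\<close> and \<open>p\<close>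
are radial, polarization preserves the constraint and $\int V u^2$, and it does not increase
$\int |\nabla u|^2$; so the polarization of a minimizer is again a minimizer, with the same Lagrange
multiplier (\<open>polar_wgrad\<close>, \<open>polar_rearrange\<close>, \<open>minimizer_polar\<close>). Both functions solve the same
Euler-Lagrange equation (\<open>Euler_Lagrange\<close>), and their difference $v \ge 0$ on the half space
satisfies $-\Delta v \ge -C v$ locally. By the strong maximum principle (\<open>zero_propagation\<close>) it
vanishes identically or nowhere on the open half space. Doing this for \<open>e\<close> and \<open>- e\<close> leaves three
possibilities (\<open>reflection_trichotomy\<close>): $W = W \circ \sigma$, or $W > W \circ \sigma$ on
the whole half space, or $W < W \circ \sigma$ on the whole half space.

The axis is found from the first moment $m = \int_{|x| \le 1} W(x)\, x\, dx$. If \<open>e\<close> is orthogonal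
to \<open>m\<close>, the two strict alternatives are impossible, since either would give $m \cdot e$ a sign
(\<open>moment_positive\<close>). So \<open>W\<close> is invariant under all reflections whose normal vector is orthogonal to
\<open>m\<close>, and these reflections identify any two points with the same projection to the axis
and the same distance from it (\<open>axially_symmetric_if_reflections\<close>).

The pointwise comparison requires \<open>W\<close> to be continuous. Regularity and maximum principle are both
obtained from one identity: the derivative with respect to the radius of a certain mollifier is the
Laplacian of a compactly supported smooth function \<open>pot\<close> (\<open>moll_derivative_eq_laplacian_pot\<close>).
For a distributional solution of $-\Delta u = f$ the mollified function therefore has the
radius derivative $- \int pot_t f$. Integrating this identity bounds $|u|$ by a constant plus the potential of
$|f| \le b |u|$, where \<open>b\<close> is the sum of a constant and a multiple of $|u|^{p-2}$. Because the exponents are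
subcritical, the potential of \<open>b\<close> is small on small scales (\<open>small_kernel_scale\<close>), and an absorption
argument bounds \<open>u\<close> (\<open>kernel_absorption\<close>). Then \<open>f\<close> is bounded, the mollifications converge
uniformly, and the limit is the continuous representative (\<open>continuous_representative\<close>).

The constraint is a Luxemburg norm with variable exponent. It enters the variational argument only
through its homogeneity and through the fact that it deviates from $1$ by at most as much as the
modular does (\<open>Lux_le\<close>, \<open>Lux_ge\<close>), and the modular is differentiable by dominated
convergence (\<open>modular_has_derivative\<close>).
\<close>

section \<open>Isometries, dilations and translations of Lebesgue measure\<close>

text \<open>The image measure is invariant under translations, because an isometry is onto, and it gives the
unit ball the same finite positive volume. Computing the product of an arbitrary Borel set with
the ball by Fubini's theorem in both orders shows that these two properties determine the measure.\<close>
lemma distr_lborel_isometry: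
  fixes s :: "'a::euclidean_space \<Rightarrow> 'a"
  assumes lin: "linear s" and iso: "\<And>x. norm (s x) = norm x"
  shows "distr lborel borel s = lborel"
proof -
  have [measurable]: "s \<in> borel_measurable borel"
    using lin by (intro borel_measurable_continuous_onI linear_continuous_on) (simp add: linear_linear)
  have "inj s"
    unfolding linear_injective_0[OF lin] using iso by (metis norm_eq_zero)
  then have bij: "bij s"
    by (simp add: bij_def lin linear_injective_imp_surjective)
  define \<mu> where "\<mu> = distr lborel borel s"
  have sets_mu[measurable_cong]: "sets \<mu> = sets borel" and space_mu: "space \<mu> = UNIV"
    by (auto simp: \<mu>_def)
  have mu_transl: "(\<integral>\<^sup>+x. f (c + x) \<partial>\<mu>) = (\<integral>\<^sup>+x. f x \<partial>\<mu>)"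
    if [measurable]: "f \<in> borel_measurable borel" for f and c :: 'a
  proof -
    obtain d where d: "s d = c" using bij by (metis bij_pointE)
    have "(\<integral>\<^sup>+x. f (c + x) \<partial>\<mu>) = (\<integral>\<^sup>+x. f (s (d + x)) \<partial>lborel)"
      unfolding \<mu>_def by (subst nn_integral_distr) (auto simp: linear_add[OF lin] d)
    also have "\<dots> = (\<integral>\<^sup>+x. f (s x) \<partial>distr lborel borel ((+) d))"
      by (subst nn_integral_distr) auto
    also have "\<dots> = (\<integral>\<^sup>+x. f x \<partial>\<mu>)"
      unfolding \<mu>_def lborel_distr_plus by (subst nn_integral_distr) auto
    finally show ?thesis .
  qed
  have ball: "emeasure \<mu> (ball 0 1) = emeasure lborel (ball (0::'a) 1)"
    unfolding \<mu>_def by (subst emeasure_distr) (auto intro!: arg_cong[where f="emeasure lborel"] simp: iso)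
  have "emeasure \<mu> (cball 0 r) = emeasure lborel (cball (0::'a) r)" for r
    unfolding \<mu>_def by (subst emeasure_distr) (auto intro!: arg_cong[where f="emeasure lborel"] simp: iso)
  then have fin: "emeasure \<mu> (cball 0 r) < \<infinity>" for r
    using emeasure_compact_finite[of "cball (0::'a) r"] by simp
  interpret mu: sigma_finite_measure \<mu>
  proof
    show "\<exists>A. countable A \<and> A \<subseteq> sets \<mu> \<and> \<Union> A = space \<mu> \<and> (\<forall>a\<in>A. emeasure \<mu> a \<noteq> \<infinity>)"
    proof (intro exI conjI)
      show "countable (range (\<lambda>n::nat. cball (0::'a) (real n)))" by simp
      show "\<Union> (range (\<lambda>n::nat. cball (0::'a) (real n))) = space \<mu>"
        by (auto simp: space_mu intro: real_arch_simple)
      show "\<forall>a\<in>range (\<lambda>n::nat. cball (0::'a) (real n)). emeasure \<mu> a \<noteq> \<infinity>"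
        using fin by (auto simp: less_top)
    qed (auto simp: sets_mu)
  qed
  interpret pair_sigma_finite \<mu> lborel ..
  let ?B = "ball (0::'a) 1"
  have [measurable]: "?B \<in> sets borel" by simp
  have eqA: "emeasure \<mu> A = emeasure lborel A" if [measurable]: "A \<in> sets borel" for A
  proof -
    have "emeasure \<mu> A * emeasure lborel ?B
      = (\<integral>\<^sup>+x. \<integral>\<^sup>+y. indicator A x * indicator ?B y \<partial>lborel \<partial>\<mu>)"
      by (simp add: nn_integral_cmult nn_integral_multc nn_integral_cmult_indicator sets_mu)
    also have "\<dots> = (\<integral>\<^sup>+x. \<integral>\<^sup>+y. indicator A x * indicator ?B (-x + y) \<partial>lborel \<partial>\<mu>)"
    proof (rule nn_integral_cong)
      fix x
      have "(\<integral>\<^sup>+y. indicator A x * indicator ?B y \<partial>distr lborel borel ((+) (-x))) =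
        (\<integral>\<^sup>+y. indicator A x * indicator ?B (-x + y) \<partial>lborel)"
        by (intro nn_integral_distr) measurable
      then show "(\<integral>\<^sup>+y. indicator A x * indicator ?B y \<partial>lborel) =
        (\<integral>\<^sup>+y. indicator A x * indicator ?B (-x + y) \<partial>lborel)"
        by (simp only: lborel_distr_plus)
    qed
    also have "\<dots> = (\<integral>\<^sup>+y. \<integral>\<^sup>+x. indicator A x * indicator ?B (-x + y) \<partial>\<mu> \<partial>lborel)"
      by (rule Fubini'[symmetric]) measurable
    also have "\<dots> = (\<integral>\<^sup>+y. \<integral>\<^sup>+x. indicator A (y + x) * indicator ?B (-(y+x) + y) \<partial>\<mu> \<partial>lborel)"
    proof (rule nn_integral_cong)
      fix y
      show "(\<integral>\<^sup>+x. indicator A x * indicator ?B (-x + y) \<partial>\<mu>) =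
        (\<integral>\<^sup>+x. indicator A (y + x) * indicator ?B (-(y+x) + y) \<partial>\<mu>)"
        by (rule mu_transl[symmetric]) measurable
    qed
    also have "\<dots> = (\<integral>\<^sup>+y. \<integral>\<^sup>+x. indicator A (y + x) * indicator ?B x \<partial>\<mu> \<partial>lborel)"
      by (intro nn_integral_cong) (auto simp: indicator_def)
    also have "\<dots> = (\<integral>\<^sup>+x. \<integral>\<^sup>+y. indicator A (y + x) * indicator ?B x \<partial>lborel \<partial>\<mu>)"
      by (rule Fubini') measurable
    also have "\<dots> = (\<integral>\<^sup>+x. emeasure lborel A * indicator ?B x \<partial>\<mu>)"
    proof (rule nn_integral_cong)
      fix x
      have "(\<integral>\<^sup>+y. indicator A y * indicator ?B x \<partial>distr lborel borel ((+) x)) =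
        (\<integral>\<^sup>+y. indicator A (x + y) * indicator ?B x \<partial>lborel)"
        by (intro nn_integral_distr) measurable
      then show "(\<integral>\<^sup>+y. indicator A (y + x) * indicator ?B x \<partial>lborel) = emeasure lborel A * indicator ?B x"
        by (simp add: lborel_distr_plus nn_integral_multc nn_integral_cmult_indicator add.commute)
    qed
    also have "\<dots> = emeasure lborel A * emeasure lborel ?B"
      by (simp add: nn_integral_cmult ball sets_mu)
    finally have eq: "emeasure \<mu> A * emeasure lborel ?B = emeasure lborel A * emeasure lborel ?B" .
    have "emeasure lborel ?B \<noteq> 0" by (simp add: emeasure_ball unit_ball_vol_pos[THEN less_imp_neq, symmetric])
    moreover have "emeasure lborel ?B \<noteq> \<infinity>" using emeasure_bounded_finite[of ?B] by auto
    ultimately show ?thesis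
      using eq by (simp add: ennreal_mult_cancel_left mult.commute[of _ "emeasure lborel ?B"])
  qed
  show ?thesis
    unfolding \<mu>_def[symmetric] by (rule measure_eqI) (auto simp: sets_mu eqA)
qed

lemma integral_lborel_affine:
  fixes f :: "'a::euclidean_space \<Rightarrow> 'b::{banach, second_countable_topology}"
  assumes [measurable]: "f \<in> borel_measurable borel" and "t > 0"
  shows "(\<integral>y. f y \<partial>lborel) = t ^ DIM('a) *\<^sub>R (\<integral>z. f (x + t *\<^sub>R z) \<partial>lborel)"
    and "integrable lborel f \<longleftrightarrow> integrable lborel (\<lambda>z. f (x + t *\<^sub>R z))"
proof -
  show "(\<integral>y. f y \<partial>lborel) = t ^ DIM('a) *\<^sub>R (\<integral>z. f (x + t *\<^sub>R z) \<partial>lborel)"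
    using assms(2) by (subst lborel_affine[of t x]) (simp_all add: integral_density integral_distr)
  have "integrable lborel f \<longleftrightarrow> integrable lborel (\<lambda>z. t ^ DIM('a) *\<^sub>R f (x + t *\<^sub>R z))"
    using assms(2) by (subst lborel_affine[of t x]) (simp_all add: integrable_density integrable_distr_eq)
  also have "\<dots> \<longleftrightarrow> integrable lborel (\<lambda>z. f (x + t *\<^sub>R z))"
    using assms(2) integrable_scaleR_right[of "inverse (t ^ DIM('a))" lborel "\<lambda>z. t ^ DIM('a) *\<^sub>R f (x + t *\<^sub>R z)"]
    by auto
  finally show "integrable lborel f \<longleftrightarrow> integrable lborel (\<lambda>z. f (x + t *\<^sub>R z))" .
qed

lemma integral_lborel_translate:
  fixes f :: "'a::euclidean_space \<Rightarrow> 'b::{banach, second_countable_topology}"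
  assumes [measurable]: "f \<in> borel_measurable borel"
  shows "(\<integral>y. f (y + x) \<partial>lborel) = (\<integral>y. f y \<partial>lborel)"
    and "integrable lborel (\<lambda>y. f (y + x)) \<longleftrightarrow> integrable lborel f"
  using integral_lborel_affine[of f 1 x] by (auto simp: add.commute)

text \<open>The indicator of an open set is lower semicontinuous, so that the positive part of
$1_U(x) - 1_U(x+h_n)$ tends to $0$ pointwise and is dominated by $1_U$. Positive and negative part
of this difference have the same integral, since translations preserve the measure of \<open>U\<close>.\<close>
lemma translation_L1_continuous_open:
  fixes U :: "'a::euclidean_space set"
  assumes U: "open U" and fin: "emeasure lborel U < \<infinity>" and h: "h \<longlonglongrightarrow> 0"
  shows "(\<lambda>n. \<integral>x. \<bar>indicator U (x + h n) - indicator U x\<bar> \<partial>lborel) \<longlonglongrightarrow> (0::real)"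
proof -
  have [measurable]: "U \<in> sets borel" using U by auto
  have int: "integrable lborel (indicator U :: 'a \<Rightarrow> real)" using fin by (auto intro: integrable_real_indicator)
  then have int': "integrable lborel (\<lambda>x. indicator U (x + c) :: real)" for c
    using integral_lborel_translate(2)[of "indicator U :: 'a \<Rightarrow> real" c] by auto
  have eq: "(\<integral>x. \<bar>indicator U (x + c) - indicator U x\<bar> \<partial>lborel) =
    2 * (\<integral>x. max 0 (indicator U x - indicator U (x + c)) \<partial>lborel :: real)" for c
  proof -
    have i3: "integrable lborel (\<lambda>x. max 0 (indicator U x - indicator U (x + c)) :: real)"
      using int int'[of c] by auto
    have "(\<integral>x. \<bar>indicator U (x + c) - indicator U x\<bar> \<partial>lborel) =
      (\<integral>x. 2 * max 0 (indicator U x - indicator U (x + c)) + (indicator U (x + c) - indicator U x) \<partial>lborel :: real)"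
      by (intro Bochner_Integration.integral_cong) (auto simp: indicator_def)
    also have "\<dots> = 2 * (\<integral>x. max 0 (indicator U x - indicator U (x + c)) \<partial>lborel)"
      using int int'[of c] i3 integral_lborel_translate(1)[of "indicator U :: 'a \<Rightarrow> real" c] by simp
    finally show ?thesis .
  qed
  have "(\<lambda>n. \<integral>x. max 0 (indicator U x - indicator U (x + h n)) \<partial>lborel) \<longlonglongrightarrow> (\<integral>x. 0 \<partial>(lborel :: 'a measure) :: real)"
  proof (rule integral_dominated_convergence[where w="indicator U"])
    show "AE x in lborel. (\<lambda>n. max 0 (indicator U x - indicator U (x + h n)) :: real) \<longlonglongrightarrow> 0"
    proof (rule AE_I2)
      fix x
      show "(\<lambda>n. max 0 (indicator U x - indicator U (x + h n)) :: real) \<longlonglongrightarrow> 0"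
      proof (cases "x \<in> U")
        case True
        have "(\<lambda>n. x + h n) \<longlonglongrightarrow> x" using tendsto_add[OF tendsto_const h, of x] by simp
        then have "\<forall>\<^sub>F n in sequentially. x + h n \<in> U" using True U by (auto dest: topological_tendstoD)
        then show ?thesis by (intro tendsto_eventually) (auto elim!: eventually_mono)
      qed simp
    qed
  qed (use int in \<open>auto simp: indicator_def\<close>)
  then show ?thesis unfolding eq by (auto intro: tendsto_mult_right_zero)
qed

text \<open>Outer regularity of the Lebesgue measure passes from open sets to Borel sets of finite measure;
simple functions and limits in $L^1$ follow since translations are isometries of $L^1$.\<close>
lemma translation_L1_continuous:
  fixes f :: "'a::euclidean_space \<Rightarrow> real"
  assumes f: "integrable lborel f" and h: "h \<longlonglongrightarrow> 0"
  shows "(\<lambda>n. \<integral>x. \<bar>f (x + h n) - f x\<bar> \<partial>lborel) \<longlonglongrightarrow> 0"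
  using f
proof induction
  case (base A c)
  have [measurable]: "A \<in> sets borel" using base by simp
  have intA: "integrable lborel (indicator A :: 'a \<Rightarrow> real)" using base by (auto intro: integrable_real_indicator)
  have "(\<lambda>n. \<integral>x. \<bar>indicator A (x + h n) - indicator A x\<bar> \<partial>lborel) \<longlonglongrightarrow> (0::real)"
  proof (rule LIMSEQ_I)
    fix e :: real assume e: "e > 0"
    obtain U where U: "open U" "A \<subseteq> U" and small: "emeasure lborel (U - A) < ennreal (e/4)"
      using outer_regular_lborel[of A "e/4"] e base by auto
    have [measurable]: "U \<in> sets borel" using U by auto
    have "emeasure lborel U = emeasure lborel A + emeasure lborel (U - A)"
      using U by (subst plus_emeasure) (auto simp: Un_absorb1)
    then have fin: "emeasure lborel U < \<infinity>" using base(2) small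
      by (simp add: ennreal_add_less_top) (metis less_trans ennreal_less_top)
    have intU: "integrable lborel (indicator U :: 'a \<Rightarrow> real)" using fin by (auto intro: integrable_real_indicator)
    have intD: "integrable lborel (indicator (U - A) :: 'a \<Rightarrow> real)" using small
      by (intro integrable_real_indicator) (auto intro: less_trans[OF small])
    have D: "(\<integral>x. indicator (U - A) x \<partial>lborel) \<le> e/4"
    proof -
      have "enn2real (emeasure lborel (U - A)) \<le> e/4"
        using small e by (intro enn2real_leI) auto
      then show ?thesis by (simp add: measure_def)
    qed
    note tr = integral_lborel_translate
    have "\<forall>\<^sub>F n in sequentially. (\<integral>x. \<bar>indicator U (x + h n) - indicator U x\<bar> \<partial>lborel) < e/2"
      using translation_L1_continuous_open[OF U(1) fin h] e by (intro order_tendstoD(2)) auto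
    then obtain N where N: "\<And>n. n \<ge> N \<Longrightarrow> (\<integral>x. \<bar>indicator U (x + h n) - indicator U x\<bar> \<partial>lborel) < e/2"
      unfolding eventually_sequentially by blast
    have "(\<integral>x. \<bar>indicator A (x + h n) - indicator A x\<bar> \<partial>lborel) < e" if "n \<ge> N" for n
    proof -
      have i1: "integrable lborel (\<lambda>x. indicator (U - A) (x + h n) :: real)" "integrable lborel (\<lambda>x. indicator U (x + h n) :: real)"
        "integrable lborel (\<lambda>x. indicator A (x + h n) :: real)"
        using intD intU intA tr(2)[of "indicator (U-A) :: 'a \<Rightarrow> real"] tr(2)[of "indicator U :: 'a \<Rightarrow> real"]
         tr(2)[of "indicator A :: 'a \<Rightarrow> real"]
        by auto
      have "(\<integral>x. \<bar>indicator A (x + h n) - indicator A x\<bar> \<partial>lborel) \<le>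
        (\<integral>x. \<bar>indicator U (x + h n) - indicator U x\<bar> + (indicator (U - A) (x + h n) + indicator (U - A) x) \<partial>lborel :: real)"
      proof (rule integral_mono)
        show "\<bar>indicator A (x + h n) - indicator A x\<bar> \<le> \<bar>indicator U (x + h n) - indicator U x\<bar>
          + (indicator (U - A) (x + h n) + indicator (U - A) x :: real)" for x
          using U(2) by (auto simp: indicator_def)
      qed (use i1 intA intU intD in simp_all)
      also have "\<dots> = (\<integral>x. \<bar>indicator U (x + h n) - indicator U x\<bar> \<partial>lborel) + ((\<integral>x. indicator (U - A) (x + h n) \<partial>lborel) + (\<integral>x. indicator (U - A) x \<partial>lborel))"
        using i1 intU intD by simp
      also have "\<dots> < e"
        using N[OF that] D tr(1)[of "indicator (U-A) :: 'a \<Rightarrow> real" "h n"] by simp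
      finally show ?thesis .
    qed
    then show "\<exists>no. \<forall>n\<ge>no. norm ((\<integral>x. \<bar>indicator A (x + h n) - indicator A x\<bar> \<partial>lborel) - 0::real) < e"
      by (intro exI[of _ N]) simp
  qed
  then have "(\<lambda>n. (\<integral>x. \<bar>indicator A (x + h n) - indicator A x\<bar> \<partial>lborel) * \<bar>c\<bar>) \<longlonglongrightarrow> 0"
    by (rule tendsto_mult_left_zero)
  moreover have "\<bar>indicator A (x + h n) *\<^sub>R c - indicator A x *\<^sub>R c\<bar> = \<bar>indicator A (x + h n) - indicator A x\<bar> * \<bar>c\<bar>" for x n
    by (simp add: left_diff_distrib[symmetric] abs_mult)
  ultimately show ?case by simp
next
  case (add f g)
  have [measurable]: "f \<in> borel_measurable borel" "g \<in> borel_measurable borel" using add by auto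
  have i: "integrable lborel (\<lambda>x. f (x + h n))" "integrable lborel (\<lambda>x. g (x + h n))" for n
    using add integral_lborel_translate(2)[of f] integral_lborel_translate(2)[of g] by auto
  show ?case
  proof (rule tendsto_sandwich[OF _ _ tendsto_const])
    show "(\<lambda>n. (\<integral>x. \<bar>f (x + h n) - f x\<bar> \<partial>lborel) + (\<integral>x. \<bar>g (x + h n) - g x\<bar> \<partial>lborel)) \<longlonglongrightarrow> 0"
      using tendsto_add[OF add(3) add(4)] by simp
    show "\<forall>\<^sub>F n in sequentially. (\<integral>x. \<bar>f (x + h n) + g (x + h n) - (f x + g x)\<bar> \<partial>lborel)
       \<le> (\<integral>x. \<bar>f (x + h n) - f x\<bar> \<partial>lborel) + (\<integral>x. \<bar>g (x + h n) - g x\<bar> \<partial>lborel)"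
    proof (intro always_eventually allI)
      fix n
      have "(\<integral>x. \<bar>f (x + h n) + g (x + h n) - (f x + g x)\<bar> \<partial>lborel)
        \<le> (\<integral>x. \<bar>f (x + h n) - f x\<bar> + \<bar>g (x + h n) - g x\<bar> \<partial>lborel)"
        using i add by (intro integral_mono) auto
      also have "\<dots> = (\<integral>x. \<bar>f (x + h n) - f x\<bar> \<partial>lborel) + (\<integral>x. \<bar>g (x + h n) - g x\<bar> \<partial>lborel)"
        using i add by (intro Bochner_Integration.integral_add) auto
      finally show "(\<integral>x. \<bar>f (x + h n) + g (x + h n) - (f x + g x)\<bar> \<partial>lborel)
        \<le> (\<integral>x. \<bar>f (x + h n) - f x\<bar> \<partial>lborel) + (\<integral>x. \<bar>g (x + h n) - g x\<bar> \<partial>lborel)" .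
    qed
  qed auto
next
  case (lim f s)
  have [measurable]: "f \<in> borel_measurable borel" "\<And>i. s i \<in> borel_measurable borel"
    using lim borel_measurable_integrable by auto
  have i: "integrable lborel (\<lambda>x. f (x + h n))" "integrable lborel (\<lambda>x. s i (x + h n))" for n i
    using lim integral_lborel_translate(2)[of f] integral_lborel_translate(2)[of "s i"] by auto
  have conv: "(\<lambda>i. \<integral>x. \<bar>s i x - f x\<bar> \<partial>lborel) \<longlonglongrightarrow> (\<integral>x. 0 \<partial>(lborel::'a measure))"
  proof (rule integral_dominated_convergence[where w="\<lambda>x. 3 * \<bar>f x\<bar>"])
    show "AE x in lborel. (\<lambda>i. \<bar>s i x - f x\<bar>) \<longlonglongrightarrow> 0"
      using lim(2) by (intro AE_I2) (simp add: LIM_zero_iff tendsto_rabs_zero_iff)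
    show "AE x in lborel. norm \<bar>s i x - f x\<bar> \<le> 3 * \<bar>f x\<bar>" for i
    proof (rule AE_I2)
      fix x :: 'a
      have "\<bar>s i x\<bar> \<le> 2 * \<bar>f x\<bar>" using lim(3)[of x i] by simp
      then show "norm \<bar>s i x - f x\<bar> \<le> 3 * \<bar>f x\<bar>" by simp
    qed
  qed (use lim in auto)
  show ?case
  proof (rule LIMSEQ_I)
    fix e :: real assume e: "e > 0"
    have "\<forall>\<^sub>F i in sequentially. (\<integral>x. \<bar>s i x - f x\<bar> \<partial>lborel) < e/4"
      using conv e by (intro order_tendstoD(2)) auto
    \<comment> \<open>an approximation fixed once and for all; only its translates vary with \<open>n\<close>\<close>
    then obtain i0 where i0: "(\<integral>x. \<bar>s i0 x - f x\<bar> \<partial>lborel) < e/4"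
      unfolding eventually_sequentially by blast
    have "\<forall>\<^sub>F n in sequentially. (\<integral>x. \<bar>s i0 (x + h n) - s i0 x\<bar> \<partial>lborel) < e/4"
      using lim(5)[of i0] e by (intro order_tendstoD(2)) auto
    then obtain N where N: "\<And>n. n \<ge> N \<Longrightarrow> (\<integral>x. \<bar>s i0 (x + h n) - s i0 x\<bar> \<partial>lborel) < e/4"
      unfolding eventually_sequentially by blast
    have "(\<integral>x. \<bar>f (x + h n) - f x\<bar> \<partial>lborel) < e" if "n \<ge> N" for n
    proof -
      have ii: "integrable lborel (\<lambda>x. \<bar>s i0 (x + h n) - f (x + h n)\<bar>)"
        using i by auto
      have "(\<integral>x. \<bar>f (x + h n) - f x\<bar> \<partial>lborel) \<le>
       (\<integral>x. \<bar>s i0 (x + h n) - f (x + h n)\<bar> + (\<bar>s i0 (x + h n) - s i0 x\<bar> + \<bar>s i0 x - f x\<bar>) \<partial>lborel)"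
        using i lim by (intro integral_mono) auto
      also have "\<dots> = (\<integral>x. \<bar>s i0 (x + h n) - f (x + h n)\<bar> \<partial>lborel) + ((\<integral>x. \<bar>s i0 (x + h n) - s i0 x\<bar> \<partial>lborel) + (\<integral>x. \<bar>s i0 x - f x\<bar> \<partial>lborel))"
        using i lim ii by simp
      also have "(\<integral>x. \<bar>s i0 (x + h n) - f (x + h n)\<bar> \<partial>lborel) = (\<integral>x. \<bar>s i0 x - f x\<bar> \<partial>lborel)"
        using integral_lborel_translate(1)[of "\<lambda>x. \<bar>s i0 x - f x\<bar>" "h n"] by simp
      finally show ?thesis using N[OF that] i0 e by linarith
    qed
    then show "\<exists>no. \<forall>n\<ge>no. norm ((\<integral>x. \<bar>f (x + h n) - f x\<bar> \<partial>lborel) - 0) < e"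
      by (intro exI[of _ N]) simp
  qed
qed

section \<open>Smooth bumps with explicit derivatives\<close>

text \<open>In terms of $z = 1/(1-s)$ the function is $Q(z) e^{-z}$, extended by zero. Allowing a polynomial
factor makes the family closed under differentiation: $dz/ds = z^2$ turns \<open>Q\<close> into $z^2 (Q' - Q)$.\<close>
definition bump :: "real poly \<Rightarrow> real \<Rightarrow> real" where
  "bump Q s = (if s < 1 then poly Q (1 / (1 - s)) * exp (- (1 / (1 - s))) else 0)"

definition bump_deriv :: "real poly \<Rightarrow> real poly" where
  "bump_deriv Q = [:0, 0, 1:] * (pderiv Q - Q)"

lemma poly_times_exp_tendsto_0:
  fixes Q :: "real poly"
  shows "((\<lambda>z. poly Q z * exp (- z)) \<longlongrightarrow> 0) at_top"
proof -
  have eq: "poly Q z * exp (-z) = (\<Sum>i\<le>degree Q. coeff Q i * (z ^ i / exp z))" for z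
    unfolding poly_altdef by (simp add: sum_distrib_right exp_minus divide_inverse mult.assoc)
  show ?thesis
    unfolding eq by (intro tendsto_null_sum tendsto_mult_right_zero tendsto_power_div_exp_0)
qed

lemma filterlim_inverse_distance_at_left: "filterlim (\<lambda>s::real. 1 / (1 - s)) at_top (at_left 1)"
proof -
  have "((\<lambda>s::real. 1 - s) \<longlongrightarrow> 1 - 1) (at_left 1)"
    by (intro tendsto_intros)
  moreover have "\<forall>\<^sub>F s::real in at_left 1. 1 - s \<in> {0<..} - {0}"
    by (auto simp: eventually_at_left_field intro!: exI[of _ 0])
  ultimately have "filterlim (\<lambda>s::real. 1 - s) (at_right 0) (at_left 1)"
    by (auto simp: filterlim_at elim: eventually_mono)
  from filterlim_compose[OF filterlim_inverse_at_top_right this] show ?thesis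
    by (simp add: inverse_eq_divide)
qed

text \<open>At $s = 1$ the difference quotient is again a polynomial times an exponential, of the form
$- z Q(z) e^{-z}$ with $z \rightarrow \infty$, and the exponential wins.\<close>
lemma has_real_derivative_bump:
  "(bump Q has_real_derivative bump (bump_deriv Q) s) (at s)"
proof -
  consider "s < 1" | "s > 1" | "s = 1" by linarith
  then show ?thesis
  proof cases
    case 1
    have inner: "((\<lambda>s. 1 / (1 - s)) has_real_derivative (1 / (1 - s)) * (1 / (1 - s))) (at s)"
      using 1 by (auto intro!: derivative_eq_intros)
    have "((\<lambda>s. poly Q (1 / (1 - s)) * exp (- (1 / (1 - s)))) has_real_derivative bump (bump_deriv Q) s) (at s)"
      by (rule DERIV_cong[OF DERIV_mult[OF DERIV_chain2[OF poly_DERIV inner]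
            DERIV_chain2[OF DERIV_exp DERIV_minus[OF inner]]]])
         (use 1 in \<open>simp add: bump_def bump_deriv_def algebra_simps\<close>)
    then show ?thesis
      by (rule has_field_derivative_transform_within_open[where S="{..<1}"]) (use 1 in \<open>auto simp: bump_def\<close>)
  next
    case 2
    have "((\<lambda>_. 0) has_real_derivative 0) (at s)" by simp
    then have "(bump Q has_real_derivative 0) (at s)"
      by (rule has_field_derivative_transform_within_open[where S="{1<..}"]) (use 2 in \<open>auto simp: bump_def\<close>)
    then show ?thesis using 2 by (simp add: bump_def)
  next
    case 3
    have "((\<lambda>y. (bump Q y - bump Q 1) / (y - 1)) \<longlongrightarrow> 0) (at 1)"
    proof (rule filterlim_split_at)
      have "((\<lambda>y. - (poly ([:0,1:] * Q) (1/(1-y)) * exp (- (1/(1-y))))) \<longlongrightarrow> - 0) (at_left 1)"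
        by (intro tendsto_minus filterlim_compose[OF poly_times_exp_tendsto_0] filterlim_inverse_distance_at_left)
      moreover have "\<forall>\<^sub>F y in at_left 1. - (poly ([:0,1:] * Q) (1/(1-y)) * exp (- (1/(1-y)))) = (bump Q y - bump Q 1) / (y - 1)"
        by (auto simp: eventually_at_left_field bump_def field_simps intro!: exI[of _ 0])
      ultimately show "((\<lambda>y. (bump Q y - bump Q 1) / (y - 1)) \<longlongrightarrow> 0) (at_left 1)"
        by (auto elim!: Lim_transform_eventually)
      show "((\<lambda>y. (bump Q y - bump Q 1) / (y - 1)) \<longlongrightarrow> 0) (at_right 1)"
        by (intro tendsto_eventually) (auto simp: eventually_at_right_field bump_def intro!: exI[of _ 2])
    qed
    then show ?thesis using 3 by (simp add: has_field_derivative_iff bump_def)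
  qed
qed

lemma continuous_bump [continuous_intros]: "continuous_on A f \<Longrightarrow> continuous_on A (\<lambda>x. bump Q (f x))"
  by (rule continuous_on_compose2[of UNIV "bump Q"])
     (auto intro!: DERIV_continuous_on has_real_derivative_bump[THEN DERIV_subset])

lemma borel_measurable_bump [measurable]: "bump Q \<in> borel_measurable borel"
  by (intro borel_measurable_continuous_onI continuous_intros)

lemma bump_uminus: "bump (- Q) s = - bump Q s"
  by (simp add: bump_def)

lemma bump_deriv_1: "bump_deriv 1 = - [:0, 0, 1:]"
  by (simp add: bump_deriv_def)

lemma bump_deriv_uminus: "bump_deriv (- Q) = - bump_deriv Q"
  by (simp add: bump_deriv_def pderiv_minus algebra_simps)

text \<open>The two members of the family that are used are the standard bump $e^{-z}$ and, up to the sign, its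
derivative $z^2 e^{-z}$.\<close>
abbreviation "profile \<equiv> bump 1"
abbreviation "mollifier \<equiv> bump [:0, 0, 1:]"

text \<open>For $0 \le s < 1$ one has $z \ge 1$. This trivial inequality later bounds \<open>pot\<close> by \<open>moll\<close>, which
turns the mean value formula in the maximum principle into a differential inequality.\<close>
lemma profile_le_mollifier: "s \<ge> 0 \<Longrightarrow> profile s \<le> mollifier s"
proof -
  assume s: "s \<ge> 0"
  have "1 \<le> 1 / (1 - s)" if "s < 1" using that s by (simp add: field_simps)
  then have "1 * exp (- (1 / (1 - s))) \<le> 1 / (1 - s) * (1 / (1 - s)) * exp (- (1 / (1 - s)))" if "s < 1"
    using that mult_mono[of 1 "1/(1-s)" 1 "1/(1-s)"] by (intro mult_right_mono) auto
  then show ?thesis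
    by (auto simp: bump_def)
qed

lemma profile_bounds: "0 \<le> profile s" "profile s \<le> 1"
  by (auto simp: bump_def)

lemma mollifier_nonneg: "0 \<le> mollifier s"
  by (auto simp: bump_def)

lemma mollifier_pos: "s < 1 \<Longrightarrow> 0 < mollifier s"
  by (auto simp: bump_def)

lemma bump_eq_0: "s \<ge> 1 \<Longrightarrow> bump Q s = 0"
  by (simp add: bump_def)

lemma Ck_differentiable: "Ck_function (Suc k) f \<Longrightarrow> (f has_derivative frechet_derivative f (at x)) (at x)"
  by (simp add: frechet_derivative_works)

lemma Ck_function_Suc_imp: "Ck_function (Suc k) f \<Longrightarrow> Ck_function k f"
proof (induction k arbitrary: f)
  case 0 then show ?case by (auto intro: differentiable_imp_continuous_on simp: differentiable_on_def)
next
  case (Suc k) then show ?case by simp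
qed

lemma Ck_function_const: "Ck_function k (\<lambda>_. c)"
  by (induction k arbitrary: c) (auto simp: frechet_derivative_const)

lemma Ck_function_add: "Ck_function k f \<Longrightarrow> Ck_function k g \<Longrightarrow> Ck_function k (\<lambda>x. f x + g x)"
proof (induction k arbitrary: f g)
  case (Suc k)
  have "frechet_derivative (\<lambda>x. f x + g x) (at x) = (\<lambda>h. frechet_derivative f (at x) h + frechet_derivative g (at x) h)" for x
    by (rule frechet_derivative_at[symmetric]) (intro has_derivative_add Ck_differentiable[OF Suc.prems(1)] Ck_differentiable[OF Suc.prems(2)])
  with Suc show ?case by auto
qed (auto intro: continuous_intros)

lemma Ck_function_mult: "Ck_function k f \<Longrightarrow> Ck_function k g \<Longrightarrow> Ck_function k (\<lambda>x. f x * g x)"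
proof (induction k arbitrary: f g)
  case (Suc k)
  have "frechet_derivative (\<lambda>x. f x * g x) (at x) = (\<lambda>h. f x * frechet_derivative g (at x) h + frechet_derivative f (at x) h * g x)" for x
    by (rule frechet_derivative_at[symmetric]) (intro has_derivative_mult Ck_differentiable[OF Suc.prems(1)] Ck_differentiable[OF Suc.prems(2)])
  with Suc Ck_function_Suc_imp[OF Suc.prems(1)] Ck_function_Suc_imp[OF Suc.prems(2)] show ?case
    by (auto intro!: Ck_function_add Suc.IH)
qed (auto intro: continuous_intros)

lemma Ck_function_inner: "Ck_function k (\<lambda>x. (x - a) \<bullet> b)"
proof (cases k)
  case (Suc m)
  have "frechet_derivative (\<lambda>x. (x - a) \<bullet> b) (at x) = (\<lambda>h. h \<bullet> b)" for x
    by (rule frechet_derivative_at[symmetric]) (auto intro!: derivative_eq_intros)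
  then show ?thesis using Suc by (auto simp: Ck_function_const)
qed (auto intro!: continuous_intros)

abbreviation (input) scaled_bump where
  "scaled_bump Q x t y \<equiv> bump Q ((norm (y - x))\<^sup>2 / t\<^sup>2)"

lemma has_derivative_scaled_bump:
  fixes x y :: "'a::euclidean_space"
  assumes t: "t > 0"
  shows "((\<lambda>y. scaled_bump Q x t y) has_derivative (\<lambda>h. scaled_bump (bump_deriv Q) x t y * (2 / t\<^sup>2 * ((y - x) \<bullet> h)))) (at y)"
proof -
  have "((\<lambda>y. (y - x) \<bullet> (y - x)) has_derivative (\<lambda>h. 2 * ((y - x) \<bullet> h))) (at y)"
    by (auto intro!: derivative_eq_intros simp: inner_commute)
  from has_derivative_mult_right[OF this, of "1 / t\<^sup>2"]
  have "((\<lambda>y. (y - x) \<bullet> (y - x) / t\<^sup>2) has_derivative (\<lambda>h. 2 / t\<^sup>2 * ((y - x) \<bullet> h))) (at y)"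
    using t by simp
  from DERIV_compose_FDERIV[OF has_real_derivative_bump this]
  show ?thesis by (simp add: power2_norm_eq_inner mult.commute)
qed

lemma frechet_derivative_scaled_bump:
  fixes x y :: "'a::euclidean_space"
  assumes t: "t > 0"
  shows "frechet_derivative (\<lambda>y. c * scaled_bump Q x t y) (at y) h = c * (scaled_bump (bump_deriv Q) x t y * (2 / t\<^sup>2 * ((y - x) \<bullet> h)))"
  by (subst frechet_derivative_at[symmetric, OF has_derivative_mult_right[OF has_derivative_scaled_bump[OF t]]]) simp

lemma Ck_function_scaled_bump:
  fixes x :: "'a::euclidean_space"
  assumes t: "t > 0"
  shows "Ck_function k (\<lambda>y. scaled_bump Q x t y)"
proof (induction k arbitrary: Q)
  case 0 show ?case using t by (auto intro!: continuous_intros)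
next
  case (Suc k)
  have d: "frechet_derivative (\<lambda>y. scaled_bump Q x t y) (at y) h = scaled_bump (bump_deriv Q) x t y * (2 / t\<^sup>2 * ((y - x) \<bullet> h))" for y h
    using frechet_derivative_scaled_bump[OF t, of 1] by simp
  show ?case
    unfolding Ck_function.simps d
    by (intro conjI allI ballI differentiableI[OF has_derivative_scaled_bump[OF t]]
      Suc.IH Ck_function_mult Ck_function_const Ck_function_inner)
qed

lemma norm_less_iff_scaled:
  fixes v :: "'a::real_normed_vector"
  shows "t > 0 \<Longrightarrow> (norm v)\<^sup>2 / t\<^sup>2 < 1 \<longleftrightarrow> norm v < t"
  by (auto simp: divide_less_eq intro: power2_less_imp_less power_strict_mono)

lemma test_function_scaled_bump:
  fixes x :: "'a::euclidean_space"
  assumes t: "t > 0"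
  shows "test_function (\<lambda>y. c * scaled_bump Q x t y)"
proof -
  have "{y. c * scaled_bump Q x t y \<noteq> 0} \<subseteq> cball x t"
    by (auto simp: bump_def norm_less_iff_scaled[OF t] dist_norm norm_minus_commute less_imp_le split: if_splits)
  then have "bounded {y. c * scaled_bump Q x t y \<noteq> 0}" using bounded_cball bounded_subset by blast
  then show ?thesis
    by (auto simp: test_function_def intro!: Ck_function_mult Ck_function_const Ck_function_scaled_bump t)
qed

section \<open>The radius derivative of the mollifier is a Laplacian\<close>

definition laplacian :: "('a::euclidean_space \<Rightarrow> real) \<Rightarrow> 'a \<Rightarrow> real" where
  "laplacian \<phi> y = (\<Sum>b\<in>Basis. frechet_derivative (\<lambda>z. frechet_derivative \<phi> (at z) b) (at y) b)"

text \<open>The mollifier of radius \<open>t\<close> centred at \<open>x\<close>. It is not normalized; its integral is the constant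
\<open>moll_mass\<close>.\<close>
definition moll :: "real \<Rightarrow> 'a::euclidean_space \<Rightarrow> 'a \<Rightarrow> real" where
  "moll t x y = scaled_bump [:0,0,1:] x t y / t ^ DIM('a)"

text \<open>The compactly supported function whose Laplacian is the derivative of the mollifier with respect to
the radius. Integrated over the radii below \<open>R\<close> it behaves like a fundamental solution of
$-\Delta$ cut off at distance \<open>R\<close>, but being smooth for every fixed \<open>t\<close> it is an admissible test
function.\<close>
definition pot :: "real \<Rightarrow> 'a::euclidean_space \<Rightarrow> 'a \<Rightarrow> real" where
  "pot t x y = t / (2 * t ^ DIM('a)) * scaled_bump 1 x t y"

lemma second_derivative_scaled_bump:
  fixes x y :: "'a::euclidean_space"
  assumes t: "t > 0"
  shows "frechet_derivative (\<lambda>y. c * (scaled_bump Q x t y * (2 / t\<^sup>2 * ((y - x) \<bullet> b)))) (at y) b =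
     c * (scaled_bump (bump_deriv Q) x t y * (2 / t\<^sup>2 * ((y - x) \<bullet> b))\<^sup>2 + scaled_bump Q x t y * (2 / t\<^sup>2 * (b \<bullet> b)))"
proof -
  have "((\<lambda>y. c * (scaled_bump Q x t y * (2 / t\<^sup>2 * ((y - x) \<bullet> b)))) has_derivative
     (\<lambda>h. c * (scaled_bump Q x t y * (2 / t\<^sup>2 * (h \<bullet> b)) + scaled_bump (bump_deriv Q) x t y * (2 / t\<^sup>2 * ((y - x) \<bullet> h)) * (2 / t\<^sup>2 * ((y - x) \<bullet> b))))) (at y)"
    by (intro has_derivative_mult_right has_derivative_mult[OF has_derivative_scaled_bump[OF t]])
       (auto intro!: derivative_eq_intros)
  from fun_cong[OF frechet_derivative_at[OF this, symmetric], of b] show ?thesis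
    by (simp only: power2_eq_square mult.assoc add.commute)
qed

lemma laplacian_pot_eq:
  fixes x y :: "'a::euclidean_space"
  assumes t: "t > 0"
  shows "laplacian (pot t x) y = - (t / (2 * t ^ DIM('a)) * (scaled_bump (bump_deriv [:0,0,1:]) x t y * (4 / t^4 * (norm (y - x))\<^sup>2) + scaled_bump [:0,0,1:] x t y * (2 * DIM('a) / t\<^sup>2)))"
proof -
  let ?r = "(norm (y - x))\<^sup>2"
  have "laplacian (pot t x) y = (\<Sum>b\<in>Basis. t / (2 * t ^ DIM('a)) *
      (scaled_bump (bump_deriv (bump_deriv 1)) x t y * (2 / t\<^sup>2 * ((y - x) \<bullet> b))\<^sup>2 + scaled_bump (bump_deriv 1) x t y * (2 / t\<^sup>2 * (b \<bullet> b))))"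
    unfolding laplacian_def pot_def[abs_def]
    by (simp only: frechet_derivative_scaled_bump[OF t] second_derivative_scaled_bump[OF t])
  also have "\<dots> = t / (2 * t ^ DIM('a)) * (scaled_bump (bump_deriv (bump_deriv 1)) x t y * (4 / t^4 * ?r) + scaled_bump (bump_deriv 1) x t y * (2 * DIM('a) / t\<^sup>2))"
  proof -
    have r: "?r = (\<Sum>b\<in>Basis. ((y - x) \<bullet> b)\<^sup>2)"
      unfolding power2_norm_eq_inner by (subst euclidean_inner) (simp add: power2_eq_square)
    have "(\<Sum>b\<in>Basis. A * (B * (2 / t\<^sup>2 * ((y - x) \<bullet> b))\<^sup>2 + C * (2 / t\<^sup>2 * (b \<bullet> b)))) =
      A * (B * (4 / t^4 * ?r) + C * (2 * DIM('a) / t\<^sup>2))" for A B C :: real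
    proof -
      have "(\<Sum>b\<in>Basis. A * (B * (2 / t\<^sup>2 * ((y - x) \<bullet> b))\<^sup>2 + C * (2 / t\<^sup>2 * (b \<bullet> b)))) =
        (\<Sum>b\<in>Basis. A * (B * (4 / t^4 * ((y - x) \<bullet> b)\<^sup>2) + C * (2 / t\<^sup>2)))"
        by (intro sum.cong) (simp_all add: power_mult_distrib power_divide)
      also have "\<dots> = A * (B * (4 / t^4 * ?r) + C * (2 * DIM('a) / t\<^sup>2))"
        unfolding r by (simp only: sum_distrib_left[symmetric] sum.distrib) simp
      finally show ?thesis .
    qed
    then show ?thesis .
  qed
  also have "\<dots> = - (t / (2 * t ^ DIM('a)) * (scaled_bump (bump_deriv [:0,0,1:]) x t y * (4 / t^4 * ?r) + mollifier (?r/t\<^sup>2) * (2 * DIM('a) / t\<^sup>2)))"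
    unfolding bump_deriv_1 bump_uminus bump_deriv_uminus by (simp del: minus_pCons add: algebra_simps)
  finally show ?thesis .
qed

lemma continuous_on_laplacian_pot:
  fixes x :: "'a::euclidean_space"
  shows "continuous_on ({0<..} \<times> UNIV) (\<lambda>(t, y). - (t / (2 * t ^ DIM('a)) * (scaled_bump (bump_deriv [:0,0,1:]) x t y * (4 / t^4 * (norm (y - x))\<^sup>2) + scaled_bump [:0,0,1:] x t y * (2 * DIM('a) / t\<^sup>2))))"
  unfolding case_prod_beta by (intro continuous_intros) auto

text \<open>Conceptually: $\nabla_y\, pot_t = - \frac{y-x}{t}\, moll_t$ by the relation between \<open>profile\<close> and
\<open>mollifier\<close>, and the divergence of $-\frac{y-x}{t}\, moll_t$ is $\partial_t\, moll_t$ because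
$moll_t$ is homogeneous of degree $-N$ in $(y - x, t)$. Hence for a solution of $-\Delta u = f$ the
derivative of the mollification of \<open>u\<close> in the radius is explicitly known in terms of \<open>f\<close>.\<close>
lemma moll_derivative_eq_laplacian_pot:
  fixes x y :: "'a::euclidean_space"
  assumes t: "t > 0"
  shows "((\<lambda>t. moll t x y) has_real_derivative laplacian (pot t x) y) (at t)"
proof -
  let ?r = "(norm (y - x))\<^sup>2"
  note L = laplacian_pot_eq[OF t, of x y]
  have pw: "t ^ DIM('a) = t * t ^ (DIM('a) - 1)" by (metis DIM_positive power_eq_if not_gr_zero)
  have "((\<lambda>t. ?r / t\<^sup>2) has_real_derivative - (2 * ?r / t^3)) (at t)"
    using t by (auto intro!: derivative_eq_intros simp: power2_eq_square power3_eq_cube field_simps)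
  from DERIV_chain2[OF has_real_derivative_bump this]
  have "((\<lambda>t. mollifier (?r / t\<^sup>2)) has_real_derivative bump (bump_deriv [:0,0,1:]) (?r/t\<^sup>2) * - (2 * ?r / t^3)) (at t)" .
  from DERIV_divide[OF this, of "\<lambda>t. t ^ DIM('a)" "DIM('a) * t ^ (DIM('a) - 1)"]
  have "((\<lambda>t. moll t x y) has_real_derivative (bump (bump_deriv [:0,0,1:]) (?r/t\<^sup>2) * - (2 * ?r / t^3) * t ^ DIM('a)
     - mollifier (?r / t\<^sup>2) * (DIM('a) * t ^ (DIM('a) - 1))) / (t ^ DIM('a) * t ^ DIM('a))) (at t)"
    unfolding moll_def using t by (auto intro!: derivative_eq_intros)
  moreover have "(bump (bump_deriv [:0,0,1:]) (?r/t\<^sup>2) * - (2 * ?r / t^3) * t ^ DIM('a)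
     - mollifier (?r / t\<^sup>2) * (DIM('a) * t ^ (DIM('a) - 1))) / (t ^ DIM('a) * t ^ DIM('a)) = laplacian (pot t x) y"
    unfolding L pw using t by (simp add: field_simps power2_eq_square power3_eq_cube power4_eq_xxxx)
  ultimately show ?thesis by simp
qed

section \<open>Locally integrable functions\<close>

definition loc_int :: "('a::euclidean_space \<Rightarrow> real) \<Rightarrow> bool" where
  "loc_int f \<longleftrightarrow> f \<in> borel_measurable borel \<and> (\<forall>r. integrable lborel (\<lambda>y. indicator (cball 0 r) y * f y))"

lemma loc_int_measurable [measurable_dest]: "loc_int f \<Longrightarrow> f \<in> borel_measurable borel"
  by (simp add: loc_int_def)

lemma integrable_imp_loc_int: "integrable lborel f \<Longrightarrow> loc_int f"
  using integrable_real_mult_indicator[of "cball 0 _" lborel f] by (auto simp: loc_int_def mult.commute)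

lemma loc_int_const: "loc_int (\<lambda>_. c)"
proof -
  have "integrable lborel (\<lambda>y. indicator (cball (0::'a) r) y * c)" for r
    using emeasure_bounded_finite[of "cball (0::'a) r"]
    by (intro integrable_mult_left integrable_real_indicator) auto
  then show ?thesis by (auto simp: loc_int_def)
qed

lemma loc_int_add: "loc_int f \<Longrightarrow> loc_int g \<Longrightarrow> loc_int (\<lambda>x. f x + g x)"
  by (auto simp: loc_int_def distrib_left)

lemma loc_int_diff: "loc_int f \<Longrightarrow> loc_int g \<Longrightarrow> loc_int (\<lambda>x. f x - g x)"
  by (auto simp: loc_int_def right_diff_distrib)

lemma loc_int_cmult: "loc_int f \<Longrightarrow> loc_int (\<lambda>x. c * f x)"
proof -
  assume f: "loc_int f"
  then show "loc_int (\<lambda>x. c * f x)"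
    unfolding loc_int_def by (auto simp: mult.left_commute[of _ c])
qed

lemma loc_int_abs: "loc_int f \<Longrightarrow> loc_int (\<lambda>x. \<bar>f x\<bar>)"
proof -
  assume f: "loc_int f"
  have "indicator (cball 0 r) y * \<bar>f y\<bar> = \<bar>indicator (cball 0 r) y * f y\<bar>" for r y by (auto simp: indicator_def)
  then show "loc_int (\<lambda>x. \<bar>f x\<bar>)" using f by (auto simp: loc_int_def)
qed

lemma loc_int_bound:
  fixes f :: "'a::euclidean_space \<Rightarrow> real"
  assumes g: "loc_int g" and [measurable]: "f \<in> borel_measurable borel" and "AE x in lborel. \<bar>f x\<bar> \<le> g x"
  shows "loc_int f"
  unfolding loc_int_def
proof (intro conjI allI)
  fix r
  have [measurable]: "cball (0::'a) r \<in> sets borel" by simp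
  show "integrable lborel (\<lambda>y. indicator (cball 0 r) y * f y)"
  proof (rule Bochner_Integration.integrable_bound)
    show "integrable lborel (\<lambda>y. indicator (cball 0 r) y * g y)" using g by (auto simp: loc_int_def)
    show "AE x in lborel. norm (indicator (cball 0 r) x * f x) \<le> norm (indicator (cball 0 r) x * g x)"
      using assms(3) by eventually_elim (auto simp: indicator_def)
  qed measurable
qed fact

lemma square_integrable_imp_loc_int:
  assumes [measurable]: "f \<in> borel_measurable borel" and "integrable lborel (\<lambda>x. (f x)\<^sup>2)"
  shows "loc_int f"
proof (rule loc_int_bound)
  show "loc_int (\<lambda>x. 1 + (f x)\<^sup>2)"
    by (intro loc_int_add loc_int_const integrable_imp_loc_int assms)
  show "AE x in lborel. \<bar>f x\<bar> \<le> 1 + (f x)\<^sup>2"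
  proof (rule AE_I2)
    fix x show "\<bar>f x\<bar> \<le> 1 + (f x)\<^sup>2"
      using zero_le_power2[of "\<bar>f x\<bar> - 1"] zero_le_power2[of "f x"] by (simp add: power2_diff del: zero_le_power2)
  qed
qed measurable

lemma compactly_supported_bounded:
  fixes \<phi> :: "'a::euclidean_space \<Rightarrow> real"
  assumes "continuous_on UNIV \<phi>" and "\<And>y. r < norm y \<Longrightarrow> \<phi> y = 0"
  obtains B where "B \<ge> 0" "\<And>y. \<bar>\<phi> y\<bar> \<le> B"
proof -
  have "compact (\<phi> ` cball 0 r)"
    by (intro compact_continuous_image continuous_on_subset[OF assms(1)]) auto
  then obtain B where B: "\<And>y. y \<in> cball 0 r \<Longrightarrow> \<bar>\<phi> y\<bar> \<le> B"
    by (metis bounded_iff compact_imp_bounded image_eqI real_norm_def)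
  have "\<bar>\<phi> y\<bar> \<le> max 0 B" for y
    using B[of y] assms(2)[of y] by (cases "norm y \<le> r") auto
  then show ?thesis by (intro that[of "max 0 B"]) auto
qed

lemma loc_int_mult_compact:
  fixes \<phi> :: "'a::euclidean_space \<Rightarrow> real"
  assumes f: "loc_int f" and c: "continuous_on UNIV \<phi>" and s: "\<And>y. r < norm y \<Longrightarrow> \<phi> y = 0"
  shows "integrable lborel (\<lambda>y. \<phi> y * f y)"
proof -
  obtain B where B: "B \<ge> 0" "\<And>y. \<bar>\<phi> y\<bar> \<le> B" using compactly_supported_bounded[OF c s] by blast
  have [measurable]: "f \<in> borel_measurable borel" "\<phi> \<in> borel_measurable borel"
    using f c by (auto intro: borel_measurable_continuous_onI)
  show ?thesis
  proof (rule Bochner_Integration.integrable_bound)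
    show "integrable lborel (\<lambda>y. B * (indicator (cball 0 r) y * f y))"
      using f by (intro integrable_mult_right) (auto simp: loc_int_def)
    show "AE y in lborel. norm (\<phi> y * f y) \<le> norm (B * (indicator (cball 0 r) y * f y))"
    proof (rule AE_I2)
      fix y show "norm (\<phi> y * f y) \<le> norm (B * (indicator (cball 0 r) y * f y))"
        using s[of y] B by (cases "norm y \<le> r") (auto simp: abs_mult intro!: mult_right_mono)
    qed
  qed measurable
qed

lemma tendsto_integral_compact_support:
  fixes \<phi> :: "nat \<Rightarrow> 'a::euclidean_space \<Rightarrow> real"
  assumes f: "loc_int f"
    and m[measurable]: "\<And>n. \<phi> n \<in> borel_measurable borel" "\<psi> \<in> borel_measurable borel"
    and bd: "\<And>n y. \<bar>\<phi> n y\<bar> \<le> B"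
    and s: "\<And>n y. r < norm y \<Longrightarrow> \<phi> n y = 0"
    and lim: "\<And>y. (\<lambda>n. \<phi> n y) \<longlonglongrightarrow> \<psi> y"
  shows "(\<lambda>n. \<integral>y. \<phi> n y * f y \<partial>lborel) \<longlonglongrightarrow> (\<integral>y. \<psi> y * f y \<partial>lborel)"
proof (rule integral_dominated_convergence[where w="\<lambda>y. B * \<bar>indicator (cball 0 r) y * f y\<bar>"])
  have [measurable]: "f \<in> borel_measurable borel" using f by measurable
  have B: "B \<ge> 0" using bd[of 0 0] by (rule order_trans[OF abs_ge_zero])
  show "(\<lambda>y. \<psi> y * f y) \<in> borel_measurable lborel" "(\<lambda>y. \<phi> n y * f y) \<in> borel_measurable lborel" for n
    by measurable
  show "integrable lborel (\<lambda>y. B * \<bar>indicator (cball 0 r) y * f y\<bar>)"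
    using f by (intro integrable_mult_right integrable_abs) (auto simp: loc_int_def)
  show "AE y in lborel. (\<lambda>n. \<phi> n y * f y) \<longlonglongrightarrow> \<psi> y * f y"
    by (intro AE_I2 tendsto_mult lim tendsto_const)
  show "AE y in lborel. norm (\<phi> n y * f y) \<le> B * \<bar>indicator (cball 0 r) y * f y\<bar>" for n
  proof (rule AE_I2)
    fix y show "norm (\<phi> n y * f y) \<le> B * \<bar>indicator (cball 0 r) y * f y\<bar>"
      using s[of y n] bd[of n y] by (cases "norm y \<le> r") (auto simp: abs_mult intro!: mult_right_mono)
  qed
qed

text \<open>The derivative of the kernel is bounded by compactness, so that the difference quotients are
dominated by a multiple of \<open>f\<close> on a ball.\<close>
lemma has_derivative_integral_compact_support:
  fixes \<Phi> \<Psi> :: "real \<Rightarrow> 'a::euclidean_space \<Rightarrow> real"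
  assumes f: "loc_int f" and t: "t \<in> {a<..<b}"
    and d: "\<And>s y. s \<in> {a..b} \<Longrightarrow> ((\<lambda>s. \<Phi> s y) has_real_derivative \<Psi> s y) (at s)"
    and cont: "continuous_on ({a..b} \<times> cball 0 r) (\<lambda>(s, y). \<Psi> s y)"
    and c1: "\<And>s. s \<in> {a..b} \<Longrightarrow> continuous_on UNIV (\<Phi> s)"
    and m[measurable]: "\<Psi> t \<in> borel_measurable borel"
    and s0: "\<And>s y. s \<in> {a..b} \<Longrightarrow> r < norm y \<Longrightarrow> \<Phi> s y = 0"
  shows "((\<lambda>s. \<integral>y. \<Phi> s y * f y \<partial>lborel) has_real_derivative (\<integral>y. \<Psi> t y * f y \<partial>lborel)) (at t)"
proof -
  have int: "integrable lborel (\<lambda>y. \<Phi> s y * f y)" if "s \<in> {a..b}" for s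
    by (rule loc_int_mult_compact[OF f c1[OF that] s0[OF that]])
  have "compact ((\<lambda>(s, y). \<Psi> s y) ` ({a..b} \<times> cball 0 r))"
    by (intro compact_continuous_image cont compact_Times) auto
  then obtain C0 where C0: "\<And>x. x \<in> (\<lambda>(s, y). \<Psi> s y) ` ({a..b} \<times> cball 0 r) \<Longrightarrow> norm x \<le> C0"
    by (metis bounded_iff compact_imp_bounded)
  have C: "\<bar>\<Psi> s y\<bar> \<le> max 0 C0" if "s \<in> {a..b}" "norm y \<le> r" for s y
    using C0[of "\<Psi> s y"] that by force
  have lip: "\<bar>\<Phi> s y - \<Phi> t y\<bar> \<le> max 0 C0 * \<bar>s - t\<bar>" if "s \<in> {a..b}" for s y
  proof (cases "norm y \<le> r")
    case True
    have "norm (\<Phi> s y - \<Phi> t y) \<le> max 0 C0 * norm (s - t)"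
      using t that by (intro field_differentiable_bound[of "{a..b}" "\<lambda>s. \<Phi> s y" "\<lambda>s. \<Psi> s y"])
         (auto intro!: has_field_derivative_at_within d C True simp del: max.bounded_iff)
    then show ?thesis by simp
  next
    case False then show ?thesis using s0[of s y] s0[of t y] t that by auto
  qed
  have "((\<lambda>s. ((\<integral>y. \<Phi> s y * f y \<partial>lborel) - (\<integral>y. \<Phi> t y * f y \<partial>lborel)) / (s - t)) \<longlongrightarrow> (\<integral>y. \<Psi> t y * f y \<partial>lborel)) (at t within {a<..<b})"
    unfolding tendsto_at_iff_sequentially
  proof (intro allI impI)
    fix X :: "nat \<Rightarrow> real" assume X: "\<forall>i. X i \<in> {a<..<b} - {t}" "X \<longlonglongrightarrow> t"
    have Xi: "X i \<in> {a..b}" "X i \<noteq> t" for i using X(1) by (auto dest: spec[of _ i])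
    have [measurable]: "\<Phi> (X i) \<in> borel_measurable borel" "\<Phi> t \<in> borel_measurable borel" for i
      using c1[OF Xi(1)[of i]] c1[of t] t by (auto intro!: borel_measurable_continuous_onI)
    have eq: "((\<lambda>s. ((\<integral>y. \<Phi> s y * f y \<partial>lborel) - (\<integral>y. \<Phi> t y * f y \<partial>lborel)) / (s - t)) \<circ> X) i = (\<integral>y. (\<Phi> (X i) y - \<Phi> t y) / (X i - t) * f y \<partial>lborel)" for i
    proof -
      have "(\<integral>y. \<Phi> (X i) y * f y \<partial>lborel) - (\<integral>y. \<Phi> t y * f y \<partial>lborel) = (\<integral>y. \<Phi> (X i) y * f y - \<Phi> t y * f y \<partial>lborel)"
        using int[OF Xi(1)] int[of t] t by (intro Bochner_Integration.integral_diff[symmetric]) auto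
      also have "\<dots> / (X i - t) = (\<integral>y. (\<Phi> (X i) y * f y - \<Phi> t y * f y) / (X i - t) \<partial>lborel)"
        by (simp add: divide_inverse)
      also have "\<dots> = (\<integral>y. (\<Phi> (X i) y - \<Phi> t y) / (X i - t) * f y \<partial>lborel)"
        by (intro Bochner_Integration.integral_cong) (auto simp: diff_divide_distrib left_diff_distrib)
      finally show ?thesis by simp
    qed
    show "((\<lambda>s. ((\<integral>y. \<Phi> s y * f y \<partial>lborel) - (\<integral>y. \<Phi> t y * f y \<partial>lborel)) / (s - t)) \<circ> X) \<longlonglongrightarrow> (\<integral>y. \<Psi> t y * f y \<partial>lborel)"
      unfolding eq[abs_def]
    proof (rule tendsto_integral_compact_support[OF f, where B="max 0 C0" and r=r])
      show "\<bar>(\<Phi> (X n) y - \<Phi> t y) / (X n - t)\<bar> \<le> max 0 C0" for n y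
        using lip[OF Xi(1)[of n], of y] Xi(2)[of n] by (simp add: abs_divide divide_le_eq del: max.bounded_iff le_max_iff_disj)
      show "(\<Phi> (X n) y - \<Phi> t y) / (X n - t) = 0" if "r < norm y" for n y
        using s0[OF Xi(1) that] s0[of t, OF _ that] t by simp
      show "(\<lambda>n. (\<Phi> (X n) y - \<Phi> t y) / (X n - t)) \<longlonglongrightarrow> \<Psi> t y" for y
      proof -
        have "((\<lambda>s. (\<Phi> s y - \<Phi> t y) / (s - t)) \<longlongrightarrow> \<Psi> t y) (at t)"
          using d[of t y] t by (auto simp: has_field_derivative_iff)
        then show ?thesis
          unfolding tendsto_at_iff_sequentially using X by (auto simp: o_def)
      qed
    qed measurable
  qed
  then show ?thesis
    using t by (simp add: has_field_derivative_iff at_within_open[of t "{a<..<b}"])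
qed

section \<open>Mollification\<close>

definition mean :: "real \<Rightarrow> ('a::euclidean_space \<Rightarrow> real) \<Rightarrow> 'a \<Rightarrow> real" where
  "mean t f x = (\<integral>y. moll t x y * f y \<partial>lborel)"

definition moll_mass :: "'a::euclidean_space itself \<Rightarrow> real" where
  "moll_mass _ = (\<integral>z. mollifier ((norm (z::'a))\<^sup>2) \<partial>lborel)"

lemma continuous_scaled_bump: "continuous_on UNIV (\<lambda>y. scaled_bump Q x t y)"
  by (cases "t = 0") (auto intro!: continuous_intros)

lemma scaled_bump_eq_0:
  "t > 0 \<Longrightarrow> t \<le> norm (y - x) \<Longrightarrow> scaled_bump Q x t y = 0"
  using norm_less_iff_scaled[of t "y - x"] by (simp add: bump_def)

lemma scaled_bump_support:
  assumes "t > 0" "norm x + t < norm y" shows "scaled_bump Q x t y = 0"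
  using assms norm_triangle_ineq2[of y x] by (intro scaled_bump_eq_0) auto

lemma moll_nonneg: "t > 0 \<Longrightarrow> 0 \<le> moll t x y" by (simp add: moll_def mollifier_nonneg)
lemma pot_nonneg: "t > 0 \<Longrightarrow> 0 \<le> pot t x y" by (simp add: pot_def profile_bounds)
lemma pot_le_moll: "t > 0 \<Longrightarrow> pot t x y \<le> t / 2 * moll t x y"
  unfolding pot_def moll_def using profile_le_mollifier[of "(norm (y - x))\<^sup>2 / t\<^sup>2"]
  by (simp add: field_simps)
lemma continuous_moll: "t > 0 \<Longrightarrow> continuous_on UNIV (moll t x)"
  unfolding moll_def[abs_def] by (intro continuous_intros continuous_scaled_bump) auto
lemma continuous_pot: "t > 0 \<Longrightarrow> continuous_on UNIV (pot t x)"
  unfolding pot_def[abs_def] by (intro continuous_intros continuous_scaled_bump) auto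
lemma moll_eq_0: "t > 0 \<Longrightarrow> t \<le> norm (y - x) \<Longrightarrow> moll t x y = 0" by (simp add: moll_def scaled_bump_eq_0)
lemma pot_eq_0: "t > 0 \<Longrightarrow> t \<le> norm (y - x) \<Longrightarrow> pot t x y = 0" by (simp add: pot_def scaled_bump_eq_0)
lemma moll_support: "t > 0 \<Longrightarrow> norm x + t < norm y \<Longrightarrow> moll t x y = 0" by (simp add: moll_def scaled_bump_support)
lemma pot_support: "t > 0 \<Longrightarrow> norm x + t < norm y \<Longrightarrow> pot t x y = 0" by (simp add: pot_def scaled_bump_support)
lemma moll_pos: "t > 0 \<Longrightarrow> norm (y - x) < t \<Longrightarrow> 0 < moll t x y"
  using mollifier_pos[of "(norm (y - x))\<^sup>2 / t\<^sup>2"] norm_less_iff_scaled[of t "y - x"] by (simp add: moll_def)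
lemma pot_commute: "pot t x y = pot t y x" by (simp add: pot_def norm_minus_commute)

lemma test_function_moll: "t > 0 \<Longrightarrow> test_function (moll t x)"
  using test_function_scaled_bump[of t "1 / t ^ DIM('a)" "[:0,0,1:]" x] unfolding moll_def[abs_def] by simp
lemma test_function_pot: "t > 0 \<Longrightarrow> test_function (pot t x)"
  using test_function_scaled_bump[of t "t / (2 * t ^ DIM('a))" 1 x] unfolding pot_def[abs_def] by simp

lemma measurable_moll [measurable]:
  "(\<lambda>(x, y). moll t x y) \<in> borel_measurable (borel \<Otimes>\<^sub>M (borel :: 'a::euclidean_space measure))"
  "moll t x \<in> borel_measurable (borel :: 'a::euclidean_space measure)"
  unfolding moll_def[abs_def] by measurable

lemma measurable_pot [measurable]:
  "(\<lambda>(x, y). pot t x y) \<in> borel_measurable (borel \<Otimes>\<^sub>M (borel :: 'a::euclidean_space measure))"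
  "pot t x \<in> borel_measurable (borel :: 'a::euclidean_space measure)"
  "(\<lambda>(t, y). pot t x y) \<in> borel_measurable (borel \<Otimes>\<^sub>M (borel :: 'a::euclidean_space measure))"
  unfolding pot_def[abs_def] by measurable

lemma integrable_moll: "loc_int f \<Longrightarrow> t > 0 \<Longrightarrow> integrable lborel (\<lambda>y. moll t x y * f y)"
  by (rule loc_int_mult_compact[OF _ continuous_moll moll_support])
lemma integrable_pot: "loc_int f \<Longrightarrow> t > 0 \<Longrightarrow> integrable lborel (\<lambda>y. pot t x y * f y)"
  by (rule loc_int_mult_compact[OF _ continuous_pot pot_support])

lemma integrable_mollifier: "integrable lborel (\<lambda>z::'a::euclidean_space. mollifier ((norm z)\<^sup>2))"
  using integrable_moll[OF loc_int_const[of 1], of 1 "0::'a"] by (simp add: moll_def)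

lemma moll_mass_pos: "0 < moll_mass TYPE('a::euclidean_space)"
proof -
  have "(\<integral>z. mollifier ((norm (z::'a))\<^sup>2) \<partial>lborel) \<noteq> 0"
  proof
    assume "(\<integral>z. mollifier ((norm (z::'a))\<^sup>2) \<partial>lborel) = 0"
    then have "AE z in lborel. mollifier ((norm (z::'a))\<^sup>2) = 0"
      by (subst (asm) integral_nonneg_eq_0_iff_AE[OF integrable_mollifier]) (auto simp: mollifier_nonneg)
    then have "AE z in lborel. z \<notin> ball (0::'a) 1"
    proof eventually_elim
      case (elim z)
      then show ?case using mollifier_pos[of "(norm z)\<^sup>2"] by (auto simp: power_less_one_iff)
    qed
    then have "ball (0::'a) 1 \<in> null_sets lborel"
      by (subst AE_iff_null_sets) auto
    then have "unit_ball_vol (real DIM('a)) = 0" by (simp add: null_sets_def emeasure_ball)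
    then show False using unit_ball_vol_pos[of "real DIM('a)"] by simp
  qed
  moreover have "0 \<le> moll_mass TYPE('a)" unfolding moll_mass_def by (intro Bochner_Integration.integral_nonneg mollifier_nonneg)
  ultimately show ?thesis unfolding moll_mass_def by simp
qed

text \<open>After rescaling, the mollification is an average of translates of \<open>f\<close> with weights independent of
the radius.\<close>
lemma mean_eq:
  fixes f :: "'a::euclidean_space \<Rightarrow> real"
  assumes [measurable]: "f \<in> borel_measurable borel" and t: "t > 0"
  shows "mean t f x = (\<integral>z. mollifier ((norm z)\<^sup>2) * f (x + t *\<^sub>R z) \<partial>lborel)"
proof -
  have "mean t f x = t ^ DIM('a) * (\<integral>z. moll t x (x + t *\<^sub>R z) * f (x + t *\<^sub>R z) \<partial>lborel)"
    unfolding mean_def by (subst integral_lborel_affine[OF _ t, of _ x]) auto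
  also have "\<dots> = (\<integral>z. t ^ DIM('a) * (moll t x (x + t *\<^sub>R z) * f (x + t *\<^sub>R z)) \<partial>lborel)"
    by simp
  also have "\<dots> = (\<integral>z. mollifier ((norm z)\<^sup>2) * f (x + t *\<^sub>R z) \<partial>lborel)"
    using t by (intro Bochner_Integration.integral_cong) (auto simp: moll_def power_mult_distrib)
  finally show ?thesis .
qed

lemma integral_moll:
  fixes x :: "'a::euclidean_space"
  shows "t > 0 \<Longrightarrow> (\<integral>y. moll t x y \<partial>lborel) = moll_mass TYPE('a)"
  using mean_eq[of "\<lambda>_. 1" t x] by (simp add: mean_def moll_mass_def)

lemma mean_cong:
  assumes "t > 0" "AE y in lborel. norm (y - x) < t \<longrightarrow> f y = g y"
    and [measurable]: "f \<in> borel_measurable borel" "g \<in> borel_measurable borel"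
  shows "mean t f x = mean t g x"
  unfolding mean_def
proof (rule integral_cong_AE)
  show "AE y in lborel. moll t x y * f y = moll t x y * g y"
    using assms(2) by eventually_elim (use moll_eq_0[OF assms(1)] in \<open>auto simp: not_less\<close>)
qed measurable

lemma mean_diff: "loc_int f \<Longrightarrow> loc_int g \<Longrightarrow> t > 0 \<Longrightarrow> mean t (\<lambda>x. f x - g x) x = mean t f x - mean t g x"
  unfolding mean_def right_diff_distrib by (intro Bochner_Integration.integral_diff integrable_moll)

lemma measurable_mean [measurable]:
  assumes [measurable]: "f \<in> borel_measurable borel"
  shows "mean t f \<in> borel_measurable borel"
  unfolding mean_def[abs_def] by measurable

text \<open>By Fubini's theorem the $L^1$ distance is at most the average of
$\tau(t_n z) = \|f(\cdot + t_n z) - f\|_1$ against the fixed mollifier, and \<open>translation_L1_continuous\<close> together with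
dominated convergence applies.\<close>
theorem mean_tendsto_L1:
  fixes f :: "'a::euclidean_space \<Rightarrow> real"
  assumes f: "integrable lborel f" and t: "\<And>n. t n > 0" "t \<longlonglongrightarrow> 0"
  shows "integrable lborel (\<lambda>x. mean (t n) f x - moll_mass TYPE('a) * f x)"
    and "(\<lambda>n. \<integral>x. \<bar>mean (t n) f x - moll_mass TYPE('a) * f x\<bar> \<partial>lborel) \<longlonglongrightarrow> 0"
proof -
  have [measurable]: "f \<in> borel_measurable borel" using f by auto
  let ?Z = "moll_mass TYPE('a)"
  let ?k = "\<lambda>z::'a. mollifier ((norm z)\<^sup>2)"
  define \<tau> where "\<tau> h = (\<integral>x. \<bar>f (x + h) - f x\<bar> \<partial>lborel)" for h
  have ftr: "integrable lborel (\<lambda>x. f (x + h))" for h using f integral_lborel_translate(2)[of f h] by simp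
  have tau_nn: "(\<integral>\<^sup>+x. ennreal \<bar>f (x + h) - f x\<bar> \<partial>lborel) = ennreal (\<tau> h)" for h
    unfolding \<tau>_def using f ftr[of h] by (intro nn_integral_eq_integral) auto
  have tau_bd: "\<tau> h \<le> 2 * (\<integral>x. \<bar>f x\<bar> \<partial>lborel)" for h
  proof -
    have "\<tau> h \<le> (\<integral>x. \<bar>f (x + h)\<bar> + \<bar>f x\<bar> \<partial>lborel)"
      unfolding \<tau>_def using f ftr[of h] by (intro integral_mono) auto
    also have "\<dots> = (\<integral>x. \<bar>f (x + h)\<bar> \<partial>lborel) + (\<integral>x. \<bar>f x\<bar> \<partial>lborel)"
      using f ftr[of h] by simp
    also have "(\<integral>x. \<bar>f (x + h)\<bar> \<partial>lborel) = (\<integral>x. \<bar>f x\<bar> \<partial>lborel)"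
      by (rule integral_lborel_translate(1)[of "\<lambda>x. \<bar>f x\<bar>"]) measurable
    finally show ?thesis by simp
  qed
  have tau_nonneg: "\<tau> h \<ge> 0" for h unfolding \<tau>_def by auto
  have [measurable]: "\<tau> \<in> borel_measurable borel" unfolding \<tau>_def by measurable
  have k0: "?k z = 0" if "1 < norm z" for z
    using that by (intro bump_eq_0) (simp add: one_le_power)
  have kc: "continuous_on UNIV ?k" by (intro continuous_intros)
  obtain B where B: "B \<ge> 0" "\<And>z. \<bar>?k z\<bar> \<le> B"
    using compactly_supported_bounded[OF kc k0] by blast
  have bound: "(\<integral>\<^sup>+x. ennreal \<bar>mean (t n) f x - ?Z * f x\<bar> \<partial>lborel) \<le> (\<integral>\<^sup>+z. ennreal (?k z * \<tau> (t n *\<^sub>R z)) \<partial>lborel)" for n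
  proof -
    have "(\<integral>\<^sup>+x. ennreal \<bar>mean (t n) f x - ?Z * f x\<bar> \<partial>lborel) \<le>
      (\<integral>\<^sup>+x. \<integral>\<^sup>+z. ennreal (?k z) * ennreal \<bar>f (x + t n *\<^sub>R z) - f x\<bar> \<partial>lborel \<partial>lborel)"
    proof (rule nn_integral_mono)
      fix x
      have i1: "integrable lborel (\<lambda>z. ?k z * f (x + t n *\<^sub>R z))"
      proof (rule Bochner_Integration.integrable_bound)
        show "integrable lborel (\<lambda>z. B * f (x + t n *\<^sub>R z))"
          using f integral_lborel_affine(2)[of f "t n" x] t by auto
        show "AE z in lborel. norm (?k z * f (x + t n *\<^sub>R z)) \<le> norm (B * f (x + t n *\<^sub>R z))"
          using B by (intro AE_I2) (auto simp: abs_mult intro!: mult_right_mono)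
      qed measurable
      have i2: "integrable lborel (\<lambda>z. ?k z * f x)" using integrable_mollifier by (rule integrable_mult_left)
      have e1: "mean (t n) f x - ?Z * f x = (\<integral>z. ?k z * f (x + t n *\<^sub>R z) - ?k z * f x \<partial>lborel)"
        using i1 i2 integrable_mollifier by (simp add: mean_eq t moll_mass_def)
      have "ennreal \<bar>mean (t n) f x - ?Z * f x\<bar> \<le> (\<integral>\<^sup>+z. ennreal \<bar>?k z * f (x + t n *\<^sub>R z) - ?k z * f x\<bar> \<partial>lborel)"
        unfolding e1 using integral_norm_bound_ennreal[OF Bochner_Integration.integrable_diff[OF i1 i2]] by simp
      also have "\<dots> = (\<integral>\<^sup>+z. ennreal (?k z) * ennreal \<bar>f (x + t n *\<^sub>R z) - f x\<bar> \<partial>lborel)"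
      proof (rule nn_integral_cong)
        fix z
        have "\<bar>?k z * f (x + t n *\<^sub>R z) - ?k z * f x\<bar> = ?k z * \<bar>f (x + t n *\<^sub>R z) - f x\<bar>"
          by (metis abs_mult abs_of_nonneg mollifier_nonneg right_diff_distrib)
        then show "ennreal \<bar>?k z * f (x + t n *\<^sub>R z) - ?k z * f x\<bar> = ennreal (?k z) * ennreal \<bar>f (x + t n *\<^sub>R z) - f x\<bar>"
          by (simp only: ennreal_mult'[OF mollifier_nonneg])
      qed
      finally show "ennreal \<bar>mean (t n) f x - ?Z * f x\<bar> \<le> (\<integral>\<^sup>+z. ennreal (?k z) * ennreal \<bar>f (x + t n *\<^sub>R z) - f x\<bar> \<partial>lborel)" .
    qed
    also have "\<dots> = (\<integral>\<^sup>+z. \<integral>\<^sup>+x. ennreal (?k z) * ennreal \<bar>f (x + t n *\<^sub>R z) - f x\<bar> \<partial>lborel \<partial>lborel)"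
      by (rule lborel_pair.Fubini') measurable
    also have "\<dots> = (\<integral>\<^sup>+z. ennreal (?k z * \<tau> (t n *\<^sub>R z)) \<partial>lborel)"
      by (intro nn_integral_cong) (simp add: nn_integral_cmult tau_nn ennreal_mult'[OF mollifier_nonneg])
    finally show ?thesis .
  qed
  have dom: "(\<integral>\<^sup>+z. ennreal (?k z * (2 * (\<integral>x. \<bar>f x\<bar> \<partial>lborel))) \<partial>lborel) < \<infinity>"
    using integrable_mult_left[OF integrable_mollifier, of "2 * (\<integral>x. \<bar>f x\<bar> \<partial>lborel)"]
    by (subst nn_integral_eq_integral) (auto simp: mollifier_nonneg)
  have le: "ennreal (?k z * \<tau> (t n *\<^sub>R z)) \<le> ennreal (?k z * (2 * (\<integral>x. \<bar>f x\<bar> \<partial>lborel)))" for z n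
    by (intro ennreal_leI mult_left_mono tau_bd mollifier_nonneg)
  have fin: "(\<integral>\<^sup>+x. ennreal \<bar>mean (t n) f x - ?Z * f x\<bar> \<partial>lborel) < \<infinity>" for n
  proof -
    have "(\<integral>\<^sup>+z. ennreal (?k z * \<tau> (t n *\<^sub>R z)) \<partial>lborel) \<le> (\<integral>\<^sup>+z. ennreal (?k z * (2 * (\<integral>x. \<bar>f x\<bar> \<partial>lborel))) \<partial>lborel)"
      by (intro nn_integral_mono le)
    with bound[of n] dom show ?thesis by (meson order.strict_trans1)
  qed
  show int: "integrable lborel (\<lambda>x. mean (t n) f x - ?Z * f x)" for n
    using fin[of n] by (intro integrableI_bounded) auto
  have "(\<lambda>n. \<integral>\<^sup>+z. ennreal (?k z * \<tau> (t n *\<^sub>R z)) \<partial>lborel) \<longlonglongrightarrow> (\<integral>\<^sup>+z. 0 \<partial>(lborel::'a measure))"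
  proof (rule nn_integral_dominated_convergence[OF _ _ _ _ dom])
    show "AE z in lborel. (\<lambda>n. ennreal (?k z * \<tau> (t n *\<^sub>R z))) \<longlonglongrightarrow> 0"
    proof (rule AE_I2)
      fix z :: 'a
      have "(\<lambda>n. t n *\<^sub>R z) \<longlonglongrightarrow> 0 *\<^sub>R z" by (intro tendsto_scaleR t tendsto_const)
      then have "(\<lambda>n. \<tau> (t n *\<^sub>R z)) \<longlonglongrightarrow> 0"
        unfolding \<tau>_def using translation_L1_continuous[OF f] by simp
      from tendsto_ennrealI[OF tendsto_mult_right_zero[OF this, of "?k z"]]
      show "(\<lambda>n. ennreal (?k z * \<tau> (t n *\<^sub>R z))) \<longlonglongrightarrow> 0" by simp
    qed
  qed (use le in auto)
  then have "(\<lambda>n. \<integral>\<^sup>+z. ennreal (?k z * \<tau> (t n *\<^sub>R z)) \<partial>lborel) \<longlonglongrightarrow> 0" by simp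
  then have "(\<lambda>n. \<integral>\<^sup>+x. ennreal \<bar>mean (t n) f x - ?Z * f x\<bar> \<partial>lborel) \<longlonglongrightarrow> 0"
    by (rule tendsto_sandwich[OF _ _ tendsto_const, rotated 2]) (auto intro!: always_eventually bound)
  moreover have "(\<integral>\<^sup>+x. ennreal \<bar>mean (t n) f x - ?Z * f x\<bar> \<partial>lborel) = ennreal (\<integral>x. \<bar>mean (t n) f x - ?Z * f x\<bar> \<partial>lborel)" for n
    using int[of n] by (intro nn_integral_eq_integral) auto
  ultimately show "(\<lambda>n. \<integral>x. \<bar>mean (t n) f x - ?Z * f x\<bar> \<partial>lborel) \<longlonglongrightarrow> 0"
    by (simp add: ennreal_tendsto_0_iff)
qed

lemma mean_restrict:
  assumes f: "loc_int f" and t: "0 < t" "t \<le> 1" and x: "norm x \<le> r"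
  shows "mean t (\<lambda>y. indicator (cball 0 (r + 1)) y * f y) x = mean t f x"
proof (rule mean_cong[OF t(1)])
  have [measurable]: "f \<in> borel_measurable borel" using f by measurable
  show "AE y in lborel. norm (y - x) < t \<longrightarrow> indicator (cball 0 (r + 1)) y * f y = f y"
  proof (intro AE_I2 impI)
    fix y assume "norm (y - x) < t"
    then have "norm y \<le> r + 1" using t x norm_triangle_sub[of y x] by linarith
    then show "indicator (cball 0 (r + 1)) y * f y = f y" by simp
  qed
  have [measurable]: "cball 0 (r + 1) \<in> sets (borel :: 'a measure)" by simp
  show "(\<lambda>y. indicator (cball 0 (r + 1)) y * f y) \<in> borel_measurable borel" by measurable
qed (use f in measurable)

text \<open>For radii at most $1$ the values on a ball of radius \<open>r\<close> only depend on \<open>f\<close> in the ball of radius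
$r + 1$.\<close>
theorem mean_tendsto_local_L1:
  fixes f :: "'a::euclidean_space \<Rightarrow> real"
  assumes f: "loc_int f" and t: "\<And>n. t n > 0" "\<And>n. t n \<le> 1" "t \<longlonglongrightarrow> 0"
  shows "integrable lborel (\<lambda>x. indicator (cball 0 r) x * \<bar>mean (t n) f x - moll_mass TYPE('a) * f x\<bar>)"
    and "(\<lambda>n. \<integral>x. indicator (cball 0 r) x * \<bar>mean (t n) f x - moll_mass TYPE('a) * f x\<bar> \<partial>lborel) \<longlonglongrightarrow> 0"
proof -
  let ?Z = "moll_mass TYPE('a)"
  let ?g = "\<lambda>y. indicator (cball 0 (r + 1)) y * f y"
  have g: "integrable lborel ?g" using f by (auto simp: loc_int_def)
  have eq: "indicator (cball 0 r) x * \<bar>mean (t n) f x - ?Z * f x\<bar> = indicator (cball 0 r) x * \<bar>mean (t n) ?g x - ?Z * ?g x\<bar>" for n x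
    using mean_restrict[OF f t(1)[of n] t(2)[of n], of x r] by (auto simp: indicator_def)
  have int: "integrable lborel (\<lambda>x. \<bar>mean (t n) ?g x - ?Z * ?g x\<bar>)" for n
    using mean_tendsto_L1(1)[OF g t(1) t(3)] by (intro integrable_abs)
  show int2: "integrable lborel (\<lambda>x. indicator (cball 0 r) x * \<bar>mean (t n) f x - ?Z * f x\<bar>)" for n
    unfolding eq using integrable_real_mult_indicator[OF _ int[of n], of "cball 0 r"] by (simp add: mult.commute)
  have "(\<integral>x. indicator (cball 0 r) x * \<bar>mean (t n) f x - ?Z * f x\<bar> \<partial>lborel) \<le> (\<integral>x. \<bar>mean (t n) ?g x - ?Z * ?g x\<bar> \<partial>lborel)" for n
  proof (rule integral_mono[OF int2 int])
    fix x show "indicator (cball 0 r) x * \<bar>mean (t n) f x - ?Z * f x\<bar> \<le> \<bar>mean (t n) ?g x - ?Z * ?g x\<bar>"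
      unfolding eq by (auto simp: indicator_def)
  qed
  then show "(\<lambda>n. \<integral>x. indicator (cball 0 r) x * \<bar>mean (t n) f x - ?Z * f x\<bar> \<partial>lborel) \<longlonglongrightarrow> 0"
    by (intro tendsto_sandwich[OF _ _ tendsto_const mean_tendsto_L1(2)[OF g t(1) t(3)]]) auto
qed

text \<open>Local $L^1$ convergence gives convergence almost everywhere along a subsequence. This weak form of
the Lebesgue differentiation theorem is the source of all identifications almost everywhere below.\<close>
theorem mean_tendsto_AE_subseq:
  fixes f :: "'a::euclidean_space \<Rightarrow> real"
  assumes f: "loc_int f" and t: "\<And>n. t n > 0" "\<And>n. t n \<le> 1" "t \<longlonglongrightarrow> 0"
  obtains s :: "nat \<Rightarrow> nat" where "strict_mono s"
    "AE x in lborel. norm x \<le> r \<longrightarrow> (\<lambda>n. mean (t (s n)) f x) \<longlonglongrightarrow> moll_mass TYPE('a) * f x"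
proof -
  let ?Z = "moll_mass TYPE('a)"
  have "(\<lambda>n. \<integral>x. norm (indicator (cball 0 r) x * \<bar>mean (t n) f x - ?Z * f x\<bar>) \<partial>lborel) \<longlonglongrightarrow> 0"
    using mean_tendsto_local_L1(2)[OF f t] by (simp add: abs_mult)
  from tendsto_L1_AE_subseq[OF mean_tendsto_local_L1(1)[OF f t] this]
  obtain s :: "nat \<Rightarrow> nat" where s: "strict_mono s"
    "AE x in lborel. (\<lambda>n. indicator (cball 0 r) x * \<bar>mean (t (s n)) f x - ?Z * f x\<bar>) \<longlonglongrightarrow> 0" by blast
  have "AE x in lborel. norm x \<le> r \<longrightarrow> (\<lambda>n. mean (t (s n)) f x) \<longlonglongrightarrow> ?Z * f x"
    using s(2)
  proof eventually_elim
    case (elim x)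
    show ?case
    proof
      assume "norm x \<le> r"
      then have "(\<lambda>n. \<bar>mean (t (s n)) f x - ?Z * f x\<bar>) \<longlonglongrightarrow> 0" using elim by simp
      then show "(\<lambda>n. mean (t (s n)) f x) \<longlonglongrightarrow> ?Z * f x"
        by (rule LIM_zero_cancel[OF tendsto_rabs_zero_cancel])
    qed
  qed
  with s(1) show thesis by (rule that)
qed

lemma AE_if_AE_balls: "(\<And>n::nat. AE x in lborel. norm x \<le> real n \<longrightarrow> P x) \<Longrightarrow> AE x in lborel. P x"
proof -
  assume "\<And>n::nat. AE x in lborel. norm x \<le> real n \<longrightarrow> P x"
  then have "AE x in lborel. \<forall>n::nat. norm x \<le> real n \<longrightarrow> P x"
    unfolding AE_all_countable by blast
  then show ?thesis by eventually_elim (meson real_arch_simple)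
qed

lemma inverse_Suc_tendsto_0: "(\<lambda>n. 1 / real (Suc n)) \<longlonglongrightarrow> 0"
  using LIMSEQ_inverse_real_of_nat by (simp add: inverse_eq_divide)

lemma AE_eq_0_if_mean_eq_0:
  fixes f :: "'a::euclidean_space \<Rightarrow> real"
  assumes f: "loc_int f" and "\<And>t x. 0 < t \<Longrightarrow> t \<le> 1 \<Longrightarrow> mean t f x = 0"
  shows "AE x in lborel. f x = 0"
proof (rule AE_if_AE_balls)
  fix n :: nat
  obtain s where s: "strict_mono s" "AE x in lborel. norm x \<le> n \<longrightarrow> (\<lambda>n. mean (1 / Suc (s n)) f x) \<longlonglongrightarrow> moll_mass TYPE('a) * f x"
    by (rule mean_tendsto_AE_subseq[OF f _ _ inverse_Suc_tendsto_0]) auto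
  from s(2) show "AE x in lborel. norm x \<le> n \<longrightarrow> f x = 0"
  proof eventually_elim
    case (elim x)
    show ?case
    proof
      assume "norm x \<le> n"
      then have "(\<lambda>n. 0) \<longlonglongrightarrow> moll_mass TYPE('a) * f x" using elim by (simp add: assms(2))
      then show "f x = 0" using moll_mass_pos[where 'a='a] by (simp add: LIMSEQ_const_iff)
    qed
  qed
qed

lemma continuous_on_integral_kernel:
  fixes \<phi> :: "'b::metric_space \<Rightarrow> 'a::euclidean_space \<Rightarrow> real"
  assumes f: "loc_int f" and m: "\<And>s. s \<in> S \<Longrightarrow> \<phi> s \<in> borel_measurable borel"
    and bd: "\<And>s y. s \<in> S \<Longrightarrow> \<bar>\<phi> s y\<bar> \<le> B" and s: "\<And>s y. s \<in> S \<Longrightarrow> r < norm y \<Longrightarrow> \<phi> s y = 0"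
    and c: "\<And>y. continuous_on S (\<lambda>s. \<phi> s y)"
  shows "continuous_on S (\<lambda>s. \<integral>y. \<phi> s y * f y \<partial>lborel)"
  unfolding continuous_on_sequentially
proof (intro allI ballI impI)
  fix X a assume a: "a \<in> S" and X: "(\<forall>n. X n \<in> S) \<and> X \<longlonglongrightarrow> a"
  have Xn: "X n \<in> S" for n using X by blast
  have "(\<lambda>n. \<integral>y. \<phi> (X n) y * f y \<partial>lborel) \<longlonglongrightarrow> (\<integral>y. \<phi> a y * f y \<partial>lborel)"
  proof (rule tendsto_integral_compact_support[OF f m[OF Xn] m[OF a] bd[OF Xn] s[OF Xn]])
    show "(\<lambda>n. \<phi> (X n) y) \<longlonglongrightarrow> \<phi> a y" for y
      using continuous_on_tendsto_compose[OF c[of y] conjunct2[OF X] a] Xn by simp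
  qed
  then show "((\<lambda>s. \<integral>y. \<phi> s y * f y \<partial>lborel) \<circ> X) \<longlonglongrightarrow> (\<integral>y. \<phi> a y * f y \<partial>lborel)"
    by (simp add: o_def)
qed

lemma mollifier_le_2: "mollifier s \<le> 2"
proof (cases "s < 1")
  case True
  define z where "z = 1 / (1 - s)"
  have z: "z \<ge> 0" using True by (simp add: z_def)
  have "z * z \<le> 2 * exp z" using exp_lower_Taylor_quadratic[OF z] z by (simp add: power2_eq_square)
  then have "z * z * exp (- z) \<le> 2" by (simp add: exp_minus field_simps)
  then show ?thesis using True by (simp add: bump_def z_def)
qed (simp add: bump_def)

lemma moll_le:
  fixes x :: "'a::euclidean_space"
  shows "t > 0 \<Longrightarrow> moll t x y \<le> 2 / t ^ DIM('a)"
  unfolding moll_def by (intro divide_right_mono mollifier_le_2) auto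

lemma continuous_mean:
  fixes f :: "'a::euclidean_space \<Rightarrow> real"
  assumes f: "loc_int f" and t: "t > 0"
  shows "continuous_on UNIV (mean t f)"
proof -
  have "continuous_on (ball 0 \<rho>) (mean t f)" for \<rho>
    unfolding mean_def[abs_def]
  proof (rule continuous_on_integral_kernel[OF f, where B="2 / t ^ DIM('a)" and r="\<rho> + t"])
    show "\<bar>moll t x y\<bar> \<le> 2 / t ^ DIM('a)" for x y :: 'a using moll_le[OF t, of x y] moll_nonneg[OF t, of x y] by simp
    show "moll t x y = 0" if "x \<in> ball 0 \<rho>" "\<rho> + t < norm y" for x y :: 'a
      using that by (intro moll_support t) auto
    show "continuous_on (ball 0 \<rho>) (\<lambda>x. moll t x y)" for y :: 'a
      unfolding moll_def using t by (intro continuous_intros) auto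
  qed measurable
  then have "continuous_on (\<Union>\<rho>\<in>UNIV. ball 0 \<rho>) (mean t f)" by (intro continuous_on_open_UN) auto
  moreover have "(\<Union>\<rho>\<in>UNIV. ball (0::'a) \<rho>) = UNIV"
  proof (rule UNIV_eq_I[symmetric])
    fix x :: 'a
    have "x \<in> ball 0 (norm x + 1)" by simp
    then show "x \<in> (\<Union>\<rho>\<in>UNIV. ball 0 \<rho>)" by blast
  qed
  ultimately show ?thesis by simp
qed

lemma mean_has_derivative_scale:
  fixes f :: "'a::euclidean_space \<Rightarrow> real"
  assumes f: "loc_int f" and t: "t > 0"
  shows "((\<lambda>t. mean t f x) has_real_derivative (\<integral>y. laplacian (pot t x) y * f y \<partial>lborel)) (at t)"
  unfolding mean_def
proof (rule has_derivative_integral_compact_support[OF f, where a="t/2" and b="2*t" and r="norm x + 2 * t"])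
  show "continuous_on ({t/2..2*t} \<times> cball 0 (norm x + 2 * t)) (\<lambda>(s, y). laplacian (pot s x) y)"
  proof (rule continuous_on_cong[THEN iffD1, OF refl _ continuous_on_subset[OF continuous_on_laplacian_pot[of x]]])
    show "{t/2..2*t} \<times> cball 0 (norm x + 2 * t) \<subseteq> {0<..} \<times> UNIV" using t by auto
  qed (use t in \<open>auto simp: laplacian_pot_eq split: prod.splits\<close>)
  show "laplacian (pot t x) \<in> borel_measurable borel"
    unfolding laplacian_pot_eq[OF t, abs_def] by measurable
  show "moll s x y = 0" if "s \<in> {t/2..2*t}" "norm x + 2 * t < norm y" for s y
    using that t by (intro moll_support) auto
qed (use t in \<open>auto intro!: moll_derivative_eq_laplacian_pot continuous_moll\<close>)

lemma frechet_derivative_moll: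
  fixes x y :: "'a::euclidean_space"
  assumes t: "t > 0"
  shows "frechet_derivative (moll t x) (at y) h = scaled_bump (bump_deriv [:0,0,1:]) x t y * (2 / t\<^sup>2 * ((y - x) \<bullet> h)) / t ^ DIM('a)"
  using frechet_derivative_scaled_bump[OF t, of "1 / t ^ DIM('a)" "[:0,0,1:]" x y h]
  unfolding moll_def[abs_def] by simp

text \<open>The kernel depends on $y - x$ only, so that a derivative in \<open>x\<close> is minus a derivative in \<open>y\<close>; it
can then be moved to a weak gradient.\<close>
lemma mean_has_derivative_direction:
  fixes f :: "'a::euclidean_space \<Rightarrow> real"
  assumes f: "loc_int f" and t: "t > 0"
  shows "((\<lambda>s. mean t f (x + s *\<^sub>R b)) has_real_derivative (\<integral>y. - frechet_derivative (moll t (x + s *\<^sub>R b)) (at y) b * f y \<partial>lborel)) (at s)"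
  unfolding mean_def
proof (rule has_derivative_integral_compact_support[OF f, where a="s-1" and b="s+1" and r="norm x + (\<bar>s\<bar> + 1) * norm b + t"])
  show "((\<lambda>s. moll t (x + s *\<^sub>R b) y) has_real_derivative - frechet_derivative (moll t (x + s *\<^sub>R b)) (at y) b) (at s)" for s y
  proof -
    have "((\<lambda>s. (y - (x + s *\<^sub>R b)) \<bullet> (y - (x + s *\<^sub>R b))) has_real_derivative - 2 * ((y - (x + s *\<^sub>R b)) \<bullet> b)) (at s)"
      unfolding has_field_derivative_def
      by (auto intro!: derivative_eq_intros simp: inner_commute algebra_simps)
    from DERIV_cdivide[OF this, of "t\<^sup>2"]
    have "((\<lambda>s. (norm (y - (x + s *\<^sub>R b)))\<^sup>2 / t\<^sup>2) has_real_derivative - (2 / t\<^sup>2 * ((y - (x + s *\<^sub>R b)) \<bullet> b))) (at s)"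
      by (simp add: power2_norm_eq_inner)
    from DERIV_cdivide[OF DERIV_chain2[OF has_real_derivative_bump this], of "[:0,0,1:]" "t ^ DIM('a)"]
    show ?thesis unfolding frechet_derivative_moll[OF t] by (simp add: moll_def)
  qed
  show "continuous_on ({s-1..s+1} \<times> cball 0 (norm x + (\<bar>s\<bar> + 1) * norm b + t)) (\<lambda>(s, y). - frechet_derivative (moll t (x + s *\<^sub>R b)) (at y) b)"
    unfolding frechet_derivative_moll[OF t] case_prod_beta using t by (intro continuous_intros) auto
  show "(\<lambda>y. - frechet_derivative (moll t (x + s *\<^sub>R b)) (at y) b) \<in> borel_measurable borel"
    unfolding frechet_derivative_moll[OF t] by measurable
  show "moll t (x + s' *\<^sub>R b) y = 0" if "s' \<in> {s-1..s+1}" "norm x + (\<bar>s\<bar> + 1) * norm b + t < norm y" for s' y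
  proof (rule moll_support[OF t])
    have "norm (x + s' *\<^sub>R b) \<le> norm x + \<bar>s'\<bar> * norm b" by (metis norm_scaleR norm_triangle_ineq)
    also have "\<bar>s'\<bar> * norm b \<le> (\<bar>s\<bar> + 1) * norm b" using that(1) by (intro mult_right_mono) auto
    finally show "norm (x + s' *\<^sub>R b) + t < norm y" using that(2) by simp
  qed
qed (use t in \<open>auto intro!: continuous_moll\<close>)

section \<open>Borel representatives of Lebesgue measurable functions\<close>

lemma lebesgue_lborel_cong:
  fixes F F0 :: "'a::euclidean_space \<Rightarrow> 'b::{banach, second_countable_topology, euclidean_space}"
  assumes [measurable]: "F0 \<in> borel_measurable borel" and ae: "AE x in lborel. F x = F0 x"
  shows "F \<in> borel_measurable lebesgue"
    and "integral\<^sup>L lebesgue F = integral\<^sup>L lborel F0"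
    and "integrable lebesgue F \<longleftrightarrow> integrable lborel F0"
proof -
  have ae': "AE x in lebesgue. F0 x = F x" using AE_completion[OF ae] by eventually_elim simp
  have m0: "F0 \<in> borel_measurable lebesgue" by (intro measurable_completion) simp
  show m: "F \<in> borel_measurable lebesgue" by (rule borel_measurable_AE[OF m0 ae'])
  have "integral\<^sup>L lebesgue F = integral\<^sup>L lebesgue F0"
    using ae' by (intro integral_cong_AE m m0) auto
  then show "integral\<^sup>L lebesgue F = integral\<^sup>L lborel F0" by (simp add: integral_completion)
  have "integrable lebesgue F \<longleftrightarrow> integrable lebesgue F0"
    using ae' by (intro integrable_cong_AE m m0) auto
  then show "integrable lebesgue F \<longleftrightarrow> integrable lborel F0" by (simp add: integrable_completion)
qed

lemma lebesgue_borel_representative: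
  fixes f :: "'a::euclidean_space \<Rightarrow> 'b::euclidean_space"
  assumes f: "f \<in> borel_measurable lebesgue"
  obtains f0 where "f0 \<in> borel_measurable borel" "AE x in lborel. f x = f0 x"
proof -
  have "\<exists>h. h \<in> borel_measurable borel \<and> (AE x in lborel. f x \<bullet> b = h x)" for b
  proof -
    have "(\<lambda>x. f x \<bullet> b) \<in> borel_measurable (completion lborel)" using f by measurable
    from completion_ex_borel_measurable_real[OF this] show ?thesis by auto
  qed
  then obtain h where h: "\<And>b. h b \<in> borel_measurable borel" "\<And>b. AE x in lborel. f x \<bullet> b = h b x" by metis
  have "AE x in lborel. \<forall>b\<in>Basis. f x \<bullet> b = h b x"
    using h(2) by (subst AE_finite_all) auto
  then have "AE x in lborel. f x = (\<Sum>b\<in>Basis. h b x *\<^sub>R b)"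
  proof eventually_elim
    case (elim x)
    then show ?case by (subst euclidean_representation[of "f x", symmetric]) (intro sum.cong, auto)
  qed
  moreover have "(\<lambda>x. \<Sum>b\<in>Basis. h b x *\<^sub>R b) \<in> borel_measurable borel" using h(1) by measurable
  ultimately show thesis using that by blast
qed

section \<open>Test functions\<close>

definition grad :: "('a::euclidean_space \<Rightarrow> real) \<Rightarrow> 'a \<Rightarrow> 'a" where
  "grad \<phi> x = (\<Sum>b\<in>Basis. frechet_derivative \<phi> (at x) b *\<^sub>R b)"

lemma inner_grad: "b \<in> Basis \<Longrightarrow> grad \<phi> x \<bullet> b = frechet_derivative \<phi> (at x) b"
  by (simp add: grad_def inner_sum_left inner_Basis if_distrib sum.delta cong: if_cong)

context
  fixes \<phi> :: "'a::euclidean_space \<Rightarrow> real"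
  assumes test: "test_function \<phi>"
begin

lemma test_has_derivative: "(\<phi> has_derivative frechet_derivative \<phi> (at x)) (at x)"
  using test Ck_differentiable[of 0 \<phi> x] unfolding test_function_def by blast

lemma test_continuous: "continuous_on UNIV \<phi>"
  using test Ck_function.simps(1)[of \<phi>] unfolding test_function_def by blast

lemma test_derivative_zero: "x \<notin> closure {x. \<phi> x \<noteq> 0} \<Longrightarrow> frechet_derivative \<phi> (at x) b = 0"
proof -
  assume x: "x \<notin> closure {x. \<phi> x \<noteq> 0}"
  have "((\<lambda>_. 0) has_derivative (\<lambda>_. 0)) (at x)" by simp
  then have "(\<phi> has_derivative (\<lambda>_. 0)) (at x)"
    by (rule has_derivative_transform_within_open[of _ _ _ _ "- closure {x. \<phi> x \<noteq> 0}"])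
       (use x closure_subset[of "{x. \<phi> x \<noteq> 0}"] in auto)
  from fun_cong[OF frechet_derivative_at[OF this]] show ?thesis by metis
qed

lemma test_support: obtains r where "\<And>y. r < norm y \<Longrightarrow> \<phi> y = 0" "\<And>y b. r < norm y \<Longrightarrow> frechet_derivative \<phi> (at y) b = 0"
proof -
  have "bounded (closure {x. \<phi> x \<noteq> 0})" using test by (auto simp: test_function_def intro: compact_imp_bounded)
  then obtain r where r: "\<And>y. y \<in> closure {x. \<phi> x \<noteq> 0} \<Longrightarrow> norm y \<le> r" by (auto simp: bounded_iff)
  show thesis
  proof (rule that[of r])
    fix y :: 'a and b assume "r < norm y"
    then have y: "y \<notin> closure {x. \<phi> x \<noteq> 0}" using r[of y] by auto
    then show "\<phi> y = 0" using closure_subset[of "{x. \<phi> x \<noteq> 0}"] by auto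
    show "frechet_derivative \<phi> (at y) b = 0" using test_derivative_zero[OF y] .
  qed
qed

lemma test_function_derivative: "b \<in> Basis \<Longrightarrow> test_function (\<lambda>x. frechet_derivative \<phi> (at x) b)"
proof -
  assume b: "b \<in> Basis"
  have "Ck_function (Suc k) \<phi>" for k using test unfolding test_function_def by blast
  then have "Ck_function k (\<lambda>x. frechet_derivative \<phi> (at x) b)" for k using b by auto
  moreover have "closure {x. frechet_derivative \<phi> (at x) b \<noteq> 0} \<subseteq> closure {x. \<phi> x \<noteq> 0}"
    using test_derivative_zero by (intro closure_minimal) auto
  then have "compact (closure {x. frechet_derivative \<phi> (at x) b \<noteq> 0})"
    using test unfolding test_function_def by (metis closed_closure closed_Int_compact inf.absorb_iff1)
  ultimately show ?thesis by (simp add: test_function_def)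
qed

end

lemma test_derivative_continuous: "test_function \<phi> \<Longrightarrow> b \<in> Basis \<Longrightarrow> continuous_on UNIV (\<lambda>x. frechet_derivative \<phi> (at x) b)"
  by (rule test_continuous[OF test_function_derivative])

lemma grad_measurable: "test_function \<phi> \<Longrightarrow> grad \<phi> \<in> borel_measurable borel"
  unfolding grad_def[abs_def]
  by (intro borel_measurable_continuous_onI continuous_on_sum continuous_on_scaleR test_derivative_continuous) auto

lemma test_measurable: "test_function \<phi> \<Longrightarrow> \<phi> \<in> borel_measurable borel"
  by (intro borel_measurable_continuous_onI test_continuous)

lemma test_direction_derivative:
  assumes "test_function \<phi>"
  shows "((\<lambda>s. \<phi> (x + s *\<^sub>R b)) has_real_derivative frechet_derivative \<phi> (at (x + s *\<^sub>R b)) b) (at s)"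
proof -
  have "((\<lambda>s. x + s *\<^sub>R b) has_derivative (\<lambda>h. h *\<^sub>R b)) (at s)"
    by (auto intro!: derivative_eq_intros)
  from diff_chain_at[OF this test_has_derivative[OF assms]]
  have "((\<lambda>s. \<phi> (x + s *\<^sub>R b)) has_derivative (\<lambda>h. frechet_derivative \<phi> (at (x + s *\<^sub>R b)) (h *\<^sub>R b))) (at s)"
    by (simp add: o_def)
  moreover have "frechet_derivative \<phi> (at (x + s *\<^sub>R b)) (h *\<^sub>R b) = frechet_derivative \<phi> (at (x + s *\<^sub>R b)) b * h" for h
    using linear_scale[OF has_derivative_linear[OF test_has_derivative[OF assms, of "x + s *\<^sub>R b"]], of h b] by simp
  ultimately show ?thesis by (simp add: has_field_derivative_def)
qed

text \<open>Integration by parts without boundary terms: the integral of a translate of \<open>f\<close> does not depend on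
the translation, so differentiating it gives zero.\<close>
lemma integral_direction_derivative_eq_0:
  fixes f f' :: "'a::euclidean_space \<Rightarrow> real"
  assumes d: "\<And>x s. ((\<lambda>s. f (x + s *\<^sub>R b)) has_real_derivative f' (x + s *\<^sub>R b)) (at s)"
    and c: "continuous_on UNIV f" "continuous_on UNIV f'" and s: "\<And>x. r < norm x \<Longrightarrow> f x = 0"
  shows "(\<integral>x. f' x \<partial>lborel) = 0"
proof -
  have [measurable]: "f \<in> borel_measurable borel" "f' \<in> borel_measurable borel"
    using c by (auto intro: borel_measurable_continuous_onI)
  have "((\<lambda>s. \<integral>y. f (y + s *\<^sub>R b) * 1 \<partial>lborel) has_real_derivative (\<integral>y. f' (y + 0 *\<^sub>R b) * 1 \<partial>lborel)) (at 0)"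
  proof (rule has_derivative_integral_compact_support[OF loc_int_const, where a="-1" and b=1 and r="r + norm b"])
    show "continuous_on ({-1..1} \<times> cball 0 (r + norm b)) (\<lambda>(s, y). f' (y + s *\<^sub>R b))"
      unfolding case_prod_beta by (intro continuous_on_compose2[OF c(2)] continuous_intros) auto
    show "continuous_on UNIV (\<lambda>y. f (y + s *\<^sub>R b))" for s
      by (intro continuous_on_compose2[OF c(1)] continuous_intros) auto
    show "f (y + s' *\<^sub>R b) = 0" if "s' \<in> {-1..1}" "r + norm b < norm y" for s' y
    proof (rule s)
      have "norm y \<le> norm (y + s' *\<^sub>R b) + norm (s' *\<^sub>R b)" using norm_triangle_ineq4[of "y + s' *\<^sub>R b" "s' *\<^sub>R b"] by simp
      also have "norm (s' *\<^sub>R b) \<le> norm b" using that(1) by (auto intro!: mult_left_le_one_le)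
      finally show "r < norm (y + s' *\<^sub>R b)" using that(2) by simp
    qed
  qed (auto intro: d)
  moreover have "(\<lambda>s. \<integral>y. f (y + s *\<^sub>R b) * 1 \<partial>lborel) = (\<lambda>s. \<integral>y. f y \<partial>lborel)"
    using integral_lborel_translate(1)[of f] by simp
  ultimately have "((\<lambda>s::real. \<integral>y. f y \<partial>lborel) has_real_derivative (\<integral>y. f' y \<partial>lborel)) (at 0)" by simp
  then show ?thesis using DERIV_unique[OF _ DERIV_const] by blast
qed

section \<open>Weak gradients of Borel functions\<close>

text \<open>The weak gradient relation for Borel functions and the Lebesgue-Borel measure, where Fubini's
theorem and composition with continuous maps are available. Its relation to the Sobolev space
of Lebesgue measurable functions is \<open>wgrad_iff_L2_weak_gradient\<close>.\<close>
definition wgrad :: "('a::euclidean_space \<Rightarrow> real) \<Rightarrow> ('a \<Rightarrow> 'a) \<Rightarrow> bool" where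
  "wgrad u g \<longleftrightarrow> u \<in> borel_measurable borel \<and> g \<in> borel_measurable borel \<and>
     integrable lborel (\<lambda>x. (u x)\<^sup>2) \<and> integrable lborel (\<lambda>x. (norm (g x))\<^sup>2) \<and>
     (\<forall>\<phi>. test_function \<phi> \<longrightarrow> (\<forall>b\<in>Basis.
        (\<integral>x. u x * frechet_derivative \<phi> (at x) b \<partial>lborel) = - (\<integral>x. (g x \<bullet> b) * \<phi> x \<partial>lborel)))"

lemma wgrad_measurable: "wgrad u g \<Longrightarrow> u \<in> borel_measurable borel" "wgrad u g \<Longrightarrow> g \<in> borel_measurable borel"
  by (auto simp: wgrad_def)

lemma wgrad_test:
  "wgrad u g \<Longrightarrow> test_function \<phi> \<Longrightarrow> b \<in> Basis \<Longrightarrow> (\<integral>x. u x * frechet_derivative \<phi> (at x) b \<partial>lborel) = - (\<integral>x. (g x \<bullet> b) * \<phi> x \<partial>lborel)"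
  by (auto simp: wgrad_def)

lemma norm_inner_Basis_square_le: "b \<in> Basis \<Longrightarrow> (g \<bullet> b)\<^sup>2 \<le> (norm (g::'a::euclidean_space))\<^sup>2"
  using Basis_le_norm[of b g] by (metis abs_ge_zero power2_abs power_mono)

lemma wgrad_square_integrable_component:
  assumes w: "wgrad u g" and b: "b \<in> Basis"
  shows "integrable lborel (\<lambda>x. (g x \<bullet> b)\<^sup>2)"
proof (rule Bochner_Integration.integrable_bound)
  have [measurable]: "g \<in> borel_measurable borel" using wgrad_measurable[OF w] by simp
  show "integrable lborel (\<lambda>x. (norm (g x))\<^sup>2)" using w by (simp add: wgrad_def)
  show "(\<lambda>x. (g x \<bullet> b)\<^sup>2) \<in> borel_measurable lborel" by measurable
  show "AE x in lborel. norm ((g x \<bullet> b)\<^sup>2) \<le> norm ((norm (g x))\<^sup>2)"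
    using norm_inner_Basis_square_le[OF b] by (intro AE_I2) simp
qed

lemma wgrad_loc_int:
  assumes w: "wgrad u g"
  shows "loc_int u" "b \<in> Basis \<Longrightarrow> loc_int (\<lambda>x. g x \<bullet> b)"
  using w wgrad_measurable[OF w] wgrad_square_integrable_component[OF w]
  by (auto intro!: square_integrable_imp_loc_int simp: wgrad_def)

lemma wgrad_integrable:
  assumes w: "wgrad u g" and t: "test_function \<phi>" and b: "b \<in> Basis"
  shows "integrable lborel (\<lambda>x. u x * frechet_derivative \<phi> (at x) b)" "integrable lborel (\<lambda>x. (g x \<bullet> b) * \<phi> x)"
    "integrable lborel (\<lambda>x. u x * \<phi> x)"
proof -
  obtain r where r: "\<And>y. r < norm y \<Longrightarrow> \<phi> y = 0" "\<And>y b. r < norm y \<Longrightarrow> frechet_derivative \<phi> (at y) b = 0"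
    using test_support[OF t] by blast
  show "integrable lborel (\<lambda>x. u x * frechet_derivative \<phi> (at x) b)" "integrable lborel (\<lambda>x. (g x \<bullet> b) * \<phi> x)" "integrable lborel (\<lambda>x. u x * \<phi> x)"
    using loc_int_mult_compact[OF wgrad_loc_int(1)[OF w] test_derivative_continuous[OF t b] r(2)]
      loc_int_mult_compact[OF wgrad_loc_int(2)[OF w b] test_continuous[OF t] r(1)]
      loc_int_mult_compact[OF wgrad_loc_int(1)[OF w] test_continuous[OF t] r(1)]
    by (simp_all add: mult.commute)
qed

lemma square_integrable_add:
  fixes f g :: "'a \<Rightarrow> 'b::euclidean_space"
  assumes [measurable]: "f \<in> borel_measurable S" "g \<in> borel_measurable S"
    and "integrable S (\<lambda>x. (norm (f x))\<^sup>2)" "integrable S (\<lambda>x. (norm (g x))\<^sup>2)"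
  shows "integrable S (\<lambda>x. (norm (f x + g x))\<^sup>2)"
proof (rule Bochner_Integration.integrable_bound)
  show "integrable S (\<lambda>x. 2 * (norm (f x))\<^sup>2 + 2 * (norm (g x))\<^sup>2)" using assms by auto
  show "AE x in S. norm ((norm (f x + g x))\<^sup>2) \<le> norm (2 * (norm (f x))\<^sup>2 + 2 * (norm (g x))\<^sup>2)"
  proof (rule AE_I2)
    fix x
    have "(norm (f x + g x))\<^sup>2 \<le> (norm (f x) + norm (g x))\<^sup>2"
      by (intro power_mono norm_triangle_ineq) auto
    also have "\<dots> \<le> 2 * (norm (f x))\<^sup>2 + 2 * (norm (g x))\<^sup>2"
      using zero_le_power2[of "norm (f x) - norm (g x)"] by (simp add: power2_sum power2_diff)
    finally show "norm ((norm (f x + g x))\<^sup>2) \<le> norm (2 * (norm (f x))\<^sup>2 + 2 * (norm (g x))\<^sup>2)" by simp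
  qed
qed measurable

lemma wgrad_lincomb:
  assumes u: "wgrad u g" and v: "wgrad v h"
  shows "wgrad (\<lambda>x. a * u x + c * v x) (\<lambda>x. a *\<^sub>R g x + c *\<^sub>R h x)"
proof -
  note [measurable] = wgrad_measurable[OF u] wgrad_measurable[OF v]
  have i: "integrable lborel (\<lambda>x. (u x)\<^sup>2)" "integrable lborel (\<lambda>x. (norm (g x))\<^sup>2)" "integrable lborel (\<lambda>x. (v x)\<^sup>2)" "integrable lborel (\<lambda>x. (norm (h x))\<^sup>2)"
    using u v by (auto simp: wgrad_def)
  show ?thesis
    unfolding wgrad_def
  proof (intro conjI allI impI ballI)
    show "integrable lborel (\<lambda>x. (a * u x + c * v x)\<^sup>2)"
      using square_integrable_add[of "\<lambda>x. a * u x" lborel "\<lambda>x. c * v x"] i by (simp add: power_mult_distrib)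
    show "integrable lborel (\<lambda>x. (norm (a *\<^sub>R g x + c *\<^sub>R h x))\<^sup>2)"
      using square_integrable_add[of "\<lambda>x. a *\<^sub>R g x" lborel "\<lambda>x. c *\<^sub>R h x"] i by (simp add: power_mult_distrib)
    fix \<phi> :: "'a \<Rightarrow> real" and b :: 'a assume t: "test_function \<phi>" and b: "b \<in> Basis"
    have "(\<integral>x. (a * u x + c * v x) * frechet_derivative \<phi> (at x) b \<partial>lborel) =
      (\<integral>x. a * (u x * frechet_derivative \<phi> (at x) b) + c * (v x * frechet_derivative \<phi> (at x) b) \<partial>lborel)"
      by (intro Bochner_Integration.integral_cong) (auto simp: algebra_simps)
    also have "\<dots> = a * (\<integral>x. u x * frechet_derivative \<phi> (at x) b \<partial>lborel) + c * (\<integral>x. v x * frechet_derivative \<phi> (at x) b \<partial>lborel)"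
      using wgrad_integrable[OF u t b] wgrad_integrable[OF v t b] by simp
    also have "\<dots> = - (a * (\<integral>x. (g x \<bullet> b) * \<phi> x \<partial>lborel) + c * (\<integral>x. (h x \<bullet> b) * \<phi> x \<partial>lborel))"
      using wgrad_test[OF u t b] wgrad_test[OF v t b] by simp
    also have "a * (\<integral>x. (g x \<bullet> b) * \<phi> x \<partial>lborel) + c * (\<integral>x. (h x \<bullet> b) * \<phi> x \<partial>lborel) =
      (\<integral>x. a * ((g x \<bullet> b) * \<phi> x) + c * ((h x \<bullet> b) * \<phi> x) \<partial>lborel)"
      using wgrad_integrable[OF u t b] wgrad_integrable[OF v t b] by simp
    also have "\<dots> = (\<integral>x. ((a *\<^sub>R g x + c *\<^sub>R h x) \<bullet> b) * \<phi> x \<partial>lborel)"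
      by (intro Bochner_Integration.integral_cong) (auto simp: algebra_simps inner_simps)
    finally show "(\<integral>x. (a * u x + c * v x) * frechet_derivative \<phi> (at x) b \<partial>lborel) = - (\<integral>x. ((a *\<^sub>R g x + c *\<^sub>R h x) \<bullet> b) * \<phi> x \<partial>lborel)" .
  qed measurable
qed

lemma test_square_integrable:
  assumes t: "test_function \<phi>"
  shows "integrable lborel (\<lambda>x. (\<phi> x)\<^sup>2)"
proof -
  obtain r where r: "\<And>y. r < norm y \<Longrightarrow> \<phi> y = 0" "\<And>y b. r < norm y \<Longrightarrow> frechet_derivative \<phi> (at y) b = 0"
    using test_support[OF t] by blast
  have "loc_int \<phi>"
    using loc_int_mult_compact[OF loc_int_const[of 1] test_continuous[OF t] r(1)] by (intro integrable_imp_loc_int) simp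
  from loc_int_mult_compact[OF this test_continuous[OF t] r(1)] show ?thesis by (simp add: power2_eq_square)
qed

lemma wgrad_test_function:
  assumes t: "test_function \<phi>"
  shows "wgrad \<phi> (grad \<phi>)"
  unfolding wgrad_def
proof (intro conjI allI impI ballI)
  show "\<phi> \<in> borel_measurable borel" "grad \<phi> \<in> borel_measurable borel" by (rule test_measurable[OF t], rule grad_measurable[OF t])
  show "integrable lborel (\<lambda>x. (\<phi> x)\<^sup>2)" by (rule test_square_integrable[OF t])
  have "(norm (grad \<phi> x))\<^sup>2 = (\<Sum>b\<in>Basis. (frechet_derivative \<phi> (at x) b)\<^sup>2)" for x
    unfolding power2_norm_eq_inner by (subst euclidean_inner) (simp add: inner_grad power2_eq_square)
  then show "integrable lborel (\<lambda>x. (norm (grad \<phi> x))\<^sup>2)"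
    using test_square_integrable[OF test_function_derivative[OF t]] by (auto intro!: Bochner_Integration.integrable_sum)
  fix \<psi> :: "'a \<Rightarrow> real" and b :: 'a assume p: "test_function \<psi>" and b: "b \<in> Basis"
  obtain r where r: "\<And>y. r < norm y \<Longrightarrow> \<phi> y = 0" "\<And>y b. r < norm y \<Longrightarrow> frechet_derivative \<phi> (at y) b = 0" using test_support[OF t] by blast
  have "loc_int \<psi>"
    using square_integrable_imp_loc_int[OF test_measurable[OF p] test_square_integrable[OF p]] .
  note i1 = loc_int_mult_compact[OF this test_derivative_continuous[OF t b] r(2)]
  have "loc_int (\<lambda>x. frechet_derivative \<psi> (at x) b)"
    using square_integrable_imp_loc_int[OF test_measurable test_square_integrable] test_function_derivative[OF p b] by blast
  note i2 = loc_int_mult_compact[OF this test_continuous[OF t] r(1)]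
  have "(\<integral>x. \<phi> x * frechet_derivative \<psi> (at x) b + frechet_derivative \<phi> (at x) b * \<psi> x \<partial>lborel) = 0"
  proof (rule integral_direction_derivative_eq_0[where f="\<lambda>x. \<phi> x * \<psi> x" and b=b and r=r])
    show "((\<lambda>s. \<phi> (x + s *\<^sub>R b) * \<psi> (x + s *\<^sub>R b)) has_real_derivative
      \<phi> (x + s *\<^sub>R b) * frechet_derivative \<psi> (at (x + s *\<^sub>R b)) b + frechet_derivative \<phi> (at (x + s *\<^sub>R b)) b * \<psi> (x + s *\<^sub>R b)) (at s)" for x s
      by (rule DERIV_cong[OF DERIV_mult[OF test_direction_derivative[OF t] test_direction_derivative[OF p]]]) simp
    show "continuous_on UNIV (\<lambda>x. \<phi> x * \<psi> x)"
      by (intro continuous_intros test_continuous t p)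
    show "continuous_on UNIV (\<lambda>x. \<phi> x * frechet_derivative \<psi> (at x) b + frechet_derivative \<phi> (at x) b * \<psi> x)"
      by (intro continuous_intros test_continuous test_derivative_continuous t p b)
  qed (use r in auto)
  then show "(\<integral>x. \<phi> x * frechet_derivative \<psi> (at x) b \<partial>lborel) = - (\<integral>x. (grad \<phi> x \<bullet> b) * \<psi> x \<partial>lborel)"
    using i1 i2 by (simp add: inner_grad[OF b])
qed

text \<open>Testing with mollifiers shows that the mollifications of the difference vanish for every radius.\<close>
lemma wgrad_unique:
  assumes g: "wgrad u g" and h: "wgrad u h"
  shows "AE x in lborel. g x = h x"
proof -
  have "AE x in lborel. g x \<bullet> b - h x \<bullet> b = 0" if b: "b \<in> Basis" for b
  proof (rule AE_eq_0_if_mean_eq_0)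
    show "loc_int (\<lambda>x. g x \<bullet> b - h x \<bullet> b)"
      by (intro loc_int_diff wgrad_loc_int[OF g] wgrad_loc_int[OF h] b)
    fix t x assume t: "(0::real) < t"
    show "mean t (\<lambda>x. g x \<bullet> b - h x \<bullet> b) x = 0"
      using wgrad_test[OF g test_function_moll[OF t] b, of x] wgrad_test[OF h test_function_moll[OF t] b, of x]
      by (subst mean_diff[OF wgrad_loc_int(2)[OF g b] wgrad_loc_int(2)[OF h b] t]) (simp add: mean_def mult.commute)
  qed
  then have "AE x in lborel. \<forall>b\<in>Basis. g x \<bullet> b - h x \<bullet> b = 0" by (subst AE_finite_all) auto
  then show ?thesis by eventually_elim (auto intro: euclidean_eqI)
qed

lemma wgrad_laplacian:
  assumes w: "wgrad u g" and t: "test_function \<phi>"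
  shows "integrable lborel (\<lambda>x. g x \<bullet> grad \<phi> x)" "integrable lborel (\<lambda>x. u x * laplacian \<phi> x)"
    "(\<integral>x. g x \<bullet> grad \<phi> x \<partial>lborel) = - (\<integral>x. u x * laplacian \<phi> x \<partial>lborel)"
proof -
  have e1: "g x \<bullet> grad \<phi> x = (\<Sum>b\<in>Basis. (g x \<bullet> b) * frechet_derivative \<phi> (at x) b)" for x
    by (subst euclidean_inner) (simp add: inner_grad)
  note d = test_function_derivative[OF t]
  have e2: "u x * laplacian \<phi> x = (\<Sum>b\<in>Basis. u x * frechet_derivative (\<lambda>z. frechet_derivative \<phi> (at z) b) (at x) b)" for x
    by (simp add: laplacian_def sum_distrib_left)
  show "integrable lborel (\<lambda>x. g x \<bullet> grad \<phi> x)" "integrable lborel (\<lambda>x. u x * laplacian \<phi> x)"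
    unfolding e1 e2 using wgrad_integrable[OF w d] by auto
  have "(\<integral>x. g x \<bullet> grad \<phi> x \<partial>lborel) = (\<Sum>b\<in>Basis. \<integral>x. (g x \<bullet> b) * frechet_derivative \<phi> (at x) b \<partial>lborel)"
    unfolding e1 using wgrad_integrable[OF w d] by (intro Bochner_Integration.integral_sum) auto
  also have "\<dots> = (\<Sum>b\<in>Basis. - (\<integral>x. u x * frechet_derivative (\<lambda>z. frechet_derivative \<phi> (at z) b) (at x) b \<partial>lborel))"
    using wgrad_test[OF w d] by (intro sum.cong) auto
  also have "\<dots> = - (\<integral>x. u x * laplacian \<phi> x \<partial>lborel)"
    unfolding e2 sum_negf using wgrad_integrable[OF w d] by (subst Bochner_Integration.integral_sum) auto
  finally show "(\<integral>x. g x \<bullet> grad \<phi> x \<partial>lborel) = - (\<integral>x. u x * laplacian \<phi> x \<partial>lborel)" .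
qed

section \<open>The Sobolev space and the functionals in terms of Borel functions\<close>

lemma wgrad_iff_L2_weak_gradient:
  fixes u u0 :: "'a::euclidean_space \<Rightarrow> real"
  assumes [measurable]: "u0 \<in> borel_measurable borel" "g0 \<in> borel_measurable borel"
    and u: "AE x in lborel. u x = u0 x" and g: "AE x in lborel. g x = g0 x"
  shows "wgrad u0 g0 \<longleftrightarrow> square_integrable u \<and> L2_weak_gradient u g"
proof -
  have u2: "AE x in lborel. (norm (u x))\<^sup>2 = (u0 x)\<^sup>2" using u by eventually_elim simp
  have g2: "AE x in lborel. (norm (g x))\<^sup>2 = (norm (g0 x))\<^sup>2" using g by eventually_elim simp
  have s1: "square_integrable u \<longleftrightarrow> integrable lborel (\<lambda>x. (u0 x)\<^sup>2)"
    unfolding square_integrable_def using lebesgue_lborel_cong(1)[OF assms(1) u] lebesgue_lborel_cong(3)[OF _ u2] by simp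
  have s2: "square_integrable g \<longleftrightarrow> integrable lborel (\<lambda>x. (norm (g0 x))\<^sup>2)"
    unfolding square_integrable_def using lebesgue_lborel_cong(1)[OF assms(2) g] lebesgue_lborel_cong(3)[OF _ g2] by simp
  have i1: "(\<integral>x. u x * frechet_derivative \<phi> (at x) b \<partial>lebesgue) = (\<integral>x. u0 x * frechet_derivative \<phi> (at x) b \<partial>lborel)"
    "(\<integral>x. (g x \<bullet> b) * \<phi> x \<partial>lebesgue) = (\<integral>x. (g0 x \<bullet> b) * \<phi> x \<partial>lborel)"
    if t: "test_function \<phi>" "b \<in> Basis" for \<phi> b
  proof -
    have [measurable]: "\<phi> \<in> borel_measurable borel" "(\<lambda>x. frechet_derivative \<phi> (at x) b) \<in> borel_measurable borel"
      using t test_measurable test_function_derivative by blast+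
    have "AE x in lborel. u x * frechet_derivative \<phi> (at x) b = u0 x * frechet_derivative \<phi> (at x) b" using u by eventually_elim simp
    then show "(\<integral>x. u x * frechet_derivative \<phi> (at x) b \<partial>lebesgue) = (\<integral>x. u0 x * frechet_derivative \<phi> (at x) b \<partial>lborel)"
      by (rule lebesgue_lborel_cong(2)[rotated]) measurable
    have "AE x in lborel. (g x \<bullet> b) * \<phi> x = (g0 x \<bullet> b) * \<phi> x" using g by eventually_elim simp
    then show "(\<integral>x. (g x \<bullet> b) * \<phi> x \<partial>lebesgue) = (\<integral>x. (g0 x \<bullet> b) * \<phi> x \<partial>lborel)"
      by (rule lebesgue_lborel_cong(2)[rotated]) measurable
  qed
  show ?thesis
    unfolding wgrad_def L2_weak_gradient_def s1 s2 using i1 assms(1,2) by auto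
qed

lemma H1_representative:
  assumes "u \<in> H1" "L2_weak_gradient u g"
  obtains u0 g0 where "wgrad u0 g0" "AE x in lborel. u x = u0 x" "AE x in lborel. g x = g0 x"
proof -
  have s: "square_integrable u" using assms by (simp add: H1_def)
  obtain u0 where u0: "u0 \<in> borel_measurable borel" "AE x in lborel. u x = u0 x"
    using lebesgue_borel_representative[of u] s by (auto simp: square_integrable_def)
  obtain g0 where g0: "g0 \<in> borel_measurable borel" "AE x in lborel. g x = g0 x"
    using lebesgue_borel_representative[of g] assms by (auto simp: square_integrable_def L2_weak_gradient_def)
  show thesis
    using that[of u0 g0] wgrad_iff_L2_weak_gradient[OF u0(1) g0(1) u0(2) g0(2)] s assms(2) u0 g0 by blast
qed

lemma wgrad_imp_H1: "wgrad u g \<Longrightarrow> u \<in> H1 \<and> L2_weak_gradient u g"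
  using wgrad_iff_L2_weak_gradient[OF wgrad_measurable, of u g u g] by (auto simp: H1_def)

lemma wgrad_weak_gradient:
  assumes w: "wgrad u g"
  shows "AE x in lborel. weak_gradient u x = g x"
proof -
  have "L2_weak_gradient u (weak_gradient u)"
    unfolding weak_gradient_def using wgrad_imp_H1[OF w] by (metis someI)
  then obtain u0 g0 where 0: "wgrad u0 g0" "AE x in lborel. u x = u0 x" "AE x in lborel. weak_gradient u x = g0 x"
    using H1_representative[of u "weak_gradient u"] wgrad_imp_H1[OF w] by blast
  have "wgrad u g0"
    using wgrad_iff_L2_weak_gradient[of u0 g0 u "weak_gradient u"] wgrad_iff_L2_weak_gradient[of u g0 u "weak_gradient u"]
      0 wgrad_measurable[OF 0(1)] wgrad_measurable[OF w] by auto
  from wgrad_unique[OF w this] 0(3) show ?thesis by eventually_elim simp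
qed

lemma J_wgrad:
  assumes w: "wgrad u g" and V[measurable]: "V0 \<in> borel_measurable borel" and VV: "AE x in lborel. V x = V0 x"
  shows "J V u = (\<integral>x. (norm (g x))\<^sup>2 + V0 x * (u x)\<^sup>2 \<partial>lborel)"
  unfolding J_def
proof (rule lebesgue_lborel_cong(2))
  note [measurable] = wgrad_measurable[OF w]
  show "(\<lambda>x. (norm (g x))\<^sup>2 + V0 x * (u x)\<^sup>2) \<in> borel_measurable borel" by measurable
  show "AE x in lborel. (norm (weak_gradient u x))\<^sup>2 + V x * (u x)\<^sup>2 = (norm (g x))\<^sup>2 + V0 x * (u x)\<^sup>2"
    using wgrad_weak_gradient[OF w] VV by eventually_elim simp
qed

text \<open>For functions that are not measurable the statement about \<open>J\<close> also holds: measurability with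
respect to the completed measure is invariant under changes on null sets, and the integral of a
nonmeasurable function is $0$ by convention.\<close>
lemma AE_eq_cong:
  assumes ae: "AE x in lborel. u x = (v x :: real)"
  shows "weak_gradient u = weak_gradient v" "J V u = J V v" "Lux p u = Lux p v" "u \<in> H1 \<longleftrightarrow> v \<in> H1" "u \<in> M p \<longleftrightarrow> v \<in> M p"
proof -
  have aeu: "AE x in lebesgue. u x = v x" by (rule AE_completion[OF ae])
  then have aev: "AE x in lebesgue. v x = u x" by eventually_elim simp
  have int: "integral\<^sup>L lebesgue (\<lambda>x. F x (u x)) = integral\<^sup>L lebesgue (\<lambda>x. F x (v x))" for F :: "'a \<Rightarrow> real \<Rightarrow> real"
  proof (cases "(\<lambda>x. F x (u x)) \<in> borel_measurable lebesgue")
    case True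
    have "AE x in lebesgue. F x (u x) = F x (v x)" using aeu by eventually_elim simp
    with borel_measurable_AE[OF True this] True show ?thesis by (intro integral_cong_AE) auto
  next
    case False
    have "(\<lambda>x. F x (v x)) \<notin> borel_measurable lebesgue"
    proof
      assume *: "(\<lambda>x. F x (v x)) \<in> borel_measurable lebesgue"
      have "AE x in lebesgue. F x (v x) = F x (u x)" using aeu by eventually_elim simp
      from borel_measurable_AE[OF * this] False show False by simp
    qed
    with False show ?thesis
      by (metis borel_measurable_integrable not_integrable_integral_eq)
  qed
  have meas: "u \<in> borel_measurable lebesgue \<longleftrightarrow> v \<in> borel_measurable lebesgue"
    using borel_measurable_AE[OF _ aeu] borel_measurable_AE[OF _ aev] by blast
  have L2: "L2_weak_gradient u g \<longleftrightarrow> L2_weak_gradient v g" for g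
    unfolding L2_weak_gradient_def using int[of "\<lambda>x y. y * frechet_derivative _ (at x) _"] by auto
  show wg: "weak_gradient u = weak_gradient v" unfolding weak_gradient_def L2 by simp
  show "J V u = J V v" unfolding J_def wg using int[of "\<lambda>x y. (norm (weak_gradient v x))\<^sup>2 + V x * y\<^sup>2"] by simp
  have "(\<integral>\<^sup>+x. ennreal (\<bar>u x / \<gamma>\<bar> powr p x / p x) \<partial>lebesgue) = (\<integral>\<^sup>+x. ennreal (\<bar>v x / \<gamma>\<bar> powr p x / p x) \<partial>lebesgue)" for \<gamma>
  proof (rule nn_integral_cong_AE)
    show "AE x in lebesgue. ennreal (\<bar>u x / \<gamma>\<bar> powr p x / p x) = ennreal (\<bar>v x / \<gamma>\<bar> powr p x / p x)"
      using aeu by eventually_elim simp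
  qed
  then show lux: "Lux p u = Lux p v" unfolding Lux_def by simp
  have "square_integrable u \<longleftrightarrow> square_integrable v"
  proof -
    have "integrable lebesgue (\<lambda>x. (norm (u x))\<^sup>2) \<longleftrightarrow> integrable lebesgue (\<lambda>x. (norm (v x))\<^sup>2)"
      if "u \<in> borel_measurable lebesgue"
    proof (rule integrable_cong_AE)
      show "AE x in lebesgue. (norm (u x))\<^sup>2 = (norm (v x))\<^sup>2" using aeu by eventually_elim simp
    qed (use that meas in auto)
    then show ?thesis unfolding square_integrable_def using meas by blast
  qed
  moreover have "L2_weak_gradient u = L2_weak_gradient v" using L2 by blast
  ultimately show h1: "u \<in> H1 \<longleftrightarrow> v \<in> H1" unfolding H1_def by simp
  show "u \<in> M p \<longleftrightarrow> v \<in> M p" unfolding M_def using h1 lux by simp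
qed

section \<open>The modular and the Luxemburg norm\<close>

text \<open>The nonlinearity $|r|^{q-2} r$, the derivative of $|r|^q / q$.\<close>
definition nl :: "real \<Rightarrow> real \<Rightarrow> real" where
  "nl q r = \<bar>r\<bar> powr (q - 2) * r"

lemma abs_nl: "\<bar>nl q r\<bar> = \<bar>r\<bar> powr (q - 1)"
proof (cases "r = 0")
  case False
  then have "\<bar>r\<bar> powr (q - 1) = \<bar>r\<bar> powr (q - 2) * \<bar>r\<bar> powr 1"
    using powr_add[of "\<bar>r\<bar>" "q - 2" 1] by simp
  then show ?thesis using False by (simp add: nl_def abs_mult)
qed (simp add: nl_def)

lemma nl_mult_self: "nl q r * r = \<bar>r\<bar> powr q"
proof (cases "r = 0")
  case False
  then have "\<bar>r\<bar> powr q = \<bar>r\<bar> powr (q - 2) * \<bar>r\<bar> powr 2"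
    using powr_add[of "\<bar>r\<bar>" "q - 2" 2] by simp
  then show ?thesis using False by (simp add: nl_def power2_eq_square)
qed (simp add: nl_def)

lemma measurable_nl [measurable]:
  assumes [measurable]: "f \<in> borel_measurable S" "h \<in> borel_measurable S"
  shows "(\<lambda>x. nl (f x) (h x)) \<in> borel_measurable S"
  unfolding nl_def by measurable

text \<open>At the origin the difference quotient is bounded by $|r|^{q-1}/q$.\<close>
lemma has_real_derivative_abs_powr:
  assumes q: "q > 1"
  shows "((\<lambda>r. \<bar>r\<bar> powr q / q) has_real_derivative nl q r) (at r)"
proof -
  consider "r > 0" | "r < 0" | "r = 0" by linarith
  then show ?thesis
  proof cases
    case 1
    have "((\<lambda>r. r powr q / q) has_real_derivative nl q r) (at r)"
      using 1 q abs_nl[of q r] by (auto intro!: derivative_eq_intros simp: nl_def)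
    then show ?thesis
      by (rule has_field_derivative_transform_within_open[where S="{0<..}"]) (use 1 in auto)
  next
    case 2
    have n: "nl q r = - ((- r) powr (q - 1))" using abs_nl[of q r] 2 by (simp add: nl_def abs_mult)
    have "((\<lambda>r. (- r) powr q / q) has_real_derivative nl q r) (at r)"
      unfolding n using 2 q by (auto intro!: derivative_eq_intros)
    then show ?thesis
      by (rule has_field_derivative_transform_within_open[where S="{..<0}"]) (use 2 in auto)
  next
    case 3
    have "((\<lambda>h::real. \<bar>h\<bar> powr (q - 1) / q) \<longlongrightarrow> \<bar>0\<bar> powr (q - 1) / q) (at 0)"
      using q by (intro tendsto_intros tendsto_powr') auto
    then have l: "((\<lambda>h::real. \<bar>h\<bar> powr (q - 1) / q) \<longlongrightarrow> 0) (at 0)" by simp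
    have "((\<lambda>h. (\<bar>h\<bar> powr q / q) / h) \<longlongrightarrow> 0) (at 0)"
    proof (rule Lim_null_comparison[OF _ l])
      show "\<forall>\<^sub>F h in at (0::real). norm ((\<bar>h\<bar> powr q / q) / h) \<le> \<bar>h\<bar> powr (q - 1) / q"
      proof (rule always_eventually, rule allI)
        fix h :: real
        show "norm ((\<bar>h\<bar> powr q / q) / h) \<le> \<bar>h\<bar> powr (q - 1) / q"
        proof (cases "h = 0")
          case False
          then have "\<bar>h\<bar> powr q = \<bar>h\<bar> powr (q - 1) * \<bar>h\<bar>" using powr_add[of "\<bar>h\<bar>" "q - 1" 1] by simp
          then show ?thesis using False q by (simp add: abs_mult)
        qed (use q in simp)
      qed
    qed
    then show ?thesis using 3 by (simp add: has_field_derivative_iff nl_def)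
  qed
qed

lemma powr_add_le:
  assumes "a \<ge> 0" "b \<ge> 0" "(q::real) \<ge> 0"
  shows "(a + b) powr q \<le> 2 powr q * (a powr q + b powr q)"
proof -
  have "(a + b) powr q \<le> (2 * max a b) powr q" using assms by (intro powr_mono2) auto
  also have "\<dots> = 2 powr q * (max a b) powr q" using assms by (intro powr_mult)
  also have "(max a b) powr q \<le> a powr q + b powr q" using assms by (auto simp: max_def)
  finally show ?thesis by simp
qed

lemma power2_le_powr: "q \<ge> 2 \<Longrightarrow> (r::real)\<^sup>2 \<le> 1 + \<bar>r\<bar> powr q"
proof (cases "\<bar>r\<bar> \<le> 1")
  case True
  then have "r\<^sup>2 \<le> 1" by (simp add: abs_square_le_1)
  then show ?thesis using powr_ge_zero[of "\<bar>r\<bar>" q] by linarith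
next
  case False assume "q \<ge> 2"
  then have "\<bar>r\<bar> powr 2 \<le> \<bar>r\<bar> powr q" using False by (intro powr_mono) auto
  then show ?thesis using False by simp
qed

locale variable_exponent =
  fixes p :: "'a::euclidean_space \<Rightarrow> real" and pmin pmax :: real
  assumes p_cont: "continuous_on UNIV p" and pmin: "2 < pmin" and p_ge: "\<And>x. pmin \<le> p x" and p_le: "\<And>x. p x \<le> pmax"
begin

lemma p_measurable [measurable]: "p \<in> borel_measurable borel"
  using p_cont by (rule borel_measurable_continuous_onI)

lemma p_gt_2: "2 < p x" using p_ge[of x] pmin by simp
lemma p_pos: "0 < p x" using p_gt_2[of x] by simp
lemma pmax_gt: "2 < pmax" using p_gt_2[of 0] p_le[of 0] by simp

definition modular :: "('a \<Rightarrow> real) \<Rightarrow> ennreal" where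
  "modular u = (\<integral>\<^sup>+x. ennreal (\<bar>u x\<bar> powr p x / p x) \<partial>lborel)"

lemma Lux_eq: "Lux p u = (INF \<gamma>\<in>{\<gamma>::real. \<gamma> > 0 \<and> modular (\<lambda>x. u x / \<gamma>) \<le> 1}. ennreal \<gamma>)"
  unfolding Lux_def modular_def nn_integral_completion by simp

lemma modular_scale_le:
  assumes u: "u \<in> borel_measurable borel" and c: "c \<ge> 0" and le: "\<And>x. \<bar>v x\<bar> powr p x \<le> c * \<bar>u x\<bar> powr p x"
  shows "modular v \<le> ennreal c * modular u"
proof -
  note [measurable] = u
  have "modular v \<le> (\<integral>\<^sup>+x. ennreal c * ennreal (\<bar>u x\<bar> powr p x / p x) \<partial>lborel)"
    unfolding modular_def
  proof (rule nn_integral_mono)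
    fix x
    have "\<bar>v x\<bar> powr p x / p x \<le> c * (\<bar>u x\<bar> powr p x / p x)"
      using divide_right_mono[OF le[of x], of "p x"] p_pos[of x] by simp
    then show "ennreal (\<bar>v x\<bar> powr p x / p x) \<le> ennreal c * ennreal (\<bar>u x\<bar> powr p x / p x)"
      using c p_pos[of x] by (simp add: ennreal_mult'[symmetric] ennreal_leI)
  qed
  also have "\<dots> = ennreal c * modular u" unfolding modular_def by (rule nn_integral_cmult) measurable
  finally show ?thesis .
qed

lemma Lux_leI: "\<gamma> > 0 \<Longrightarrow> modular (\<lambda>x. u x / \<gamma>) \<le> 1 \<Longrightarrow> Lux p u \<le> ennreal \<gamma>"
  unfolding Lux_eq by (rule INF_lower) auto

lemma Lux_lessE:
  assumes "Lux p u < c" obtains \<gamma> where "\<gamma> > 0" "modular (\<lambda>x. u x / \<gamma>) \<le> 1" "ennreal \<gamma> < c"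
  using assms unfolding Lux_eq INF_less_iff by auto

text \<open>With the exponents bounded by \<open>pmax\<close>, dividing \<open>u\<close> by \<open>\<gamma>\<close> changes the modular by at most the factor
$\gamma^{\pm pmax}$. Admissible $\gamma$ close to $1$ show that the modular is at most $1$, and a modular below $1$ could be raised by some $\gamma < 1$ without exceeding
$1$, contradicting the value of the norm.\<close>
lemma modular_eq_1:
  assumes u[measurable]: "u \<in> borel_measurable borel" and L: "Lux p u = 1"
  shows "modular u = 1"
proof (rule antisym)
  show "modular u \<le> 1"
  proof -
    have le: "modular u \<le> ennreal ((1 + 1 / Suc n) powr pmax)" for n
    proof -
      have "Lux p u < ennreal (1 + 1 / Suc n)" unfolding L by (subst ennreal_1[symmetric], subst ennreal_less_iff) auto
      then obtain \<gamma> where g: "\<gamma> > 0" "modular (\<lambda>x. u x / \<gamma>) \<le> 1" "ennreal \<gamma> < ennreal (1 + 1 / Suc n)" by (rule Lux_lessE)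
      then have g2: "\<gamma> < 1 + 1 / Suc n" by (subst (asm) ennreal_less_iff) auto
      have "1 \<le> ennreal \<gamma>" using Lux_leI[OF g(1,2)] L by simp
      then have g1: "1 \<le> \<gamma>" using g(1) by (metis ennreal_1 ennreal_le_iff less_imp_le)
      have "modular u \<le> ennreal (\<gamma> powr pmax) * modular (\<lambda>x. u x / \<gamma>)"
      proof (rule modular_scale_le)
        fix x
        have "\<bar>u x\<bar> powr p x = \<gamma> powr p x * \<bar>u x / \<gamma>\<bar> powr p x" using g by (simp add: powr_mult[symmetric])
        also have "\<dots> \<le> \<gamma> powr pmax * \<bar>u x / \<gamma>\<bar> powr p x" using g1 p_le by (intro mult_right_mono powr_mono) auto
        finally show "\<bar>u x\<bar> powr p x \<le> \<gamma> powr pmax * \<bar>u x / \<gamma>\<bar> powr p x" .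
      qed auto
      also have "\<dots> \<le> ennreal (\<gamma> powr pmax) * 1" using g by (intro mult_left_mono) auto
      also have "\<dots> \<le> ennreal ((1 + 1 / Suc n) powr pmax)" using g1 g2 pmax_gt by (simp add: ennreal_leI powr_mono2)
      finally show ?thesis .
    qed
    have "(\<lambda>n. 1 + 1 / real (Suc n)) \<longlonglongrightarrow> 1 + 0" by (intro tendsto_add tendsto_const inverse_Suc_tendsto_0)
    then have "(\<lambda>n. (1 + 1 / real (Suc n)) powr pmax) \<longlonglongrightarrow> (1 + 0) powr pmax"
      by (intro tendsto_powr tendsto_const) auto
    then have "(\<lambda>n. ennreal ((1 + 1 / real (Suc n)) powr pmax)) \<longlonglongrightarrow> ennreal 1"
      by (intro tendsto_ennrealI) simp
    then show ?thesis using LIMSEQ_le_const[of _ "ennreal 1" "modular u"] le by (auto simp del: of_nat_Suc)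
  qed
  show "1 \<le> modular u"
  proof (rule ccontr)
    assume "\<not> 1 \<le> modular u"
    then have lt: "modular u < 1" by simp
    then obtain m where m: "modular u = ennreal m" "0 \<le> m" "m < 1"
      by (cases "modular u") (auto simp: ennreal_less_iff[of _ 1, simplified])
    \<comment> \<open>the maximum with $1/2$ only serves to keep \<open>\<gamma>\<close> positive when $m = 0$\<close>
    define \<gamma> where "\<gamma> = (max m (1/2)) powr (1 / pmax)"
    have gg: "\<gamma> powr pmax = max m (1/2)" unfolding \<gamma>_def using pmax_gt by (simp add: powr_powr)
    have g0: "\<gamma> > 0" unfolding \<gamma>_def by (simp add: max_def)
    have g1: "\<gamma> < 1" unfolding \<gamma>_def using m pmax_gt powr_less_one[of "max m (1/2)" "1/pmax"] by (auto simp: powr01_less_one)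
    have "modular (\<lambda>x. u x / \<gamma>) \<le> ennreal (1 / \<gamma> powr pmax) * modular u"
    proof (rule modular_scale_le)
      fix x
      have "\<bar>u x / \<gamma>\<bar> powr p x = (1 / \<gamma> powr p x) * \<bar>u x\<bar> powr p x" using g0 by (simp add: powr_divide)
      also have "\<gamma> powr pmax \<le> \<gamma> powr p x" using g0 g1 p_le by (intro powr_mono') auto
      then have "(1 / \<gamma> powr p x) * \<bar>u x\<bar> powr p x \<le> (1 / \<gamma> powr pmax) * \<bar>u x\<bar> powr p x"
        using g0 by (intro mult_right_mono divide_left_mono) auto
      finally show "\<bar>u x / \<gamma>\<bar> powr p x \<le> 1 / \<gamma> powr pmax * \<bar>u x\<bar> powr p x" .
    qed (use g0 in auto)
    also have "\<dots> = ennreal (m / max m (1/2))" unfolding m gg using m by (simp add: ennreal_mult'[symmetric])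
    also have "\<dots> \<le> 1" using m by (subst ennreal_1[symmetric], intro ennreal_leI) (auto simp: divide_le_eq max_def)
    finally have "Lux p u \<le> ennreal \<gamma>" by (rule Lux_leI[OF g0])
    then show False using L g0 g1 by (metis ennreal_1 ennreal_le_iff less_imp_le not_less)
  qed
qed

text \<open>Together with \<open>Lux_ge\<close> this says that $|I(v) - 1|$ is at most the distance of the modular from $1$,
because all exponents are at least $1$. In this form the norm enters the first variation: it is
$1 + o(t)$ wherever the modular is.\<close>
lemma Lux_le:
  assumes u[measurable]: "u \<in> borel_measurable borel" and m: "modular u \<le> ennreal c" and c: "c \<ge> 1"
  shows "Lux p u \<le> ennreal c"
proof (rule Lux_leI)
  have "modular (\<lambda>x. u x / c) \<le> ennreal (1 / c) * modular u"
  proof (rule modular_scale_le)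
    fix x
    have "c powr 1 \<le> c powr p x" using c p_gt_2[of x] by (intro powr_mono) auto
    then have "\<bar>u x\<bar> powr p x / c powr p x \<le> \<bar>u x\<bar> powr p x / c" using c by (intro divide_left_mono) auto
    then show "\<bar>u x / c\<bar> powr p x \<le> 1 / c * \<bar>u x\<bar> powr p x" using c by (simp add: powr_divide)
  qed (use c in auto)
  also have "\<dots> \<le> ennreal (1 / c) * ennreal c" by (intro mult_left_mono m) auto
  also have "\<dots> = 1" using c by (simp add: ennreal_mult'[symmetric])
  finally show "modular (\<lambda>x. u x / c) \<le> 1" .
qed (use c in simp)

lemma Lux_ge:
  assumes u[measurable]: "u \<in> borel_measurable borel" and m: "ennreal c \<le> modular u" and c: "0 < c" "c \<le> 1"
  shows "ennreal c \<le> Lux p u"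
proof (rule ccontr)
  assume "\<not> ennreal c \<le> Lux p u"
  then have "Lux p u < ennreal c" by simp
  then obtain \<gamma> where g: "\<gamma> > 0" "modular (\<lambda>x. u x / \<gamma>) \<le> 1" "ennreal \<gamma> < ennreal c" by (rule Lux_lessE)
  have gc: "\<gamma> < c" using g(1,3) by (simp add: ennreal_less_iff)
  have "modular u \<le> ennreal \<gamma> * modular (\<lambda>x. u x / \<gamma>)"
  proof (rule modular_scale_le)
    fix x
    have "\<bar>u x\<bar> powr p x = \<gamma> powr p x * \<bar>u x / \<gamma>\<bar> powr p x" using g by (simp add: powr_mult[symmetric])
    also have "\<gamma> powr p x \<le> \<gamma> powr 1" using g gc c p_gt_2[of x] by (intro powr_mono') auto
    then have "\<gamma> powr p x * \<bar>u x / \<gamma>\<bar> powr p x \<le> \<gamma> * \<bar>u x / \<gamma>\<bar> powr p x"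
      using g by (intro mult_right_mono) auto
    finally show "\<bar>u x\<bar> powr p x \<le> \<gamma> * \<bar>u x / \<gamma>\<bar> powr p x" .
  qed (use g in auto)
  also have "\<dots> \<le> ennreal \<gamma> * 1" by (intro mult_left_mono g) auto
  also have "\<dots> < ennreal c" using g by simp
  finally show False using m by simp
qed

lemma Lux_eq_1:
  assumes u: "u \<in> borel_measurable borel" and m: "modular u = 1"
  shows "Lux p u = 1"
  using Lux_le[OF u, of 1] Lux_ge[OF u, of 1] m by (intro antisym) auto

lemma Lux_normalize:
  assumes L: "Lux p v = ennreal \<gamma>" and g: "\<gamma> > 0"
  shows "Lux p (\<lambda>x. v x / \<gamma>) = 1"
proof (rule antisym)
  show "1 \<le> Lux p (\<lambda>x. v x / \<gamma>)"
    unfolding Lux_eq[of "\<lambda>x. v x / \<gamma>"]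
  proof (rule INF_greatest)
    fix s :: real assume "s \<in> {s. 0 < s \<and> modular (\<lambda>x. v x / \<gamma> / s) \<le> 1}"
    then have s: "s > 0" "modular (\<lambda>x. v x / (\<gamma> * s)) \<le> 1" by auto
    have "ennreal \<gamma> \<le> ennreal (\<gamma> * s)" using Lux_leI[OF _ s(2)] s g L by simp
    then have "\<gamma> \<le> \<gamma> * s" using s g by (subst (asm) ennreal_le_iff) auto
    then have "1 \<le> s" using g by simp
    then show "1 \<le> ennreal s" by (metis ennreal_1 ennreal_leI)
  qed
  have le: "Lux p (\<lambda>x. v x / \<gamma>) \<le> ennreal (1 + e)" if e: "e > 0" for e
  proof -
    have "Lux p v < ennreal (\<gamma> * (1 + e))" unfolding L using e g by (subst ennreal_less_iff) auto
    then obtain s where s: "s > 0" "modular (\<lambda>x. v x / s) \<le> 1" "ennreal s < ennreal (\<gamma> * (1 + e))" by (rule Lux_lessE)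
    have s2: "s < \<gamma> * (1 + e)" using s(1,3) by (simp add: ennreal_less_iff)
    have "Lux p (\<lambda>x. v x / \<gamma>) \<le> ennreal (s / \<gamma>)" using s g by (intro Lux_leI) auto
    also have "\<dots> \<le> ennreal (1 + e)" using s2 g by (intro ennreal_leI) (auto simp: divide_le_eq mult.commute)
    finally show ?thesis .
  qed
  show "Lux p (\<lambda>x. v x / \<gamma>) \<le> 1"
  proof (rule ennreal_le_epsilon)
    fix e :: real assume "0 < e"
    with le[of e] show "Lux p (\<lambda>x. v x / \<gamma>) \<le> 1 + ennreal e" by simp
  qed
qed

definition powr_integrable :: "('a \<Rightarrow> real) \<Rightarrow> bool" where
  "powr_integrable u \<longleftrightarrow> u \<in> borel_measurable borel \<and> integrable lborel (\<lambda>x. \<bar>u x\<bar> powr p x)"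

lemma powr_integrable_measurable [measurable_dest]: "powr_integrable u \<Longrightarrow> u \<in> borel_measurable borel"
  by (simp add: powr_integrable_def)

lemma powr_integrable_bound:
  assumes f: "integrable lborel f" and u[measurable]: "u \<in> borel_measurable borel" and "\<And>x. \<bar>u x\<bar> powr p x \<le> f x"
  shows "powr_integrable u"
  unfolding powr_integrable_def
  by (intro conjI u Bochner_Integration.integrable_bound[OF f]) (use assms(3) in \<open>auto intro!: AE_I2 intro: order_trans[OF _ abs_ge_self]\<close>)

lemma powr_integrable_add:
  assumes u: "powr_integrable u" and v: "powr_integrable v"
  shows "powr_integrable (\<lambda>x. \<bar>u x\<bar> + \<bar>v x\<bar>)" "powr_integrable (\<lambda>x. u x + v x)"
proof -
  note [measurable] = powr_integrable_measurable[OF u] powr_integrable_measurable[OF v]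
  have i: "integrable lborel (\<lambda>x. 2 powr pmax * (\<bar>u x\<bar> powr p x + \<bar>v x\<bar> powr p x))"
    using u v by (auto simp: powr_integrable_def)
  have le: "(\<bar>u x\<bar> + \<bar>v x\<bar>) powr p x \<le> 2 powr pmax * (\<bar>u x\<bar> powr p x + \<bar>v x\<bar> powr p x)" for x
  proof -
    have "(\<bar>u x\<bar> + \<bar>v x\<bar>) powr p x \<le> 2 powr p x * (\<bar>u x\<bar> powr p x + \<bar>v x\<bar> powr p x)"
      using p_pos[of x] by (intro powr_add_le) auto
    also have "\<dots> \<le> 2 powr pmax * (\<bar>u x\<bar> powr p x + \<bar>v x\<bar> powr p x)"
      using p_le[of x] by (intro mult_right_mono powr_mono) auto
    finally show ?thesis .
  qed
  show "powr_integrable (\<lambda>x. \<bar>u x\<bar> + \<bar>v x\<bar>)"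
    by (rule powr_integrable_bound[OF i]) (use le in auto)
  have "\<bar>u x + v x\<bar> powr p x \<le> (\<bar>u x\<bar> + \<bar>v x\<bar>) powr p x" for x
    using p_pos[of x] by (intro powr_mono2) auto
  then show "powr_integrable (\<lambda>x. u x + v x)"
    by (intro powr_integrable_bound[OF i]) (use le in \<open>auto intro: order_trans\<close>)
qed

lemma powr_integrable_cmult:
  assumes u: "powr_integrable u"
  shows "powr_integrable (\<lambda>x. c * u x)"
proof (rule powr_integrable_bound)
  note [measurable] = powr_integrable_measurable[OF u]
  show "integrable lborel (\<lambda>x. max 1 \<bar>c\<bar> powr pmax * \<bar>u x\<bar> powr p x)" using u by (auto simp: powr_integrable_def)
  show "(\<lambda>x. c * u x) \<in> borel_measurable borel" by measurable
  fix x
  have "\<bar>c\<bar> powr p x \<le> max 1 \<bar>c\<bar> powr p x" using p_pos[of x] by (intro powr_mono2) auto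
  also have "\<dots> \<le> max 1 \<bar>c\<bar> powr pmax" using p_le[of x] by (intro powr_mono) auto
  finally have "\<bar>c\<bar> powr p x * \<bar>u x\<bar> powr p x \<le> max 1 \<bar>c\<bar> powr pmax * \<bar>u x\<bar> powr p x"
    by (rule mult_right_mono) simp
  then show "\<bar>c * u x\<bar> powr p x \<le> max 1 \<bar>c\<bar> powr pmax * \<bar>u x\<bar> powr p x"
    by (simp add: abs_mult powr_mult)
qed

lemma powr_integrable_test:
  assumes t: "test_function \<phi>"
  shows "powr_integrable \<phi>"
proof -
  obtain r where r: "\<And>y. r < norm y \<Longrightarrow> \<phi> y = 0" "\<And>y b. r < norm y \<Longrightarrow> frechet_derivative \<phi> (at y) b = 0"
    using test_support[OF t] by blast
  obtain B where B: "B \<ge> 0" "\<And>y. \<bar>\<phi> y\<bar> \<le> B" using compactly_supported_bounded[OF test_continuous[OF t] r(1)] by blast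
  show ?thesis
  proof (rule powr_integrable_bound[OF _ test_measurable[OF t]])
    show "integrable lborel (\<lambda>x. indicator (cball 0 r) x * (max 1 B powr pmax))"
      by (rule conjunct2[OF loc_int_const[unfolded loc_int_def], rule_format])
    fix x
    show "\<bar>\<phi> x\<bar> powr p x \<le> indicator (cball 0 r) x * (max 1 B powr pmax)"
    proof (cases "norm x \<le> r")
      case True
      have "\<bar>\<phi> x\<bar> powr p x \<le> max 1 B powr p x" using p_pos[of x] B(2)[of x] by (intro powr_mono2) auto
      also have "\<dots> \<le> max 1 B powr pmax" using p_le[of x] by (intro powr_mono) auto
      finally show ?thesis using True by simp
    qed (use r(1)[of x] in simp)
  qed
qed

lemma powr_integrable_divide: "powr_integrable u \<Longrightarrow> integrable lborel (\<lambda>x. \<bar>u x\<bar> powr p x / p x)"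
proof -
  assume u: "powr_integrable u"
  note [measurable] = powr_integrable_measurable[OF u]
  show ?thesis
  proof (rule Bochner_Integration.integrable_bound)
    show "integrable lborel (\<lambda>x. \<bar>u x\<bar> powr p x)" using u by (simp add: powr_integrable_def)
    have "\<bar>u x\<bar> powr p x / p x \<le> \<bar>u x\<bar> powr p x / 1" for x
      using p_gt_2[of x] by (intro divide_left_mono) auto
    then show "AE x in lborel. norm (\<bar>u x\<bar> powr p x / p x) \<le> norm (\<bar>u x\<bar> powr p x)"
      using p_pos by (intro AE_I2) (simp add: less_imp_le)
  qed measurable
qed

lemma modular_integral: "powr_integrable u \<Longrightarrow> modular u = ennreal (\<integral>x. \<bar>u x\<bar> powr p x / p x \<partial>lborel)"
  unfolding modular_def using powr_integrable_divide p_pos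
  by (intro nn_integral_eq_integral) (auto simp: less_imp_le)

lemma modular_1_powr_integrable:
  assumes u[measurable]: "u \<in> borel_measurable borel" and m: "modular u = 1"
  shows "powr_integrable u" "(\<integral>x. \<bar>u x\<bar> powr p x / p x \<partial>lborel) = 1" "(\<integral>x. \<bar>u x\<bar> powr p x \<partial>lborel) \<le> pmax"
    "0 < (\<integral>x. \<bar>u x\<bar> powr p x \<partial>lborel)"
proof -
  have i1: "integrable lborel (\<lambda>x. \<bar>u x\<bar> powr p x / p x)"
    using m p_pos unfolding modular_def by (intro integrableI_bounded) (auto simp: less_imp_le)
  have le: "\<bar>u x\<bar> powr p x \<le> pmax * (\<bar>u x\<bar> powr p x / p x)" for x
    using p_pos[of x] p_le[of x] by (simp add: le_divide_eq mult_right_mono mult.commute)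
  show u1: "powr_integrable u"
    by (rule powr_integrable_bound[OF integrable_mult_right[OF i1, of pmax] u]) (use le in auto)
  show one: "(\<integral>x. \<bar>u x\<bar> powr p x / p x \<partial>lborel) = 1"
    using modular_integral[OF u1] m by (metis ennreal_eq_1)
  have "(\<integral>x. \<bar>u x\<bar> powr p x \<partial>lborel) \<le> (\<integral>x. pmax * (\<bar>u x\<bar> powr p x / p x) \<partial>lborel)"
    using u1 le by (intro integral_mono[OF _ integrable_mult_right[OF i1]]) (auto simp: powr_integrable_def)
  also have "\<dots> = pmax" by (simp only: integral_mult_right_zero one mult_1_right)
  finally show "(\<integral>x. \<bar>u x\<bar> powr p x \<partial>lborel) \<le> pmax" .
  have "(\<integral>x. \<bar>u x\<bar> powr p x / p x \<partial>lborel) \<le> (\<integral>x. \<bar>u x\<bar> powr p x \<partial>lborel)"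
    using u1
  proof (intro integral_mono[OF i1])
    fix x
    show "\<bar>u x\<bar> powr p x / p x \<le> \<bar>u x\<bar> powr p x"
      using divide_left_mono[of 1 "p x" "\<bar>u x\<bar> powr p x"] p_gt_2[of x] by simp
  qed (simp add: powr_integrable_def)
  then show "0 < (\<integral>x. \<bar>u x\<bar> powr p x \<partial>lborel)" using one by simp
qed

lemma nl_mult_bound: "\<bar>nl (p x) a * b\<bar> \<le> (\<bar>a\<bar> + \<bar>b\<bar>) powr p x"
proof -
  have "\<bar>nl (p x) a * b\<bar> = \<bar>a\<bar> powr (p x - 1) * \<bar>b\<bar>" by (simp add: abs_mult abs_nl)
  also have "\<dots> \<le> (\<bar>a\<bar> + \<bar>b\<bar>) powr (p x - 1) * (\<bar>a\<bar> + \<bar>b\<bar>)"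
    using p_gt_2[of x] by (intro mult_mono powr_mono2) auto
  also have "\<dots> = (\<bar>a\<bar> + \<bar>b\<bar>) powr p x"
    using powr_add[of "\<bar>a\<bar> + \<bar>b\<bar>" "p x - 1" 1] by simp
  finally show ?thesis .
qed

lemma nl_integrable:
  assumes u: "powr_integrable u" and v: "powr_integrable v"
  shows "integrable lborel (\<lambda>x. nl (p x) (u x) * v x)"
proof -
  note [measurable] = powr_integrable_measurable[OF u] powr_integrable_measurable[OF v]
  show ?thesis
  proof (rule Bochner_Integration.integrable_bound)
    show "integrable lborel (\<lambda>x. (\<bar>u x\<bar> + \<bar>v x\<bar>) powr p x)"
      using powr_integrable_add(1)[OF u v] by (simp add: powr_integrable_def)
  qed (use nl_mult_bound in \<open>auto intro!: AE_I2\<close>)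
qed

text \<open>The mean value theorem on the interval of radius $|a| + |b|$; the bound is the integrable dominating
function for the difference quotients of the modular.\<close>
lemma powr_increment_bound:
  assumes "\<bar>t\<bar> \<le> 1"
  shows "\<bar>\<bar>a + t * b\<bar> powr p x / p x - \<bar>a\<bar> powr p x / p x\<bar> \<le> \<bar>t\<bar> * (\<bar>a\<bar> + \<bar>b\<bar>) powr p x"
proof -
  let ?m = "\<bar>a\<bar> + \<bar>b\<bar>"
  have tb: "\<bar>t * b\<bar> \<le> \<bar>b\<bar>" using assms by (simp add: abs_mult mult_left_le_one_le)
  have "norm (\<bar>a + t * b\<bar> powr p x / p x - \<bar>a\<bar> powr p x / p x) \<le> ?m powr (p x - 1) * norm ((a + t * b) - a)"
  proof (rule field_differentiable_bound[of "{-?m..?m}" "\<lambda>r. \<bar>r\<bar> powr p x / p x" "nl (p x)"])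
    show "((\<lambda>r. \<bar>r\<bar> powr p x / p x) has_field_derivative nl (p x) z) (at z within {-?m..?m})" for z
      using p_gt_2[of x] by (intro has_field_derivative_at_within[OF has_real_derivative_abs_powr]) simp
    show "norm (nl (p x) z) \<le> ?m powr (p x - 1)" if "z \<in> {-?m..?m}" for z
      using that p_gt_2[of x] by (auto simp: abs_nl intro!: powr_mono2)
  qed (use tb in auto)
  also have "\<dots> = \<bar>t\<bar> * (?m powr (p x - 1) * \<bar>b\<bar>)" by (simp add: abs_mult)
  also have "\<dots> \<le> \<bar>t\<bar> * (?m powr (p x - 1) * ?m)" by (intro mult_left_mono) auto
  also have "?m powr (p x - 1) * ?m = ?m powr p x" using powr_add[of ?m "p x - 1" 1] by simp
  finally show ?thesis by simp
qed

lemma modular_has_derivative: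
  assumes u: "powr_integrable u" and v: "powr_integrable v"
  shows "((\<lambda>t. \<integral>x. \<bar>u x + t * v x\<bar> powr p x / p x \<partial>lborel) has_real_derivative (\<integral>x. nl (p x) (u x) * v x \<partial>lborel)) (at 0)"
proof -
  note [measurable] = powr_integrable_measurable[OF u] powr_integrable_measurable[OF v]
  have int: "integrable lborel (\<lambda>x. \<bar>u x + t * v x\<bar> powr p x / p x)" for t
    by (intro powr_integrable_divide powr_integrable_add u powr_integrable_cmult v)
  have "((\<lambda>t. ((\<integral>x. \<bar>u x + t * v x\<bar> powr p x / p x \<partial>lborel) - (\<integral>x. \<bar>u x\<bar> powr p x / p x \<partial>lborel)) / t) \<longlongrightarrow> (\<integral>x. nl (p x) (u x) * v x \<partial>lborel)) (at 0 within {-1<..<1})"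
    unfolding tendsto_at_iff_sequentially
  proof (intro allI impI)
    fix X :: "nat \<Rightarrow> real" assume X: "\<forall>i. X i \<in> {-1<..<1} - {0}" "X \<longlonglongrightarrow> 0"
    have Xi: "\<bar>X i\<bar> \<le> 1" "X i \<noteq> 0" for i using X(1) by (auto dest: spec[of _ i])
    have "(\<lambda>i. \<integral>x. (\<bar>u x + X i * v x\<bar> powr p x / p x - \<bar>u x\<bar> powr p x / p x) / X i \<partial>lborel) \<longlonglongrightarrow> (\<integral>x. nl (p x) (u x) * v x \<partial>lborel)"
    proof (rule integral_dominated_convergence)
      show "integrable lborel (\<lambda>x. (\<bar>u x\<bar> + \<bar>v x\<bar>) powr p x)"
        using powr_integrable_add(1)[OF u v] by (simp add: powr_integrable_def)
      show "AE x in lborel. norm ((\<bar>u x + X i * v x\<bar> powr p x / p x - \<bar>u x\<bar> powr p x / p x) / X i) \<le> (\<bar>u x\<bar> + \<bar>v x\<bar>) powr p x" for i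
      proof (rule AE_I2)
        fix x
        show "norm ((\<bar>u x + X i * v x\<bar> powr p x / p x - \<bar>u x\<bar> powr p x / p x) / X i) \<le> (\<bar>u x\<bar> + \<bar>v x\<bar>) powr p x"
          using powr_increment_bound[OF Xi(1)[of i], of "u x" "v x" x] Xi(2)[of i]
          by (simp add: divide_le_eq mult.commute)
      qed
      show "AE x in lborel. (\<lambda>i. (\<bar>u x + X i * v x\<bar> powr p x / p x - \<bar>u x\<bar> powr p x / p x) / X i) \<longlonglongrightarrow> nl (p x) (u x) * v x"
      proof (rule AE_I2)
        fix x
        have "((\<lambda>t. \<bar>u x + t * v x\<bar> powr p x / p x) has_real_derivative nl (p x) (u x + 0 * v x) * v x) (at 0)"
          using p_gt_2[of x] by (intro DERIV_chain2[OF has_real_derivative_abs_powr]) (auto intro!: derivative_eq_intros)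
        then show "(\<lambda>i. (\<bar>u x + X i * v x\<bar> powr p x / p x - \<bar>u x\<bar> powr p x / p x) / X i) \<longlonglongrightarrow> nl (p x) (u x) * v x"
          using X unfolding has_field_derivative_iff tendsto_at_iff_sequentially by (auto simp: o_def)
      qed
    qed measurable
    moreover have "(\<integral>x. (\<bar>u x + X i * v x\<bar> powr p x / p x - \<bar>u x\<bar> powr p x / p x) / X i \<partial>lborel) =
      ((\<integral>x. \<bar>u x + X i * v x\<bar> powr p x / p x \<partial>lborel) - (\<integral>x. \<bar>u x\<bar> powr p x / p x \<partial>lborel)) / X i" for i
      using int[of "X i"] int[of 0] by simp
    ultimately show "((\<lambda>t. ((\<integral>x. \<bar>u x + t * v x\<bar> powr p x / p x \<partial>lborel) - (\<integral>x. \<bar>u x\<bar> powr p x / p x \<partial>lborel)) / t) \<circ> X) \<longlonglongrightarrow> (\<integral>x. nl (p x) (u x) * v x \<partial>lborel)"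
      unfolding o_def by (simp only:)
  qed
  then show ?thesis
    by (simp add: has_field_derivative_iff at_within_open[of 0 "{-1<..<1::real}"])
qed

end

section \<open>The Euler-Lagrange equation of a minimizer\<close>

text \<open>The function \<open>V0\<close> is a bounded Borel representative of the potential. Of the positive limit of the
potential at infinity only nonnegativity outside a ball is recorded.\<close>
locale minimization = variable_exponent p pmin pmax
  for p :: "'a::euclidean_space \<Rightarrow> real" and pmin pmax :: real +
  fixes V V0 :: "'a \<Rightarrow> real" and Vmax R :: real
  assumes V0_measurable [measurable]: "V0 \<in> borel_measurable borel"
    and V_eq: "AE x in lborel. V x = V0 x"
    and V0_bound: "\<And>x. \<bar>V0 x\<bar> \<le> Vmax"
    and V0_far: "AE x in lborel. R \<le> norm x \<longrightarrow> 0 \<le> V0 x"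
begin

lemma Vmax_nonneg: "0 \<le> Vmax" using V0_bound[of 0] by linarith

lemma V0_integrable:
  assumes [measurable]: "u \<in> borel_measurable borel" and "integrable lborel (\<lambda>x. (u x)\<^sup>2)"
  shows "integrable lborel (\<lambda>x. V0 x * (u x)\<^sup>2)"
proof (rule Bochner_Integration.integrable_bound)
  show "integrable lborel (\<lambda>x. Vmax * (u x)\<^sup>2)" using assms by auto
  show "AE x in lborel. norm (V0 x * (u x)\<^sup>2) \<le> norm (Vmax * (u x)\<^sup>2)"
    using V0_bound Vmax_nonneg by (intro AE_I2) (auto simp: abs_mult intro!: mult_right_mono)
qed measurable

lemma M_representative:
  assumes "w \<in> M p"
  obtains u g where "wgrad u g" "AE x in lborel. w x = u x" "Lux p u = 1"
proof -
  have w: "w \<in> H1" "Lux p w = 1" using assms by (auto simp: M_def)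
  then obtain g where "L2_weak_gradient w g" by (auto simp: H1_def)
  with H1_representative[OF w(1) this] that w AE_eq_cong(3) show thesis by metis
qed

text \<open>Where the potential may be negative, that is in the ball of radius \<open>R\<close>, it is controlled by the
modular, since $u^2 \le 1 + |u|^{p(x)}$. A lower bound is indispensable here: without it the infimum
\<open>lambda1\<close> of a set of reals would say nothing about its members.\<close>
lemma J_bounded_below:
  assumes "w \<in> M p"
  shows "- (Vmax * (measure lborel (cball (0::'a) R) + pmax)) \<le> J V w"
proof -
  obtain u g where ug: "wgrad u g" "AE x in lborel. w x = u x" "Lux p u = 1" using M_representative[OF assms] .
  note [measurable] = wgrad_measurable[OF ug(1)]
  note m = modular_1_powr_integrable[OF wgrad_measurable(1)[OF ug(1)] modular_eq_1[OF wgrad_measurable(1)[OF ug(1)] ug(3)]]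
  have i: "integrable lborel (\<lambda>x. (u x)\<^sup>2)" "integrable lborel (\<lambda>x. (norm (g x))\<^sup>2)" using ug(1) by (auto simp: wgrad_def)
  have ib: "integrable lborel (indicator (cball (0::'a) R) :: 'a \<Rightarrow> real)"
    using emeasure_bounded_finite[of "cball (0::'a) R"] by (intro integrable_real_indicator) auto
  have ip: "integrable lborel (\<lambda>x. \<bar>u x\<bar> powr p x)" using m(1) by (simp add: powr_integrable_def)
  have "(\<integral>x. - (Vmax * (indicator (cball 0 R) x + \<bar>u x\<bar> powr p x)) \<partial>lborel) \<le> (\<integral>x. (norm (g x))\<^sup>2 + V0 x * (u x)\<^sup>2 \<partial>lborel)"
  proof (rule integral_mono_AE)
    show "AE x in lborel. - (Vmax * (indicator (cball 0 R) x + \<bar>u x\<bar> powr p x)) \<le> (norm (g x))\<^sup>2 + V0 x * (u x)\<^sup>2"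
      using V0_far
    proof eventually_elim
      case (elim x)
      have "- (Vmax * (indicator (cball 0 R) x + \<bar>u x\<bar> powr p x)) \<le> V0 x * (u x)\<^sup>2"
      proof (cases "R \<le> norm x")
        case True
        then have "0 \<le> V0 x * (u x)\<^sup>2" using elim by simp
        moreover have "0 \<le> Vmax * (indicator (cball 0 R) x + \<bar>u x\<bar> powr p x)" using Vmax_nonneg by simp
        ultimately show ?thesis by linarith
      next
        case False
        have "- V0 x * (u x)\<^sup>2 \<le> Vmax * (1 + \<bar>u x\<bar> powr p x)"
          using V0_bound[of x] p_gt_2[of x] power2_le_powr[of "p x" "u x"] Vmax_nonneg by (intro mult_mono) auto
        then show ?thesis using False by simp
      qed
      moreover have "0 \<le> (norm (g x))\<^sup>2" by simp
      ultimately show ?case by linarith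
    qed
  qed (use i ib ip V0_integrable[OF wgrad_measurable(1)[OF ug(1)]] in auto)
  also have "\<dots> = J V w" using J_wgrad[OF ug(1) V0_measurable V_eq] AE_eq_cong(2)[OF ug(2)] by simp
  also have "(\<integral>x. - (Vmax * (indicator (cball 0 R) x + \<bar>u x\<bar> powr p x)) \<partial>lborel) =
     - (Vmax * (measure lborel (cball (0::'a) R) + (\<integral>x. \<bar>u x\<bar> powr p x \<partial>lborel)))"
    using ib ip by simp
  finally have "- (Vmax * (measure lborel (cball (0::'a) R) + (\<integral>x. \<bar>u x\<bar> powr p x \<partial>lborel))) \<le> J V w" .
  moreover have "Vmax * (measure lborel (cball (0::'a) R) + (\<integral>x. \<bar>u x\<bar> powr p x \<partial>lborel)) \<le> Vmax * (measure lborel (cball (0::'a) R) + pmax)"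
    using m(3) Vmax_nonneg by (intro mult_left_mono) auto
  ultimately show ?thesis by linarith
qed

lemma lambda1_le_J: "w \<in> M p \<Longrightarrow> lambda1 V p \<le> J V w"
  unfolding lambda1_def by (intro cINF_lower bdd_belowI2[OF J_bounded_below])

definition energy :: "('a \<Rightarrow> real) \<Rightarrow> ('a \<Rightarrow> 'a) \<Rightarrow> real" where
  "energy u g = (\<integral>x. (norm (g x))\<^sup>2 + V0 x * (u x)\<^sup>2 \<partial>lborel)"

lemma J_eq_energy: "wgrad u g \<Longrightarrow> J V u = energy u g"
  unfolding energy_def by (rule J_wgrad[OF _ V0_measurable V_eq])

lemma energy_integrable: "wgrad u g \<Longrightarrow> integrable lborel (\<lambda>x. (norm (g x))\<^sup>2 + V0 x * (u x)\<^sup>2)"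
  using V0_integrable[of u] by (auto simp: wgrad_def)

text \<open>The energy is homogeneous of degree $2$ and the norm of degree $1$, so that the minimization problem
also bounds the energy of functions that are not normalized.\<close>
lemma energy_ge_Lux:
  assumes w: "wgrad v h" and L: "Lux p v = ennreal \<gamma>" and g: "\<gamma> > 0"
  shows "lambda1 V p * \<gamma>\<^sup>2 \<le> energy v h"
proof -
  have w': "wgrad (\<lambda>x. v x / \<gamma>) (\<lambda>x. (1 / \<gamma>) *\<^sub>R h x)"
    using wgrad_lincomb[OF w w, of "1 / \<gamma>" 0] by simp
  have "(\<lambda>x. v x / \<gamma>) \<in> M p" using wgrad_imp_H1[OF w'] Lux_normalize[OF L g] by (simp add: M_def)
  from lambda1_le_J[OF this] have "lambda1 V p \<le> energy (\<lambda>x. v x / \<gamma>) (\<lambda>x. (1 / \<gamma>) *\<^sub>R h x)"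
    using J_eq_energy[OF w'] by simp
  also have "\<dots> = (\<integral>x. (1 / \<gamma>\<^sup>2) * ((norm (h x))\<^sup>2 + V0 x * (v x)\<^sup>2) \<partial>lborel)"
    unfolding energy_def using g by (intro Bochner_Integration.integral_cong) (auto simp: power_divide distrib_left)
  also have "\<dots> = energy v h / \<gamma>\<^sup>2" unfolding energy_def by simp
  finally show ?thesis using g by (simp add: le_divide_eq)
qed

lemma pairing_integrable:
  assumes u: "wgrad u g" and v: "wgrad v h"
  shows "integrable lborel (\<lambda>x. g x \<bullet> h x)" "integrable lborel (\<lambda>x. V0 x * (u x * v x))"
proof -
  note [measurable] = wgrad_measurable[OF u] wgrad_measurable[OF v]
  have i: "integrable lborel (\<lambda>x. (norm (g x))\<^sup>2 + (norm (h x))\<^sup>2)" "integrable lborel (\<lambda>x. Vmax * ((u x)\<^sup>2 + (v x)\<^sup>2))"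
    using u v by (auto simp: wgrad_def)
  have le: "\<bar>a * b\<bar> \<le> a\<^sup>2 + b\<^sup>2" for a b :: real
  proof -
    have "0 \<le> (\<bar>a\<bar> - \<bar>b\<bar>)\<^sup>2" by simp
    then have "2 * \<bar>a * b\<bar> \<le> a\<^sup>2 + b\<^sup>2" by (simp add: power2_diff abs_mult)
    moreover have "0 \<le> \<bar>a * b\<bar>" by simp
    ultimately show ?thesis by linarith
  qed
  show "integrable lborel (\<lambda>x. g x \<bullet> h x)"
  proof (rule Bochner_Integration.integrable_bound[OF i(1)])
    show "AE x in lborel. norm (g x \<bullet> h x) \<le> norm ((norm (g x))\<^sup>2 + (norm (h x))\<^sup>2)"
    proof (rule AE_I2)
      fix x
      have "\<bar>g x \<bullet> h x\<bar> \<le> norm (g x) * norm (h x)" by (rule Cauchy_Schwarz_ineq2)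
      then show "norm (g x \<bullet> h x) \<le> norm ((norm (g x))\<^sup>2 + (norm (h x))\<^sup>2)" using le[of "norm (g x)" "norm (h x)"] by simp
    qed
  qed measurable
  show "integrable lborel (\<lambda>x. V0 x * (u x * v x))"
  proof (rule Bochner_Integration.integrable_bound[OF i(2)])
    show "AE x in lborel. norm (V0 x * (u x * v x)) \<le> norm (Vmax * ((u x)\<^sup>2 + (v x)\<^sup>2))"
    proof (rule AE_I2)
      fix x
      have "\<bar>V0 x\<bar> * \<bar>u x * v x\<bar> \<le> Vmax * ((u x)\<^sup>2 + (v x)\<^sup>2)"
        by (intro mult_mono V0_bound le Vmax_nonneg) auto
      then show "norm (V0 x * (u x * v x)) \<le> norm (Vmax * ((u x)\<^sup>2 + (v x)\<^sup>2))"
        using Vmax_nonneg by (simp add: abs_mult)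
    qed
  qed measurable
qed

definition pairing :: "('a \<Rightarrow> real) \<Rightarrow> ('a \<Rightarrow> 'a) \<Rightarrow> ('a \<Rightarrow> real) \<Rightarrow> ('a \<Rightarrow> 'a) \<Rightarrow> real" where
  "pairing u g v h = (\<integral>x. g x \<bullet> h x + V0 x * (u x * v x) \<partial>lborel)"

lemma energy_expand:
  assumes u: "wgrad u g" and v: "wgrad v h"
  shows "energy (\<lambda>x. u x + t * v x) (\<lambda>x. g x + t *\<^sub>R h x) = energy u g + 2 * t * pairing u g v h + t\<^sup>2 * energy v h"
proof -
  have "energy (\<lambda>x. u x + t * v x) (\<lambda>x. g x + t *\<^sub>R h x) =
    (\<integral>x. ((norm (g x))\<^sup>2 + V0 x * (u x)\<^sup>2) + (2 * t * (g x \<bullet> h x + V0 x * (u x * v x)) + t\<^sup>2 * ((norm (h x))\<^sup>2 + V0 x * (v x)\<^sup>2)) \<partial>lborel)"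
    unfolding energy_def
  proof (intro Bochner_Integration.integral_cong refl)
    fix x
    have "(norm (g x + t *\<^sub>R h x))\<^sup>2 = (norm (g x))\<^sup>2 + 2 * t * (g x \<bullet> h x) + t\<^sup>2 * (norm (h x))\<^sup>2"
      unfolding power2_norm_eq_inner by (simp add: inner_simps inner_commute algebra_simps power2_eq_square)
    then show "(norm (g x + t *\<^sub>R h x))\<^sup>2 + V0 x * (u x + t * v x)\<^sup>2 = ((norm (g x))\<^sup>2 + V0 x * (u x)\<^sup>2) +
      (2 * t * (g x \<bullet> h x + V0 x * (u x * v x)) + t\<^sup>2 * ((norm (h x))\<^sup>2 + V0 x * (v x)\<^sup>2))"
      by (simp add: power2_sum power_mult_distrib algebra_simps)
  qed
  also have "\<dots> = energy u g + (2 * t * pairing u g v h + t\<^sup>2 * energy v h)"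
    unfolding energy_def pairing_def
    using energy_integrable[OF u] energy_integrable[OF v] pairing_integrable[OF u v]
    by (subst Bochner_Integration.integral_add, simp, simp, subst Bochner_Integration.integral_add) auto
  finally show ?thesis by simp
qed

text \<open>The constraint is expressed by the modular, which is equivalent to the norm being $1$.\<close>
definition minimizer :: "('a \<Rightarrow> real) \<Rightarrow> ('a \<Rightarrow> 'a) \<Rightarrow> bool" where
  "minimizer u g \<longleftrightarrow> wgrad u g \<and> modular u = 1 \<and> energy u g = lambda1 V p"

text \<open>Along the line $u + t v$ in a direction tangent to the constraint the modular is $1 + o(t)$, hence so
is the norm by \<open>Lux_le\<close> and \<open>Lux_ge\<close>. Then \<open>energy_ge_Lux\<close> says that
$2 t \langle u, v\rangle + t^2 J(v) \ge - o(t)$ for both signs of \<open>t\<close>, with the bilinear form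
\<open>pairing\<close>.\<close>
lemma first_variation:
  assumes m: "minimizer u g" and v: "wgrad v h" and pv: "powr_integrable v"
    and tangent: "(\<integral>x. nl (p x) (u x) * v x \<partial>lborel) = 0"
  shows "pairing u g v h = 0"
proof -
  have u: "wgrad u g" and mod: "modular u = 1" and E: "energy u g = lambda1 V p"
    using m by (auto simp: minimizer_def)
  note [measurable] = wgrad_measurable[OF u] wgrad_measurable[OF v]
  note mu = modular_1_powr_integrable[OF wgrad_measurable(1)[OF u] mod]
  let ?l = "lambda1 V p" and ?B = "pairing u g v h" and ?D = "energy v h"
  define \<rho> where "\<rho> t = (\<integral>x. \<bar>u x + t * v x\<bar> powr p x / p x \<partial>lborel)" for t
  have rho0: "\<rho> 0 = 1" unfolding \<rho>_def using mu(2) by simp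
  have d: "(\<rho> has_real_derivative 0) (at 0)"
    using modular_has_derivative[OF mu(1) pv] tangent unfolding \<rho>_def by simp
  have modt: "modular (\<lambda>x. u x + t * v x) = ennreal (\<rho> t)" for t
    unfolding \<rho>_def by (intro modular_integral powr_integrable_add powr_integrable_cmult mu pv)
  have key: "- (3 * \<bar>?l\<bar> * \<bar>\<rho> t - 1\<bar>) \<le> 2 * t * ?B + t\<^sup>2 * ?D" if small: "\<bar>\<rho> t - 1\<bar> \<le> 1/2" for t
  proof -
    have w: "wgrad (\<lambda>x. u x + t * v x) (\<lambda>x. g x + t *\<^sub>R h x)"
      using wgrad_lincomb[OF u v, of 1 t] by simp
    have [measurable]: "(\<lambda>x. u x + t * v x) \<in> borel_measurable borel" by measurable
    have up: "Lux p (\<lambda>x. u x + t * v x) \<le> ennreal (1 + \<bar>\<rho> t - 1\<bar>)"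
      by (rule Lux_le) (auto simp: modt simp del: ennreal_plus intro!: ennreal_leI)
    have lo: "ennreal (1 - \<bar>\<rho> t - 1\<bar>) \<le> Lux p (\<lambda>x. u x + t * v x)"
      using small by (intro Lux_ge) (auto simp: modt intro!: ennreal_leI)
    obtain \<gamma> where g: "Lux p (\<lambda>x. u x + t * v x) = ennreal \<gamma>" "\<gamma> \<ge> 0"
      using up by (cases "Lux p (\<lambda>x. u x + t * v x)") (auto simp: top_unique)
    have g1: "\<gamma> \<le> 1 + \<bar>\<rho> t - 1\<bar>" using up g by (subst (asm) g(1), subst (asm) ennreal_le_iff) auto
    have g2: "1 - \<bar>\<rho> t - 1\<bar> \<le> \<gamma>" using lo g by (subst (asm) g(1), subst (asm) ennreal_le_iff) auto
    have g0: "\<gamma> > 0" using g2 small by linarith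
    have "?l * \<gamma>\<^sup>2 \<le> ?l + 2 * t * ?B + t\<^sup>2 * ?D"
      using energy_ge_Lux[OF w g(1) g0] unfolding energy_expand[OF u v] E .
    moreover have "\<bar>?l * \<gamma>\<^sup>2 - ?l\<bar> \<le> 3 * \<bar>?l\<bar> * \<bar>\<rho> t - 1\<bar>"
    proof -
      have "\<bar>?l * \<gamma>\<^sup>2 - ?l\<bar> = \<bar>?l\<bar> * (\<bar>\<gamma> - 1\<bar> * \<bar>\<gamma> + 1\<bar>)"
        by (simp add: abs_mult[symmetric] power2_eq_square algebra_simps)
      also have "\<dots> \<le> \<bar>?l\<bar> * (\<bar>\<rho> t - 1\<bar> * 3)"
        using g1 g2 small g0 by (intro mult_left_mono mult_mono) auto
      finally show ?thesis by simp
    qed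
    ultimately show ?thesis by linarith
  qed
  have q: "((\<lambda>t. \<bar>(\<rho> t - 1) / t\<bar>) \<longlongrightarrow> 0) (at 0)"
    using d rho0 by (intro tendsto_rabs_zero) (simp add: has_field_derivative_iff)
  have cont: "(\<rho> \<longlongrightarrow> 1) (at 0)" using DERIV_isCont[OF d] rho0 by (simp add: isCont_def)
  have "\<forall>\<^sub>F t in at 0. dist (\<rho> t) 1 < 1/2" by (rule tendstoD[OF cont]) simp
  then have small: "\<forall>\<^sub>F t in at 0. \<bar>\<rho> t - 1\<bar> \<le> 1/2" by eventually_elim (auto simp: dist_real_def)
  have "0 \<le> 2 * ?B"
  proof (rule tendsto_le[of "at_right 0" "\<lambda>t. 2 * ?B + t * ?D" _ "\<lambda>t. - (3 * \<bar>?l\<bar> * \<bar>(\<rho> t - 1) / t\<bar>)"])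
    have "((\<lambda>t. 2 * ?B + t * ?D) \<longlongrightarrow> 2 * ?B + 0 * ?D) (at_right 0)" by (intro tendsto_intros)
    then show "((\<lambda>t. 2 * ?B + t * ?D) \<longlongrightarrow> 2 * ?B) (at_right 0)" by simp
    have "((\<lambda>t. - (3 * \<bar>?l\<bar> * \<bar>(\<rho> t - 1) / t\<bar>)) \<longlongrightarrow> - (3 * \<bar>?l\<bar> * 0)) (at_right 0)"
      by (intro tendsto_intros tendsto_within_subset[OF q]) auto
    then show "((\<lambda>t. - (3 * \<bar>?l\<bar> * \<bar>(\<rho> t - 1) / t\<bar>)) \<longlongrightarrow> 0) (at_right 0)" by simp
    have "\<forall>\<^sub>F t in at_right 0. \<bar>\<rho> t - 1\<bar> \<le> 1/2" using small by (rule filter_leD[OF at_le, rotated]) auto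
    moreover have "\<forall>\<^sub>F t in at_right 0. (0::real) < t" by (rule eventually_at_right_less)
    ultimately show "\<forall>\<^sub>F t in at_right 0. - (3 * \<bar>?l\<bar> * \<bar>(\<rho> t - 1) / t\<bar>) \<le> 2 * ?B + t * ?D"
    proof eventually_elim
      case (elim t)
      have "- (3 * \<bar>?l\<bar> * \<bar>(\<rho> t - 1) / t\<bar>) = - (3 * \<bar>?l\<bar> * \<bar>\<rho> t - 1\<bar>) / t" using elim by (simp add: abs_divide)
      also have "\<dots> \<le> (2 * t * ?B + t\<^sup>2 * ?D) / t" using key[OF elim(1)] elim(2) by (intro divide_right_mono) auto
      also have "\<dots> = 2 * ?B + t * ?D" using elim(2) by (simp add: add_divide_distrib power2_eq_square)
      finally show ?case .
    qed
  qed simp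
  moreover have "2 * ?B \<le> 0"
  proof (rule tendsto_le[of "at_left 0" "\<lambda>t. 3 * \<bar>?l\<bar> * \<bar>(\<rho> t - 1) / t\<bar>" _ "\<lambda>t. 2 * ?B + t * ?D"])
    have "((\<lambda>t. 2 * ?B + t * ?D) \<longlongrightarrow> 2 * ?B + 0 * ?D) (at_left 0)" by (intro tendsto_intros)
    then show "((\<lambda>t. 2 * ?B + t * ?D) \<longlongrightarrow> 2 * ?B) (at_left 0)" by simp
    have "((\<lambda>t. 3 * \<bar>?l\<bar> * \<bar>(\<rho> t - 1) / t\<bar>) \<longlongrightarrow> 3 * \<bar>?l\<bar> * 0) (at_left 0)"
      by (intro tendsto_intros tendsto_within_subset[OF q]) auto
    then show "((\<lambda>t. 3 * \<bar>?l\<bar> * \<bar>(\<rho> t - 1) / t\<bar>) \<longlongrightarrow> 0) (at_left 0)" by simp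
    have "\<forall>\<^sub>F t in at_left 0. \<bar>\<rho> t - 1\<bar> \<le> 1/2" using small by (rule filter_leD[OF at_le, rotated]) auto
    moreover have "\<forall>\<^sub>F t in at_left 0. t < (0::real)" by (auto simp: eventually_at_left_field intro!: exI[of _ "-1"])
    ultimately show "\<forall>\<^sub>F t in at_left 0. 2 * ?B + t * ?D \<le> 3 * \<bar>?l\<bar> * \<bar>(\<rho> t - 1) / t\<bar>"
    proof eventually_elim
      case (elim t)
      have "2 * ?B + t * ?D = (2 * t * ?B + t\<^sup>2 * ?D) / t" using elim(2) by (simp add: add_divide_distrib power2_eq_square)
      also have "\<dots> \<le> - (3 * \<bar>?l\<bar> * \<bar>\<rho> t - 1\<bar>) / t" using key[OF elim(1)] elim(2) by (intro divide_right_mono_neg) auto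
      also have "\<dots> = 3 * \<bar>?l\<bar> * \<bar>(\<rho> t - 1) / t\<bar>" using elim by (simp add: abs_divide)
      finally show ?case .
    qed
  qed simp
  ultimately show ?thesis by linarith
qed

text \<open>The value is forced by testing the equation with \<open>u\<close> itself. It is visibly the same for two
minimizers with the same $\int |u|^{p(x)} dx$, which is what is needed for \<open>u\<close> and its
polarization.\<close>
definition multiplier :: "('a \<Rightarrow> real) \<Rightarrow> real" where
  "multiplier u = lambda1 V p / (\<integral>x. \<bar>u x\<bar> powr p x \<partial>lborel)"

definition source :: "real \<Rightarrow> ('a \<Rightarrow> real) \<Rightarrow> 'a \<Rightarrow> real" where
  "source \<mu> u x = \<mu> * nl (p x) (u x) - V0 x * u x"

lemma source_loc_int:
  assumes w: "wgrad u g" and pu: "powr_integrable u"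
  shows "loc_int (source \<mu> u)" "loc_int (\<lambda>x. nl (p x) (u x))" "loc_int (\<lambda>x. V0 x * u x)"
proof -
  note [measurable] = wgrad_measurable[OF w]
  show 1: "loc_int (\<lambda>x. nl (p x) (u x))"
  proof (rule loc_int_bound)
    show "loc_int (\<lambda>x. 1 + \<bar>u x\<bar> powr p x)"
      using pu by (intro loc_int_add loc_int_const integrable_imp_loc_int) (simp add: powr_integrable_def)
    show "AE x in lborel. \<bar>nl (p x) (u x)\<bar> \<le> 1 + \<bar>u x\<bar> powr p x"
    proof (rule AE_I2)
      fix x
      show "\<bar>nl (p x) (u x)\<bar> \<le> 1 + \<bar>u x\<bar> powr p x"
      proof (cases "\<bar>u x\<bar> \<le> 1")
        case True
        then have "\<bar>u x\<bar> powr (p x - 1) \<le> 1" using p_gt_2[of x] by (intro powr_le1) auto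
        then show ?thesis using powr_ge_zero[of "\<bar>u x\<bar>" "p x"] unfolding abs_nl by linarith
      next
        case False
        then have "\<bar>u x\<bar> powr (p x - 1) \<le> \<bar>u x\<bar> powr p x" by (intro powr_mono) auto
        then show ?thesis unfolding abs_nl by linarith
      qed
    qed
  qed measurable
  show 2: "loc_int (\<lambda>x. V0 x * u x)"
  proof (rule loc_int_bound)
    show "loc_int (\<lambda>x. Vmax * \<bar>u x\<bar>)" by (intro loc_int_cmult loc_int_abs wgrad_loc_int[OF w])
    show "AE x in lborel. \<bar>V0 x * u x\<bar> \<le> Vmax * \<bar>u x\<bar>"
      using V0_bound by (intro AE_I2) (simp add: abs_mult mult_right_mono)
  qed measurable
  show "loc_int (source \<mu> u)"
    unfolding source_def[abs_def] by (intro loc_int_diff loc_int_cmult 1 2)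
qed

text \<open>A test function becomes tangent to the constraint after subtracting a multiple of \<open>u\<close>, because the
derivative of the modular in the direction \<open>u\<close> is $\int |u|^{p(x)} dx > 0$.\<close>
theorem Euler_Lagrange:
  assumes m: "minimizer u g" and t: "test_function \<phi>"
  shows "(\<integral>x. laplacian \<phi> x * u x \<partial>lborel) = - (\<integral>x. \<phi> x * source (multiplier u) u x \<partial>lborel)"
proof -
  have u: "wgrad u g" and mod: "modular u = 1" and E: "energy u g = lambda1 V p"
    using m by (auto simp: minimizer_def)
  note mu = modular_1_powr_integrable[OF wgrad_measurable(1)[OF u] mod]
  let ?K = "\<integral>x. \<bar>u x\<bar> powr p x \<partial>lborel" and ?Q = "\<integral>x. nl (p x) (u x) * \<phi> x \<partial>lborel"
  \<comment> \<open>chosen such that $\phi - c u$ is tangent to the constraint\<close>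
  define c where "c = ?Q / ?K"
  note w\<phi> = wgrad_test_function[OF t]
  have w: "wgrad (\<lambda>x. \<phi> x + - c * u x) (\<lambda>x. grad \<phi> x + - c *\<^sub>R g x)"
    using wgrad_lincomb[OF w\<phi> u, of 1 "-c"] by simp
  have pw: "powr_integrable (\<lambda>x. \<phi> x + - c * u x)"
    by (intro powr_integrable_add powr_integrable_test t powr_integrable_cmult mu)
  have "(\<integral>x. nl (p x) (u x) * (\<phi> x + - c * u x) \<partial>lborel) = (\<integral>x. nl (p x) (u x) * \<phi> x - c * \<bar>u x\<bar> powr p x \<partial>lborel)"
    by (intro Bochner_Integration.integral_cong) (auto simp: algebra_simps nl_mult_self[symmetric])
  also have "\<dots> = ?Q - c * ?K"
    using nl_integrable[OF mu(1) powr_integrable_test[OF t]] mu(1) by (simp add: powr_integrable_def)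
  also have "\<dots> = 0" using mu(4) by (simp add: c_def)
  finally have "pairing u g (\<lambda>x. \<phi> x + - c * u x) (\<lambda>x. grad \<phi> x + - c *\<^sub>R g x) = 0"
    by (rule first_variation[OF m w pw])
  moreover have "pairing u g (\<lambda>x. \<phi> x + - c * u x) (\<lambda>x. grad \<phi> x + - c *\<^sub>R g x) =
    (\<integral>x. (g x \<bullet> grad \<phi> x + V0 x * (u x * \<phi> x)) - c * ((norm (g x))\<^sup>2 + V0 x * (u x)\<^sup>2) \<partial>lborel)"
    unfolding pairing_def
    by (intro Bochner_Integration.integral_cong)
       (simp_all add: algebra_simps inner_simps power2_norm_eq_inner power2_eq_square[of "u _"])
  moreover have "\<dots> = ((\<integral>x. g x \<bullet> grad \<phi> x \<partial>lborel) + (\<integral>x. V0 x * (u x * \<phi> x) \<partial>lborel)) - c * energy u g"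
    unfolding energy_def using pairing_integrable[OF u w\<phi>] energy_integrable[OF u] by simp
  ultimately have eq: "(\<integral>x. g x \<bullet> grad \<phi> x \<partial>lborel) + (\<integral>x. V0 x * (u x * \<phi> x) \<partial>lborel) = c * lambda1 V p"
    using E by simp
  have "(\<integral>x. \<phi> x * source (multiplier u) u x \<partial>lborel) = (\<integral>x. multiplier u * (nl (p x) (u x) * \<phi> x) - V0 x * (u x * \<phi> x) \<partial>lborel)"
    by (intro Bochner_Integration.integral_cong) (auto simp: source_def algebra_simps)
  also have "\<dots> = multiplier u * ?Q - (\<integral>x. V0 x * (u x * \<phi> x) \<partial>lborel)"
    using nl_integrable[OF mu(1) powr_integrable_test[OF t]] pairing_integrable[OF u w\<phi>] by simp
  also have "multiplier u * ?Q = c * lambda1 V p" by (simp add: multiplier_def c_def)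
  finally show ?thesis
    using eq wgrad_laplacian(3)[OF u t] by (simp add: mult.commute)
qed

end

section \<open>Potential estimates for weak solutions\<close>

text \<open>Solutions of $-\Delta u = f$ in the sense of distributions.\<close>
definition weak_solution :: "('a::euclidean_space \<Rightarrow> real) \<Rightarrow> ('a \<Rightarrow> real) \<Rightarrow> bool" where
  "weak_solution u f \<longleftrightarrow> loc_int u \<and> loc_int f \<and>
     (\<forall>\<phi>. test_function \<phi> \<longrightarrow> (\<integral>x. laplacian \<phi> x * u x \<partial>lborel) = - (\<integral>x. \<phi> x * f x \<partial>lborel))"

lemma weak_solution_mean_derivative:
  assumes u: "weak_solution u f" and t: "t > 0"
  shows "((\<lambda>t. mean t u x) has_real_derivative - (\<integral>y. pot t x y * f y \<partial>lborel)) (at t)"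
  using mean_has_derivative_scale[of u t x] u t test_function_pot[OF t, of x] by (auto simp: weak_solution_def)

lemma pot_le:
  fixes x :: "'a::euclidean_space"
  shows "t > 0 \<Longrightarrow> pot t x y \<le> t / (2 * t ^ DIM('a))"
  unfolding pot_def using mult_left_mono[OF profile_bounds(2), of "t / (2 * t ^ DIM('a))"] by simp

lemma continuous_on_integral_pot:
  fixes f :: "'a::euclidean_space \<Rightarrow> real"
  assumes f: "loc_int f" and \<delta>: "0 < \<delta>"
  shows "continuous_on {\<delta>..R} (\<lambda>t. \<integral>y. pot t x y * f y \<partial>lborel)"
proof (rule continuous_on_integral_kernel[OF f, where r="norm x + R" and B="R / (2 * \<delta> ^ DIM('a))"])
  fix t y assume t: "t \<in> {\<delta>..R}"
  have "pot t x y \<le> t / (2 * t ^ DIM('a))" using t \<delta> by (intro pot_le) auto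
  also have "\<dots> \<le> R / (2 * \<delta> ^ DIM('a))" using t \<delta> by (intro frac_le mult_left_mono power_mono) auto
  finally show "\<bar>pot t x y\<bar> \<le> R / (2 * \<delta> ^ DIM('a))" using pot_nonneg[of t x y] t \<delta> by simp
  show "norm x + R < norm y \<Longrightarrow> pot t x y = 0" using t \<delta> by (intro pot_support) auto
next
  show "continuous_on {\<delta>..R} (\<lambda>t. pot t x y)" for y
    unfolding pot_def using \<delta> by (intro continuous_intros) auto
qed measurable

text \<open>The cut-off substitute for the fundamental solution of $-\Delta$. The value on the
diagonal may be infinite, hence the extended nonnegative reals.\<close>
definition pot_kernel :: "real \<Rightarrow> 'a::euclidean_space \<Rightarrow> 'a \<Rightarrow> ennreal" where
  "pot_kernel R x y = (\<integral>\<^sup>+t. indicator {0<..R} t * ennreal (pot t x y) \<partial>lborel)"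

lemma pot_kernel_commute: "pot_kernel R x y = pot_kernel R y x"
  by (simp add: pot_kernel_def pot_commute[of _ x])

lemma measurable_pot_comp [measurable (raw)]:
  fixes x y :: "'b \<Rightarrow> 'a::euclidean_space"
  assumes [measurable]: "t \<in> borel_measurable S" "x \<in> borel_measurable S" "y \<in> borel_measurable S"
  shows "(\<lambda>z. pot (t z) (x z) (y z)) \<in> borel_measurable S"
  unfolding pot_def by measurable

lemma measurable_pot_kernel [measurable (raw)]:
  fixes x y :: "'b \<Rightarrow> 'a::euclidean_space"
  assumes [measurable]: "x \<in> borel_measurable S" "y \<in> borel_measurable S"
  shows "(\<lambda>z. pot_kernel R (x z) (y z)) \<in> borel_measurable S"
  unfolding pot_kernel_def by measurable

lemma pot_kernel_integral:
  assumes [measurable]: "F \<in> borel_measurable (borel :: 'a::euclidean_space measure)"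
  shows "(\<integral>\<^sup>+y. pot_kernel R x y * F y \<partial>lborel) = (\<integral>\<^sup>+t. indicator {0<..R} t * (\<integral>\<^sup>+y. ennreal (pot t x y) * F y \<partial>lborel) \<partial>lborel)"
proof -
  have "(\<integral>\<^sup>+y. pot_kernel R x y * F y \<partial>lborel) = (\<integral>\<^sup>+y. \<integral>\<^sup>+t. indicator {0<..R} t * (ennreal (pot t x y) * F y) \<partial>lborel \<partial>lborel)"
    unfolding pot_kernel_def by (intro nn_integral_cong, subst nn_integral_multc[symmetric]) (auto simp: mult.assoc)
  also have "\<dots> = (\<integral>\<^sup>+t. \<integral>\<^sup>+y. indicator {0<..R} t * (ennreal (pot t x y) * F y) \<partial>lborel \<partial>lborel)"
    by (rule lborel_pair.Fubini') measurable
  also have "\<dots> = (\<integral>\<^sup>+t. indicator {0<..R} t * (\<integral>\<^sup>+y. ennreal (pot t x y) * F y \<partial>lborel) \<partial>lborel)"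
    by (intro nn_integral_cong nn_integral_cmult) measurable
  finally show ?thesis .
qed

text \<open>The fundamental theorem of calculus in the radius: the derivative of the mollification of \<open>u\<close> at
the radius \<open>t\<close> is the integral of \<open>f\<close> against $pot_t$, up to the sign.\<close>
lemma weak_solution_mean_bound:
  fixes u f :: "'a::euclidean_space \<Rightarrow> real"
  assumes u: "weak_solution u f" and \<delta>: "0 < \<delta>" "\<delta> \<le> R"
  shows "ennreal \<bar>mean \<delta> u x\<bar> \<le> ennreal \<bar>mean R u x\<bar> + (\<integral>\<^sup>+y. pot_kernel R x y * ennreal \<bar>f y\<bar> \<partial>lborel)"
proof -
  have f: "loc_int f" and u': "loc_int u" using u by (auto simp: weak_solution_def)
  have [measurable]: "f \<in> borel_measurable borel" using f by measurable
  define D where "D t = (\<integral>y. pot t x y * f y \<partial>lborel)" for t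
  have cont: "continuous_on {\<delta>..R} (\<lambda>t. - D t)"
    unfolding D_def by (intro continuous_intros continuous_on_integral_pot f \<delta>)
  have FTC: "(\<integral>t. indicator {\<delta>..R} t *\<^sub>R (- D t) \<partial>lborel) = mean R u x - mean \<delta> u x"
  proof (rule integral_FTC_atLeastAtMost[OF \<delta>(2) _ cont])
    fix t assume "\<delta> \<le> t" "t \<le> R"
    then have "0 < t" using \<delta> by simp
    from has_field_derivative_at_within[OF weak_solution_mean_derivative[OF u this]]
    have "((\<lambda>t. mean t u x) has_real_derivative - D t) (at t within {\<delta>..R})"
      unfolding D_def .
    then show "((\<lambda>t. mean t u x) has_vector_derivative - D t) (at t within {\<delta>..R})"
      by (simp add: has_real_derivative_iff_has_vector_derivative)
  qed
  have int: "integrable lborel (\<lambda>t. indicator {\<delta>..R} t *\<^sub>R (- D t))"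
    using borel_integrable_atLeastAtMost'[OF cont] by (simp add: set_integrable_def)
  have "ennreal \<bar>mean \<delta> u x\<bar> \<le> ennreal (\<bar>mean R u x\<bar> + \<bar>mean R u x - mean \<delta> u x\<bar>)"
    by (intro ennreal_leI) linarith
  also have "\<dots> = ennreal \<bar>mean R u x\<bar> + ennreal \<bar>mean R u x - mean \<delta> u x\<bar>" by simp
  also have "\<dots> \<le> ennreal \<bar>mean R u x\<bar> + (\<integral>\<^sup>+y. pot_kernel R x y * ennreal \<bar>f y\<bar> \<partial>lborel)"
  proof (rule add_left_mono)
    have "ennreal \<bar>mean R u x - mean \<delta> u x\<bar> \<le> (\<integral>\<^sup>+t. ennreal (norm (indicator {\<delta>..R} t *\<^sub>R (- D t))) \<partial>lborel)"
      unfolding FTC[symmetric] using integral_norm_bound_ennreal[OF int] by (simp only: real_norm_def)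
    also have "\<dots> \<le> (\<integral>\<^sup>+t. indicator {0<..R} t * (\<integral>\<^sup>+y. ennreal (pot t x y) * ennreal \<bar>f y\<bar> \<partial>lborel) \<partial>lborel)"
    proof (rule nn_integral_mono)
      fix t
      show "ennreal (norm (indicator {\<delta>..R} t *\<^sub>R (- D t))) \<le> indicator {0<..R} t * (\<integral>\<^sup>+y. ennreal (pot t x y) * ennreal \<bar>f y\<bar> \<partial>lborel)"
      proof (cases "t \<in> {\<delta>..R}")
        case True
        then have t: "t > 0" "t \<le> R" using \<delta> by auto
        have "ennreal (norm (D t)) \<le> (\<integral>\<^sup>+y. ennreal (norm (pot t x y * f y)) \<partial>lborel)"
          unfolding D_def by (rule integral_norm_bound_ennreal[OF integrable_pot[OF f t(1)]])
        also have "\<dots> = (\<integral>\<^sup>+y. ennreal (pot t x y) * ennreal \<bar>f y\<bar> \<partial>lborel)"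
          by (intro nn_integral_cong) (simp add: abs_mult ennreal_mult' abs_of_nonneg[OF pot_nonneg[OF t(1)]] pot_nonneg[OF t(1)])
        finally show ?thesis using True t by simp
      qed simp
    qed
    also have "\<dots> = (\<integral>\<^sup>+y. pot_kernel R x y * ennreal \<bar>f y\<bar> \<partial>lborel)"
      by (rule pot_kernel_integral[symmetric]) measurable
    finally show "ennreal \<bar>mean R u x - mean \<delta> u x\<bar> \<le> (\<integral>\<^sup>+y. pot_kernel R x y * ennreal \<bar>f y\<bar> \<partial>lborel)" .
  qed
  finally show ?thesis .
qed

lemma weak_solution_pointwise_bound:
  fixes u f :: "'a::euclidean_space \<Rightarrow> real"
  assumes u: "weak_solution u f" and R: "0 < R"
  shows "AE x in lborel. ennreal (moll_mass TYPE('a) * \<bar>u x\<bar>) \<le> ennreal \<bar>mean R u x\<bar> + (\<integral>\<^sup>+y. pot_kernel R x y * ennreal \<bar>f y\<bar> \<partial>lborel)"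
proof (rule AE_if_AE_balls)
  fix n :: nat
  have u': "loc_int u" using u by (auto simp: weak_solution_def)
  define t where "t n = min R 1 * (1 / real (Suc n))" for n
  have tle: "t n \<le> min R 1" for n
    using mult_left_mono[of "1 / real (Suc n)" 1 "min R 1"] R by (simp add: t_def)
  have t: "t n > 0" "t n \<le> 1" "t n \<le> R" for n
    using R tle[of n] by (simp_all add: t_def)
  have t0: "t \<longlonglongrightarrow> 0" unfolding t_def by (rule tendsto_mult_right_zero[OF inverse_Suc_tendsto_0])
  obtain s where s: "strict_mono s" "AE x in lborel. norm x \<le> real n \<longrightarrow> (\<lambda>n. mean (t (s n)) u x) \<longlonglongrightarrow> moll_mass TYPE('a) * u x"
    by (rule mean_tendsto_AE_subseq[OF u' t(1,2) t0])
  from s(2) show "AE x in lborel. norm x \<le> real n \<longrightarrow> ennreal (moll_mass TYPE('a) * \<bar>u x\<bar>) \<le> ennreal \<bar>mean R u x\<bar> + (\<integral>\<^sup>+y. pot_kernel R x y * ennreal \<bar>f y\<bar> \<partial>lborel)"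
  proof eventually_elim
    case (elim x)
    show ?case
    proof
      assume "norm x \<le> real n"
      then have "(\<lambda>n. mean (t (s n)) u x) \<longlonglongrightarrow> moll_mass TYPE('a) * u x" using elim by blast
      then have "(\<lambda>n. ennreal \<bar>mean (t (s n)) u x\<bar>) \<longlonglongrightarrow> ennreal \<bar>moll_mass TYPE('a) * u x\<bar>"
        by (intro tendsto_ennrealI tendsto_rabs)
      then have "(\<lambda>n. ennreal \<bar>mean (t (s n)) u x\<bar>) \<longlonglongrightarrow> ennreal (moll_mass TYPE('a) * \<bar>u x\<bar>)"
        using moll_mass_pos[where 'a='a] by (simp only: abs_mult abs_of_pos)
      then show "ennreal (moll_mass TYPE('a) * \<bar>u x\<bar>) \<le> ennreal \<bar>mean R u x\<bar> + (\<integral>\<^sup>+y. pot_kernel R x y * ennreal \<bar>f y\<bar> \<partial>lborel)"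
        by (rule LIMSEQ_le_const2) (use weak_solution_mean_bound[OF u t(1) t(3)] in blast)
    qed
  qed
qed

text \<open>If \<open>U\<close> is bounded by a constant plus the potential of $b U$, and the potential of \<open>b\<close> is small,
then the constant absorbs the part of \<open>U\<close> below \<open>c\<close>, and the excess $E = (U - c)^+$ satisfies
$Z E \le G(b E)$. Integrating this against \<open>b\<close> and using the symmetry of the kernel
gives $Z \int b E \le \frac{Z}{2} \int b E$. As this integral is finite, $b E = 0$ almost
everywhere, and then $E = 0$.\<close>
lemma kernel_absorption:
  fixes G :: "'a::euclidean_space \<Rightarrow> 'a \<Rightarrow> ennreal" and U b :: "'a \<Rightarrow> ennreal"
  assumes G[measurable]: "(\<lambda>(x, y). G x y) \<in> borel_measurable (borel \<Otimes>\<^sub>M borel)" and sym: "\<And>x y. G x y = G y x"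
    and [measurable]: "U \<in> borel_measurable borel" "b \<in> borel_measurable borel"
    and Z: "0 < Z" and c: "0 \<le> c"
    and small: "\<And>x. (\<integral>\<^sup>+y. G x y * b y \<partial>lborel) \<le> ennreal (Z / 2)"
    and bound: "AE x in lborel. ennreal Z * U x \<le> ennreal (Z / 2 * c) + (\<integral>\<^sup>+y. G x y * (b y * U y) \<partial>lborel)"
    and fin: "(\<integral>\<^sup>+x. b x * (U x - ennreal c) \<partial>lborel) < \<infinity>"
  shows "AE x in lborel. U x \<le> ennreal c"
proof -
  define E where "E x = U x - ennreal c" for x
  have [measurable]: "E \<in> borel_measurable borel" unfolding E_def by measurable
  have UE: "U x \<le> ennreal c + E x" for x
  proof (cases "ennreal c \<le> U x")
    case True then show ?thesis unfolding E_def add_diff_inverse_ennreal[OF True] by simp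
  next
    case False
    then have "U x \<le> ennreal c" by simp
    also have "\<dots> \<le> ennreal c + E x" by (rule add_increasing2) auto
    finally show ?thesis .
  qed
  have mG: "G x \<in> borel_measurable borel" for x
    using measurable_compose[OF measurable_Pair1'[of x borel borel] G] by simp
  note [measurable] = mG
  have E1: "AE x in lborel. ennreal Z * E x \<le> (\<integral>\<^sup>+y. G x y * (b y * E y) \<partial>lborel)"
    using bound
  proof eventually_elim
    case (elim x)
    have "(\<integral>\<^sup>+y. G x y * (b y * U y) \<partial>lborel) \<le> (\<integral>\<^sup>+y. G x y * b y * ennreal c + G x y * (b y * E y) \<partial>lborel)"
    proof (rule nn_integral_mono)
      fix y
      have "G x y * (b y * U y) \<le> G x y * (b y * (ennreal c + E y))" by (intro mult_left_mono UE) auto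
      then show "G x y * (b y * U y) \<le> G x y * b y * ennreal c + G x y * (b y * E y)" by (simp add: algebra_simps)
    qed
    also have "\<dots> = (\<integral>\<^sup>+y. G x y * b y \<partial>lborel) * ennreal c + (\<integral>\<^sup>+y. G x y * (b y * E y) \<partial>lborel)"
      by (subst nn_integral_add) (auto simp: nn_integral_multc)
    also have "\<dots> \<le> ennreal (Z / 2) * ennreal c + (\<integral>\<^sup>+y. G x y * (b y * E y) \<partial>lborel)"
      by (intro add_right_mono mult_right_mono small) auto
    finally have "ennreal Z * U x \<le> ennreal (Z / 2 * c) + (ennreal (Z / 2) * ennreal c + (\<integral>\<^sup>+y. G x y * (b y * E y) \<partial>lborel))"
      using elim by (meson add_left_mono order_trans)
    also have "\<dots> = ennreal (Z * c) + (\<integral>\<^sup>+y. G x y * (b y * E y) \<partial>lborel)"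
      using Z c by (simp add: ennreal_mult'[symmetric] ennreal_plus[symmetric] add.assoc[symmetric] del: ennreal_plus)
    finally have "ennreal Z * U x - ennreal (Z * c) \<le> (\<integral>\<^sup>+y. G x y * (b y * E y) \<partial>lborel)"
      by (simp add: ennreal_minus_le_iff)
    then show ?case unfolding E_def using Z c by (simp add: ennreal_right_diff_distrib ennreal_mult')
  qed
  have "ennreal Z * (\<integral>\<^sup>+x. b x * E x \<partial>lborel) = (\<integral>\<^sup>+x. b x * (ennreal Z * E x) \<partial>lborel)"
    by (subst nn_integral_cmult[symmetric]) (auto simp: mult.left_commute)
  also have "\<dots> \<le> (\<integral>\<^sup>+x. b x * (\<integral>\<^sup>+y. G x y * (b y * E y) \<partial>lborel) \<partial>lborel)"
    using E1 by (intro nn_integral_mono_AE) (auto elim!: eventually_mono intro: mult_left_mono)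
  also have "\<dots> = (\<integral>\<^sup>+x. \<integral>\<^sup>+y. b x * (G x y * (b y * E y)) \<partial>lborel \<partial>lborel)"
    by (intro nn_integral_cong nn_integral_cmult[symmetric]) measurable
  also have "\<dots> = (\<integral>\<^sup>+y. \<integral>\<^sup>+x. b x * (G x y * (b y * E y)) \<partial>lborel \<partial>lborel)"
    by (rule lborel_pair.Fubini') measurable
  also have "\<dots> = (\<integral>\<^sup>+y. b y * E y * (\<integral>\<^sup>+x. G y x * b x \<partial>lborel) \<partial>lborel)"
    by (intro nn_integral_cong, subst nn_integral_cmult[symmetric]) (auto simp: sym mult_ac)
  also have "\<dots> \<le> (\<integral>\<^sup>+y. b y * E y * ennreal (Z / 2) \<partial>lborel)"
    by (intro nn_integral_mono mult_left_mono small) auto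
  also have "\<dots> = ennreal (Z / 2) * (\<integral>\<^sup>+y. b y * E y \<partial>lborel)"
    by (subst nn_integral_multc) (auto simp: mult.commute)
  finally have le: "ennreal Z * (\<integral>\<^sup>+x. b x * E x \<partial>lborel) \<le> ennreal (Z / 2) * (\<integral>\<^sup>+y. b y * E y \<partial>lborel)" .
  obtain r where r: "(\<integral>\<^sup>+x. b x * E x \<partial>lborel) = ennreal r" "r \<ge> 0"
    using fin unfolding E_def[symmetric] by (cases "\<integral>\<^sup>+x. b x * E x \<partial>lborel") auto
  have "Z * r \<le> Z / 2 * r" using le r Z by (simp add: ennreal_mult'[symmetric])
  then have "Z * r \<le> 0" by simp
  then have "r \<le> 0" using Z by (simp add: mult_le_0_iff)
  then have "(\<integral>\<^sup>+x. b x * E x \<partial>lborel) = 0" using r by simp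
  then have bE: "AE x in lborel. b x * E x = 0" by (subst (asm) nn_integral_0_iff_AE) auto
  have "(\<integral>\<^sup>+y. G x y * (b y * E y) \<partial>lborel) = 0" for x
    using bE by (subst nn_integral_0_iff_AE) (auto elim!: eventually_mono)
  with E1 have "AE x in lborel. E x = 0"
    using Z by (auto elim!: eventually_mono)
  then show ?thesis
  proof eventually_elim
    case (elim x) then show ?case using UE[of x] by simp
  qed
qed

text \<open>With a bounded right-hand side the derivative of the mollifications in the radius is bounded
uniformly in \<open>x\<close>, so that they converge uniformly as the radius tends to zero.\<close>
lemma continuous_representative:
  fixes u f :: "'a::euclidean_space \<Rightarrow> real"
  assumes u: "weak_solution u f" and S: "AE x in lborel. \<bar>f x\<bar> \<le> S" and S0: "0 \<le> S"
  obtains W where "continuous_on UNIV W" "AE x in lborel. W x = u x"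
proof -
  have f: "loc_int f" and u': "loc_int u" using u by (auto simp: weak_solution_def)
  have [measurable]: "f \<in> borel_measurable borel" using f by measurable
  let ?Z = "moll_mass TYPE('a)"
  have Z: "?Z > 0" by (rule moll_mass_pos)
  have D: "\<bar>- (\<integral>y. pot t x y * f y \<partial>lborel)\<bar> \<le> S * ?Z * t / 2" if t: "t > 0" for t x
  proof -
    have "\<bar>\<integral>y. pot t x y * f y \<partial>lborel\<bar> \<le> (\<integral>y. \<bar>pot t x y * f y\<bar> \<partial>lborel)" by simp
    also have "\<dots> \<le> (\<integral>y. S * t / 2 * moll t x y \<partial>lborel)"
    proof (rule integral_mono_AE)
      show "integrable lborel (\<lambda>y. \<bar>pot t x y * f y\<bar>)" using integrable_pot[OF f t] by simp
      show "integrable lborel (\<lambda>y. S * t / 2 * moll t x y)"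
        using integrable_moll[OF loc_int_const[of 1] t, of x] by simp
      show "AE y in lborel. \<bar>pot t x y * f y\<bar> \<le> S * t / 2 * moll t x y"
        using S
      proof eventually_elim
        case (elim y)
        have "\<bar>pot t x y * f y\<bar> \<le> (t / 2 * moll t x y) * S"
          unfolding abs_mult using pot_le_moll[OF t, of x y] pot_nonneg[OF t, of x y] elim t moll_nonneg[OF t, of x y] by (intro mult_mono) auto
        then show ?case by (simp add: mult_ac)
      qed
    qed
    also have "\<dots> = S * ?Z * t / 2" using integral_moll[OF t, of x] by simp
    finally show ?thesis by simp
  qed
  define t where "t n = 1 / real (Suc n)" for n
  have t: "t n > 0" "t n \<le> 1" for n by (auto simp: t_def)
  have t0: "t \<longlonglongrightarrow> 0" unfolding t_def by (rule inverse_Suc_tendsto_0)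
  have lip: "\<bar>mean r u x - mean s u x\<bar> \<le> S * ?Z / 2 * \<bar>r - s\<bar>" if "0 < r" "r \<le> 1" "0 < s" "s \<le> 1" for r s x
  proof -
    have "norm (mean r u x - mean s u x) \<le> S * ?Z / 2 * norm (r - s)"
    proof (rule field_differentiable_bound[of "{0<..1}" "\<lambda>t. mean t u x" "\<lambda>t. - (\<integral>y. pot t x y * f y \<partial>lborel)"])
      fix z :: real assume z: "z \<in> {0<..1}"
      then show "((\<lambda>t. mean t u x) has_field_derivative - (\<integral>y. pot z x y * f y \<partial>lborel)) (at z within {0<..1})"
        by (intro has_field_derivative_at_within[OF weak_solution_mean_derivative[OF u]]) auto
      have "S * ?Z * z / 2 \<le> S * ?Z / 2 * 1" using z S0 Z by (simp add: mult_left_le)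
      then show "norm (- (\<integral>y. pot z x y * f y \<partial>lborel)) \<le> S * ?Z / 2" using D[of z x] z by simp
    qed (use that in auto)
    then show ?thesis by simp
  qed
  have "uniformly_convergent_on UNIV (\<lambda>n. mean (t n) u)"
  proof (intro Cauchy_uniformly_convergent uniformly_Cauchy_onI)
    fix e :: real assume e: "e > 0"
    have "Cauchy t" using t0 by (intro LIMSEQ_imp_Cauchy)
    moreover have "e / (S * ?Z / 2 + 1) > 0" using e S0 Z by (intro divide_pos_pos add_nonneg_pos) auto
    ultimately obtain N where N: "\<And>m n. m \<ge> N \<Longrightarrow> n \<ge> N \<Longrightarrow> \<bar>t m - t n\<bar> < e / (S * ?Z / 2 + 1)"
      unfolding Cauchy_def dist_real_def by metis
    have "dist (mean (t m) u x) (mean (t n) u x) < e" if "m \<ge> N" "n \<ge> N" for m n x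
    proof -
      have "\<bar>mean (t m) u x - mean (t n) u x\<bar> \<le> S * ?Z / 2 * \<bar>t m - t n\<bar>" by (intro lip t)
      also have "\<dots> \<le> (S * ?Z / 2 + 1) * \<bar>t m - t n\<bar>" by (intro mult_right_mono) auto
      also have "\<dots> < (S * ?Z / 2 + 1) * (e / (S * ?Z / 2 + 1))"
        using N[OF that] S0 Z by (intro mult_strict_left_mono add_nonneg_pos) auto
      also have "\<dots> = e"
      proof -
        have "S * ?Z / 2 + 1 > 0" using S0 Z by (intro add_nonneg_pos) auto
        then show ?thesis by simp
      qed
      finally show ?thesis by (simp add: dist_real_def)
    qed
    then show "\<exists>N. \<forall>x\<in>UNIV. \<forall>m\<ge>N. \<forall>n\<ge>N. dist (mean (t m) u x) (mean (t n) u x) < e" by blast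
  qed
  then obtain L where L: "uniform_limit UNIV (\<lambda>n. mean (t n) u) L sequentially"
    by (auto simp: uniformly_convergent_on_def)
  have contL: "continuous_on UNIV L"
    by (rule uniform_limit_theorem[OF _ L]) (auto intro!: always_eventually continuous_mean u' t)
  have lim: "(\<lambda>n. mean (t n) u x) \<longlonglongrightarrow> L x" for x using tendsto_uniform_limitI[OF L] by auto
  show thesis
  proof (rule that[of "\<lambda>x. L x / ?Z"])
    show "continuous_on UNIV (\<lambda>x. L x / ?Z)" using Z by (intro continuous_intros contL) auto
    show "AE x in lborel. L x / ?Z = u x"
    proof (rule AE_if_AE_balls)
      fix n :: nat
      obtain s where s: "strict_mono s" "AE x in lborel. norm x \<le> real n \<longrightarrow> (\<lambda>n. mean (t (s n)) u x) \<longlonglongrightarrow> ?Z * u x"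
        by (rule mean_tendsto_AE_subseq[OF u' t t0])
      from s(2) show "AE x in lborel. norm x \<le> real n \<longrightarrow> L x / ?Z = u x"
      proof eventually_elim
        case (elim x)
        show ?case
        proof
          assume "norm x \<le> real n"
          then have "(\<lambda>n. mean (t (s n)) u x) \<longlonglongrightarrow> ?Z * u x" using elim by blast
          moreover have "(\<lambda>n. mean (t (s n)) u x) \<longlonglongrightarrow> L x"
            using LIMSEQ_subseq_LIMSEQ[OF lim s(1)] by (simp add: o_def)
          ultimately have "?Z * u x = L x" by (rule LIMSEQ_unique)
          then show "L x / ?Z = u x" using Z by (simp add: field_simps)
        qed
      qed
    qed
  qed
qed

section \<open>Boundedness and continuity of minimizers\<close>

text \<open>Below the level \<open>l\<close> the power is at most $l^{q-2}$, above it $1 \le l^{-2} r^2$.\<close>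
lemma powr_split_at:
  fixes r l :: real
  assumes "0 < l" "2 \<le> q"
  shows "\<bar>r\<bar> powr (q - 2) \<le> l powr (- 2) * \<bar>r\<bar> powr q + l powr (q - 2)"
proof (cases "\<bar>r\<bar> \<le> l")
  case True
  then have "\<bar>r\<bar> powr (q - 2) \<le> l powr (q - 2)" using assms by (intro powr_mono2) auto
  moreover have "0 \<le> l powr (- 2) * \<bar>r\<bar> powr q" by simp
  ultimately show ?thesis by linarith
next
  case False
  then have "1 \<le> l powr (- 2) * \<bar>r\<bar> powr 2"
    using assms powr_mono2[of 2 l "\<bar>r\<bar>"] by (simp add: powr_minus field_simps)
  then have "1 * \<bar>r\<bar> powr (q - 2) \<le> l powr (- 2) * \<bar>r\<bar> powr 2 * \<bar>r\<bar> powr (q - 2)" by (intro mult_right_mono) auto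
  also have "\<dots> = l powr (- 2) * \<bar>r\<bar> powr q" using powr_add[of "\<bar>r\<bar>" 2 "q - 2"] by (simp add: mult.assoc)
  finally have "\<bar>r\<bar> powr (q - 2) \<le> l powr (- 2) * \<bar>r\<bar> powr q" by simp
  moreover have "0 \<le> l powr (q - 2)" by simp
  ultimately show ?thesis by linarith
qed

text \<open>From $|u| \le 1 + u^2$; the resulting bound is uniform in the centre of the ball.\<close>
lemma mean_le_square_integral:
  fixes u :: "'a::euclidean_space \<Rightarrow> real"
  assumes [measurable]: "u \<in> borel_measurable borel" and i: "integrable lborel (\<lambda>x. (u x)\<^sup>2)" and R: "0 < R"
  shows "\<bar>mean R u x\<bar> \<le> moll_mass TYPE('a) + 2 / R ^ DIM('a) * (\<integral>x. (u x)\<^sup>2 \<partial>lborel)"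
proof -
  have u: "loc_int u" by (rule square_integrable_imp_loc_int) fact+
  have i1: "integrable lborel (\<lambda>y. moll R x y)" using integrable_moll[OF loc_int_const[of 1] R, of x] by simp
  have "\<bar>mean R u x\<bar> \<le> (\<integral>y. \<bar>moll R x y * u y\<bar> \<partial>lborel)" unfolding mean_def by simp
  also have "\<dots> \<le> (\<integral>y. moll R x y + 2 / R ^ DIM('a) * (u y)\<^sup>2 \<partial>lborel)"
  proof (rule integral_mono)
    show "integrable lborel (\<lambda>y. \<bar>moll R x y * u y\<bar>)" using integrable_moll[OF u R] by simp
    show "integrable lborel (\<lambda>y. moll R x y + 2 / R ^ DIM('a) * (u y)\<^sup>2)" using i1 i by auto
    fix y
    have "0 \<le> (\<bar>u y\<bar> - 1)\<^sup>2" "0 \<le> (u y)\<^sup>2" by simp_all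
    then have "\<bar>u y\<bar> \<le> 1 + (u y)\<^sup>2" by (simp only: power2_diff power2_abs) simp
    then have "moll R x y * \<bar>u y\<bar> \<le> moll R x y * (1 + (u y)\<^sup>2)" using moll_nonneg[OF R] by (intro mult_left_mono) auto
    also have "\<dots> \<le> moll R x y + 2 / R ^ DIM('a) * (u y)\<^sup>2"
      using mult_right_mono[OF moll_le[OF R, of x y], of "(u y)\<^sup>2"] by (simp add: distrib_left)
    finally show "\<bar>moll R x y * u y\<bar> \<le> moll R x y + 2 / R ^ DIM('a) * (u y)\<^sup>2"
      using moll_nonneg[OF R, of x y] by (simp add: abs_mult)
  qed
  also have "\<dots> = moll_mass TYPE('a) + 2 / R ^ DIM('a) * (\<integral>x. (u x)\<^sup>2 \<partial>lborel)"
    using i1 i integral_moll[OF R, of x] by simp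
  finally show ?thesis .
qed

context minimization
begin

lemma minimizer_wgrad: "minimizer u g \<Longrightarrow> wgrad u g"
  by (simp add: minimizer_def)

lemma minimizer_powr_integrable:
  assumes "minimizer u g" shows "powr_integrable u"
  by (rule modular_1_powr_integrable(1)[OF wgrad_measurable(1)[OF minimizer_wgrad[OF assms]]])
     (use assms in \<open>simp add: minimizer_def\<close>)

lemma minimizer_weak_solution:
  assumes m: "minimizer u g"
  shows "weak_solution u (source (multiplier u) u)"
  unfolding weak_solution_def
  by (intro conjI allI impI wgrad_loc_int(1)[OF minimizer_wgrad[OF m]] Euler_Lagrange[OF m]
    source_loc_int(1)[OF minimizer_wgrad[OF m] minimizer_powr_integrable[OF m]])

text \<open>The factor $|u|^{p(y)-2}$ is split at the level $|u| = t^{-\alpha}$. Below it the factor is at most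
$t^{-\alpha(pmax-2)}$ and the potential contributes the volume of the ball of radius \<open>t\<close>; above it
the factor is at most $t^{2\alpha} |u|^{p(y)}$, which is integrable, and the potential contributes its
maximum, of order $t^{1-N}$. The exponent \<open>s\<close> is a lower bound of the two resulting exponents of \<open>t\<close>.\<close>
lemma potential_integral_bound:
  fixes \<alpha> s m t :: real
  assumes u: "powr_integrable u" and \<alpha>: "0 \<le> \<alpha>" and t: "0 < t" "t \<le> 1" and m: "0 \<le> m"
  defines "\<omega> \<equiv> measure lborel (ball (0::'a) 1)" and "K \<equiv> \<integral>x. \<bar>u x\<bar> powr p x \<partial>lborel"
  assumes s: "s \<le> 1 - \<alpha> * (pmax - 2)" "s \<le> 1 - real DIM('a) + 2 * \<alpha>"
  shows "(\<integral>\<^sup>+y. ennreal (pot t x y) * ennreal (Vmax + m * \<bar>u y\<bar> powr (p y - 2)) \<partial>lborel)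
     \<le> ennreal ((\<omega> * Vmax + \<omega> * m + m * K) / 2 * t powr s)"
proof -
  note [measurable] = powr_integrable_measurable[OF u]
  let ?n = "DIM('a)"
  define c where "c = t / (2 * t ^ ?n)"
  define A where "A = Vmax + m * t powr (- \<alpha> * (pmax - 2))"
  have \<omega>0: "\<omega> \<ge> 0" by (simp add: \<omega>_def)
  have K0: "K \<ge> 0" unfolding K_def by simp
  have c0: "c \<ge> 0" using t by (simp add: c_def)
  have A0: "A \<ge> 0" using Vmax_nonneg m by (simp add: A_def)
  have tn: "t ^ ?n = t powr ?n" using t by (simp add: powr_realpow)
  have pw: "Vmax + m * \<bar>u y\<bar> powr (p y - 2) \<le> A + m * t powr (2 * \<alpha>) * \<bar>u y\<bar> powr p y" for y
  proof -
    have "\<bar>u y\<bar> powr (p y - 2) \<le> (t powr (-\<alpha>)) powr (-2) * \<bar>u y\<bar> powr p y + (t powr (-\<alpha>)) powr (p y - 2)"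
      using t p_gt_2[of y] by (intro powr_split_at) auto
    also have "(t powr (-\<alpha>)) powr (p y - 2) \<le> (t powr (-\<alpha>)) powr (pmax - 2)"
    proof (rule powr_mono)
      have "t powr \<alpha> \<le> 1" using t \<alpha> by (intro powr_le1) auto
      then show "1 \<le> t powr (-\<alpha>)" using t by (simp add: powr_minus one_le_inverse_iff)
    qed (use p_le in auto)
    finally have "\<bar>u y\<bar> powr (p y - 2) \<le> t powr (2 * \<alpha>) * \<bar>u y\<bar> powr p y + t powr (- \<alpha> * (pmax - 2))"
      by (simp add: powr_powr mult.commute)
    from mult_left_mono[OF this m] show ?thesis by (simp add: A_def algebra_simps)
  qed
  have "(\<integral>\<^sup>+y. ennreal (pot t x y) * ennreal (Vmax + m * \<bar>u y\<bar> powr (p y - 2)) \<partial>lborel) \<le>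
    (\<integral>\<^sup>+y. ennreal (c * A) * indicator (ball x t) y + ennreal (c * (m * t powr (2 * \<alpha>))) * ennreal (\<bar>u y\<bar> powr p y) \<partial>lborel)"
  proof (rule nn_integral_mono)
    fix y
    show "ennreal (pot t x y) * ennreal (Vmax + m * \<bar>u y\<bar> powr (p y - 2)) \<le>
      ennreal (c * A) * indicator (ball x t) y + ennreal (c * (m * t powr (2 * \<alpha>))) * ennreal (\<bar>u y\<bar> powr p y)"
    proof (cases "norm (y - x) < t")
      case True
      have "pot t x y * (Vmax + m * \<bar>u y\<bar> powr (p y - 2)) \<le> c * (A + m * t powr (2 * \<alpha>) * \<bar>u y\<bar> powr p y)"
        using pot_le[OF t(1), of x y] pot_nonneg[OF t(1), of x y] c0 m Vmax_nonneg pw[of y] unfolding c_def[symmetric]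
        by (intro mult_mono) auto
      also have "\<dots> = c * A + c * (m * t powr (2 * \<alpha>)) * \<bar>u y\<bar> powr p y" by (simp add: algebra_simps)
      finally have "ennreal (pot t x y * (Vmax + m * \<bar>u y\<bar> powr (p y - 2))) \<le> ennreal (c * A + c * (m * t powr (2 * \<alpha>)) * \<bar>u y\<bar> powr p y)"
        by (rule ennreal_leI)
      moreover have "y \<in> ball x t" using True by (simp add: dist_norm norm_minus_commute)
      ultimately show ?thesis using c0 A0 m pot_nonneg[OF t(1), of x y] Vmax_nonneg
        by (simp add: ennreal_mult'[symmetric] ennreal_plus[symmetric] del: ennreal_plus)
    qed (simp add: pot_eq_0 t not_less)
  qed
  also have "\<dots> = ennreal (c * A) * emeasure lborel (ball x t) + ennreal (c * (m * t powr (2 * \<alpha>))) * ennreal K"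
  proof -
    have "(\<integral>\<^sup>+y. ennreal (\<bar>u y\<bar> powr p y) \<partial>lborel) = ennreal K"
      unfolding K_def using u by (intro nn_integral_eq_integral) (auto simp: powr_integrable_def)
    moreover have [measurable]: "ball x t \<in> sets borel" by simp
    ultimately show ?thesis
      by (subst nn_integral_add, measurable) (simp add: nn_integral_cmult nn_integral_cmult_indicator)
  qed
  also have "emeasure lborel (ball x t) = ennreal (\<omega> * t ^ ?n)"
    unfolding \<omega>_def using t by (simp add: emeasure_ball measure_def)
  also have "ennreal (c * A) * ennreal (\<omega> * t ^ ?n) + ennreal (c * (m * t powr (2 * \<alpha>))) * ennreal K =
      ennreal (c * A * (\<omega> * t ^ ?n) + c * (m * t powr (2 * \<alpha>)) * K)"
    using c0 A0 \<omega>0 K0 m t by (simp add: ennreal_mult'[symmetric] ennreal_plus[symmetric] del: ennreal_plus)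
  also have "c * A * (\<omega> * t ^ ?n) + c * (m * t powr (2 * \<alpha>)) * K =
     (\<omega> * Vmax * t powr 1 + \<omega> * m * t powr (1 - \<alpha> * (pmax - 2)) + m * K * t powr (1 - real ?n + 2 * \<alpha>)) / 2"
  proof -
    have "t powr (1 - \<alpha> * (pmax - 2)) = t * t powr (- \<alpha> * (pmax - 2))" using t by (simp add: powr_add[symmetric] powr_mult_base)
    moreover have "t powr (1 - real ?n + 2 * \<alpha>) = t / t ^ ?n * t powr (2 * \<alpha>)"
      unfolding tn using t by (simp add: powr_add powr_diff)
    ultimately show ?thesis using t by (simp add: c_def A_def field_simps)
  qed
  also have "ennreal \<dots> \<le> ennreal ((\<omega> * Vmax + \<omega> * m + m * K) / 2 * t powr s)"
  proof (rule ennreal_leI)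
    have "0 \<le> \<alpha> * (pmax - 2)" using \<alpha> pmax_gt by simp
    then have s1: "s \<le> 1" using s by linarith
    have "\<omega> * Vmax * t powr 1 \<le> \<omega> * Vmax * t powr s" "\<omega> * m * t powr (1 - \<alpha> * (pmax - 2)) \<le> \<omega> * m * t powr s"
      "m * K * t powr (1 - real ?n + 2 * \<alpha>) \<le> m * K * t powr s"
      using s s1 t \<omega>0 K0 m Vmax_nonneg by (intro mult_left_mono powr_mono' mult_nonneg_nonneg; simp)+
    then show "(\<omega> * Vmax * t powr 1 + \<omega> * m * t powr (1 - \<alpha> * (pmax - 2)) + m * K * t powr (1 - real ?n + 2 * \<alpha>)) / 2
      \<le> (\<omega> * Vmax + \<omega> * m + m * K) / 2 * t powr s"
      by (simp add: algebra_simps)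
  qed
  finally show ?thesis .
qed

text \<open>This is where subcriticality enters. The bound of \<open>potential_integral_bound\<close> is integrable in \<open>t\<close>
near $0$ iff $s > -1$, that is iff $(N-2)/2 < \alpha < 2/(pmax-2)$, and such an \<open>\<alpha>\<close> exists exactly if
$pmax < 2N/(N-2)$.\<close>
lemma small_kernel_scale:
  assumes N: "3 \<le> DIM('a)" and crit: "pmax < 2 * DIM('a) / (DIM('a) - 2)" and u: "powr_integrable u" and m: "0 \<le> m" and e: "0 < e"
  obtains \<rho> where "0 < \<rho>"
    "\<And>x. (\<integral>\<^sup>+y. pot_kernel \<rho> x y * ennreal (Vmax + m * \<bar>u y\<bar> powr (p y - 2)) \<partial>lborel) \<le> ennreal e"
proof -
  note [measurable] = powr_integrable_measurable[OF u]
  let ?n = "real DIM('a)"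
  define C where "C = (measure lborel (ball (0::'a) 1) * Vmax + measure lborel (ball (0::'a) 1) * m + m * (\<integral>x. \<bar>u x\<bar> powr p x \<partial>lborel)) / 2"
  have C0: "C \<ge> 0" unfolding C_def using Vmax_nonneg m by (intro divide_nonneg_nonneg add_nonneg_nonneg mult_nonneg_nonneg) auto
  have n: "?n \<ge> 3" using N by simp
  have "(?n - 2) / 2 < 2 / (pmax - 2)"
  proof -
    have "pmax * (?n - 2) < 2 * ?n" using crit n by (simp add: less_divide_eq)
    then have "(?n - 2) * (pmax - 2) < 4" by (simp add: algebra_simps)
    then show ?thesis using pmax_gt by (simp add: field_simps)
  qed
  \<comment> \<open>the interval for \<open>\<alpha>\<close> is nonempty by subcriticality\<close>
  then obtain \<alpha> where \<alpha>: "(?n - 2) / 2 < \<alpha>" "\<alpha> < 2 / (pmax - 2)" using dense by blast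
  have "0 \<le> (?n - 2) / 2" using n by simp
  then have \<alpha>0: "0 \<le> \<alpha>" using \<alpha>(1) by (meson less_imp_le order_trans)
  define s where "s = min (1 - \<alpha> * (pmax - 2)) (1 - ?n + 2 * \<alpha>)"
  have s: "s > -1" using \<alpha> pmax_gt n by (auto simp: s_def less_divide_eq)
  \<comment> \<open>such that $\int_0^\rho C t^s\, dt = C \rho^{s+1}/(s+1) \le e$\<close>
  define \<rho> where "\<rho> = min 1 ((e * (s + 1) / (C + 1)) powr (1 / (s + 1)))"
  have \<rho>: "0 < \<rho>" "\<rho> \<le> 1" using e s C0 by (auto simp: \<rho>_def)
  have Rs: "C * (\<rho> powr (s + 1) / (s + 1)) \<le> e"
  proof -
    have "\<rho> powr (s + 1) \<le> ((e * (s + 1) / (C + 1)) powr (1 / (s + 1))) powr (s + 1)"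
      using \<rho> s by (intro powr_mono2) (auto simp: \<rho>_def)
    also have "\<dots> = e * (s + 1) / (C + 1)" using s e C0 by (simp add: powr_powr)
    finally have "\<rho> powr (s + 1) / (s + 1) \<le> e / (C + 1)" using s by (simp add: divide_le_eq)
    then have "C * (\<rho> powr (s + 1) / (s + 1)) \<le> C * (e / (C + 1))" using C0 by (intro mult_left_mono)
    also have "\<dots> \<le> e" using C0 e by (simp add: field_simps)
    finally show ?thesis .
  qed
  show thesis
  proof (rule that[OF \<rho>(1)])
    fix x
    have "(\<integral>\<^sup>+y. pot_kernel \<rho> x y * ennreal (Vmax + m * \<bar>u y\<bar> powr (p y - 2)) \<partial>lborel) =
      (\<integral>\<^sup>+t. indicator {0<..\<rho>} t * (\<integral>\<^sup>+y. ennreal (pot t x y) * ennreal (Vmax + m * \<bar>u y\<bar> powr (p y - 2)) \<partial>lborel) \<partial>lborel)"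
      by (rule pot_kernel_integral) measurable
    also have "\<dots> \<le> (\<integral>\<^sup>+t. ennreal (C * t powr s) * indicator {0..\<rho>} t \<partial>lborel)"
    proof (rule nn_integral_mono)
      fix t
      show "indicator {0<..\<rho>} t * (\<integral>\<^sup>+y. ennreal (pot t x y) * ennreal (Vmax + m * \<bar>u y\<bar> powr (p y - 2)) \<partial>lborel) \<le> ennreal (C * t powr s) * indicator {0..\<rho>} t"
        using potential_integral_bound[OF u \<alpha>0 _ _ m, of t s x] \<rho> by (auto simp: indicator_def s_def C_def)
    qed
    also have "\<dots> = ennreal (C * (\<rho> powr (s + 1) / (s + 1)))"
    proof (rule nn_integral_has_integral_lebesgue')
      show "((\<lambda>t. C * t powr s) has_integral C * (\<rho> powr (s + 1) / (s + 1))) {0..\<rho>}"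
        using has_integral_powr_from_0[OF s, of \<rho>] \<rho> by (intro has_integral_mult_right) auto
    qed (use C0 in auto)
    also have "\<dots> \<le> ennreal e" by (intro ennreal_leI Rs)
    finally show "(\<integral>\<^sup>+y. pot_kernel \<rho> x y * ennreal (Vmax + m * \<bar>u y\<bar> powr (p y - 2)) \<partial>lborel) \<le> ennreal e" .
  qed
qed

text \<open>The right-hand side of the Euler-Lagrange equation is at most $b |u|$ with
$b = Vmax + |\mu| |u|^{p-2}$, and \<open>small_kernel_scale\<close> makes the potential of \<open>b\<close> small on a small
scale, so that \<open>kernel_absorption\<close> applies.\<close>
theorem minimizer_bounded:
  assumes N: "3 \<le> DIM('a)" and crit: "pmax < 2 * DIM('a) / (DIM('a) - 2)" and min: "minimizer u g"
  obtains B where "0 \<le> B" "AE x in lborel. \<bar>u x\<bar> \<le> B"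
proof -
  let ?\<mu> = "multiplier u" and ?Z = "moll_mass TYPE('a)"
  note pu = minimizer_powr_integrable[OF min]
  note ws = minimizer_weak_solution[OF min]
  note [measurable] = powr_integrable_measurable[OF pu]
  have Z: "?Z > 0" by (rule moll_mass_pos)
  have u2: "integrable lborel (\<lambda>x. (u x)\<^sup>2)" using min by (simp add: minimizer_def wgrad_def)
  define b where "b y = Vmax + \<bar>?\<mu>\<bar> * \<bar>u y\<bar> powr (p y - 2)" for y
  have b0: "b y \<ge> 0" for y using Vmax_nonneg by (simp add: b_def)
  have [measurable]: "b \<in> borel_measurable borel" unfolding b_def by measurable
  obtain \<rho> where \<rho>: "0 < \<rho>" "\<And>x. (\<integral>\<^sup>+y. pot_kernel \<rho> x y * ennreal (b y) \<partial>lborel) \<le> ennreal (?Z / 2)"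
    using small_kernel_scale[OF N crit pu, of "\<bar>?\<mu>\<bar>" "?Z / 2"] Z unfolding b_def by auto
  define h where "h = ?Z + 2 / \<rho> ^ DIM('a) * (\<integral>x. (u x)\<^sup>2 \<partial>lborel)"
  have h: "h > 0" unfolding h_def using Z \<rho> by (intro add_pos_nonneg) auto
  \<comment> \<open>so that the inhomogeneous term \<open>h\<close> is half of $Z c$, as required by \<open>kernel_absorption\<close>\<close>
  define c where "c = 2 * h / ?Z"
  have c: "c > 0" unfolding c_def using h Z by simp
  have hc: "?Z / 2 * c = h" unfolding c_def using Z by simp
  have bu: "\<bar>source ?\<mu> u y\<bar> \<le> b y * \<bar>u y\<bar>" for y
  proof -
    have "\<bar>source ?\<mu> u y\<bar> \<le> \<bar>?\<mu> * nl (p y) (u y)\<bar> + \<bar>V0 y * u y\<bar>" unfolding source_def by (rule abs_triangle_ineq4)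
    also have "\<dots> \<le> \<bar>?\<mu>\<bar> * \<bar>u y\<bar> powr (p y - 2) * \<bar>u y\<bar> + Vmax * \<bar>u y\<bar>"
      using V0_bound[of y] by (simp add: nl_def abs_mult mult_right_mono)
    finally show ?thesis by (simp add: b_def algebra_simps)
  qed
  have "AE x in lborel. ennreal \<bar>u x\<bar> \<le> ennreal c"
  proof (rule kernel_absorption[where G="pot_kernel \<rho>" and b="\<lambda>y. ennreal (b y)" and Z="?Z"])
    show "AE x in lborel. ennreal ?Z * ennreal \<bar>u x\<bar> \<le> ennreal (?Z / 2 * c) + (\<integral>\<^sup>+y. pot_kernel \<rho> x y * (ennreal (b y) * ennreal \<bar>u y\<bar>) \<partial>lborel)"
      using weak_solution_pointwise_bound[OF ws \<rho>(1)]
    proof eventually_elim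
      case (elim x)
      have "ennreal ?Z * ennreal \<bar>u x\<bar> = ennreal (?Z * \<bar>u x\<bar>)" using Z by (simp add: ennreal_mult')
      also note elim
      also have "ennreal \<bar>mean \<rho> u x\<bar> + (\<integral>\<^sup>+y. pot_kernel \<rho> x y * ennreal \<bar>source ?\<mu> u y\<bar> \<partial>lborel) \<le>
        ennreal (?Z / 2 * c) + (\<integral>\<^sup>+y. pot_kernel \<rho> x y * (ennreal (b y) * ennreal \<bar>u y\<bar>) \<partial>lborel)"
      proof (intro add_mono nn_integral_mono mult_left_mono)
        show "ennreal \<bar>mean \<rho> u x\<bar> \<le> ennreal (?Z / 2 * c)"
          unfolding hc h_def by (intro ennreal_leI mean_le_square_integral u2 \<rho>) measurable
        show "ennreal \<bar>source ?\<mu> u y\<bar> \<le> ennreal (b y) * ennreal \<bar>u y\<bar>" for y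
          using ennreal_leI[OF bu[of y]] b0 by (simp add: ennreal_mult')
      qed auto
      finally show ?case .
    qed
    have "(\<integral>\<^sup>+x. ennreal (b x) * (ennreal \<bar>u x\<bar> - ennreal c) \<partial>lborel) \<le> (\<integral>\<^sup>+x. ennreal ((Vmax * (u x)\<^sup>2 + \<bar>?\<mu>\<bar> * \<bar>u x\<bar> powr p x) / c) \<partial>lborel)"
    proof (rule nn_integral_mono)
      fix x
      show "ennreal (b x) * (ennreal \<bar>u x\<bar> - ennreal c) \<le> ennreal ((Vmax * (u x)\<^sup>2 + \<bar>?\<mu>\<bar> * \<bar>u x\<bar> powr p x) / c)"
      proof (cases "\<bar>u x\<bar> \<le> c")
        case True
        then show ?thesis using c by (simp add: ennreal_minus ennreal_neg)
      next
        case False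
        have "ennreal (b x) * (ennreal \<bar>u x\<bar> - ennreal c) = ennreal (b x * (\<bar>u x\<bar> - c))"
          using c b0[of x] False by (simp add: ennreal_minus ennreal_mult')
        \<comment> \<open>where $|u| > c$, the first power is dominated by the square, which makes the excess integrable\<close>
        also have "b x * (\<bar>u x\<bar> - c) \<le> b x * (\<bar>u x\<bar> * (\<bar>u x\<bar> / c))"
        proof (rule mult_left_mono[OF _ b0])
          have "\<bar>u x\<bar> * 1 \<le> \<bar>u x\<bar> * (\<bar>u x\<bar> / c)" using False c by (intro mult_left_mono) auto
          then show "\<bar>u x\<bar> - c \<le> \<bar>u x\<bar> * (\<bar>u x\<bar> / c)" using c by linarith
        qed
        also have "\<dots> = (Vmax * (u x)\<^sup>2 + \<bar>?\<mu>\<bar> * \<bar>u x\<bar> powr p x) / c"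
        proof -
          have "\<bar>u x\<bar> powr (p x - 2) * (\<bar>u x\<bar> * \<bar>u x\<bar>) = \<bar>u x\<bar> powr p x"
            using nl_mult_self[of "p x" "u x"] by (simp add: nl_def mult.assoc)
          then show ?thesis by (simp add: b_def power2_eq_square algebra_simps add_divide_distrib)
        qed
        finally show ?thesis by (simp add: ennreal_leI)
      qed
    qed
    also have "\<dots> < \<infinity>"
    proof -
      have "integrable lborel (\<lambda>x. (Vmax * (u x)\<^sup>2 + \<bar>?\<mu>\<bar> * \<bar>u x\<bar> powr p x) / c)"
        using u2 pu by (auto simp: powr_integrable_def)
      then show ?thesis using c Vmax_nonneg by (subst nn_integral_eq_integral) auto
    qed
    finally show "(\<integral>\<^sup>+x. ennreal (b x) * (ennreal \<bar>u x\<bar> - ennreal c) \<partial>lborel) < \<infinity>" .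
  qed (use Z c \<rho>(2) pot_kernel_commute in auto)
  then have "AE x in lborel. \<bar>u x\<bar> \<le> c" using c by (auto elim!: eventually_mono simp: ennreal_le_iff)
  then show thesis using that[of c] c by simp
qed

theorem minimizer_continuous_representative:
  assumes N: "3 \<le> DIM('a)" and crit: "pmax < 2 * DIM('a) / (DIM('a) - 2)" and min: "minimizer u g"
  obtains W where "continuous_on UNIV W" "AE x in lborel. W x = u x"
proof -
  obtain B where B: "0 \<le> B" "AE x in lborel. \<bar>u x\<bar> \<le> B" using minimizer_bounded[OF N crit min] by blast
  let ?\<mu> = "multiplier u"
  have "AE x in lborel. \<bar>source ?\<mu> u x\<bar> \<le> \<bar>?\<mu>\<bar> * max 1 B powr pmax + Vmax * B"
    using B(2)
  proof eventually_elim
    case (elim x)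
    have "\<bar>u x\<bar> powr (p x - 1) \<le> max 1 B powr (p x - 1)" using elim p_gt_2[of x] by (intro powr_mono2) auto
    also have "\<dots> \<le> max 1 B powr pmax" using p_le[of x] by (intro powr_mono) auto
    finally have "\<bar>nl (p x) (u x)\<bar> \<le> max 1 B powr pmax" by (simp add: abs_nl)
    then have "\<bar>?\<mu> * nl (p x) (u x)\<bar> \<le> \<bar>?\<mu>\<bar> * max 1 B powr pmax" by (simp add: abs_mult mult_left_mono)
    moreover have "\<bar>V0 x * u x\<bar> \<le> Vmax * B" unfolding abs_mult using V0_bound elim B(1) Vmax_nonneg by (intro mult_mono) auto
    ultimately show ?case unfolding source_def by linarith
  qed
  from continuous_representative[OF minimizer_weak_solution[OF min] this] show thesis
    using that B(1) Vmax_nonneg by auto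
qed

end

section \<open>Limits of integrals and weak derivatives in arbitrary directions\<close>

lemma tendsto_integral_compact_support_AE:
  fixes \<phi> :: "nat \<Rightarrow> 'a::euclidean_space \<Rightarrow> real"
  assumes f: "loc_int f"
    and m[measurable]: "\<And>n. \<phi> n \<in> borel_measurable borel" "\<psi> \<in> borel_measurable borel"
    and bd: "\<And>n y. \<bar>\<phi> n y\<bar> \<le> B"
    and s: "\<And>n y. r < norm y \<Longrightarrow> \<phi> n y = 0" "\<And>y. r < norm y \<Longrightarrow> \<psi> y = 0"
    and lim: "AE y in lborel. norm y \<le> r \<longrightarrow> (\<lambda>n. \<phi> n y) \<longlonglongrightarrow> \<psi> y"
  shows "(\<lambda>n. \<integral>y. \<phi> n y * f y \<partial>lborel) \<longlonglongrightarrow> (\<integral>y. \<psi> y * f y \<partial>lborel)"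
proof (rule integral_dominated_convergence[where w="\<lambda>y. B * \<bar>indicator (cball 0 r) y * f y\<bar>"])
  have [measurable]: "f \<in> borel_measurable borel" using f by measurable
  have B: "B \<ge> 0" using bd[of 0 0] by (rule order_trans[OF abs_ge_zero])
  show "(\<lambda>y. \<psi> y * f y) \<in> borel_measurable lborel" "(\<lambda>y. \<phi> n y * f y) \<in> borel_measurable lborel" for n
    by measurable
  show "integrable lborel (\<lambda>y. B * \<bar>indicator (cball 0 r) y * f y\<bar>)"
    using f by (intro integrable_mult_right integrable_abs) (auto simp: loc_int_def)
  show "AE y in lborel. (\<lambda>n. \<phi> n y * f y) \<longlonglongrightarrow> \<psi> y * f y"
    using lim
  proof eventually_elim
    case (elim y)
    have "(\<lambda>n. \<phi> n y) \<longlonglongrightarrow> \<psi> y"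
      using elim s by (cases "norm y \<le> r") auto
    then show ?case by (intro tendsto_mult tendsto_const)
  qed
  show "AE y in lborel. norm (\<phi> n y * f y) \<le> B * \<bar>indicator (cball 0 r) y * f y\<bar>" for n
  proof (rule AE_I2)
    fix y show "norm (\<phi> n y * f y) \<le> B * \<bar>indicator (cball 0 r) y * f y\<bar>"
      using s(1)[of y n] bd[of n y] by (cases "norm y \<le> r") (auto simp: abs_mult intro!: mult_right_mono)
  qed
qed

lemma wgrad_test_direction:
  assumes w: "wgrad u g" and t: "test_function \<phi>"
  shows "(\<integral>x. u x * frechet_derivative \<phi> (at x) b \<partial>lborel) = - (\<integral>x. (g x \<bullet> b) * \<phi> x \<partial>lborel)"
proof -
  have e1: "u x * frechet_derivative \<phi> (at x) b = (\<Sum>i\<in>Basis. (b \<bullet> i) * (u x * frechet_derivative \<phi> (at x) i))" for x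
  proof -
    have l: "linear (frechet_derivative \<phi> (at x))" using has_derivative_linear[OF test_has_derivative[OF t]] .
    have "frechet_derivative \<phi> (at x) b = frechet_derivative \<phi> (at x) (\<Sum>i\<in>Basis. (b \<bullet> i) *\<^sub>R i)" by (simp add: euclidean_representation)
    also have "\<dots> = (\<Sum>i\<in>Basis. (b \<bullet> i) * frechet_derivative \<phi> (at x) i)" by (simp add: linear_sum[OF l] linear_scale[OF l])
    finally show ?thesis by (simp add: sum_distrib_left mult_ac)
  qed
  have e2: "(g x \<bullet> b) * \<phi> x = (\<Sum>i\<in>Basis. (b \<bullet> i) * ((g x \<bullet> i) * \<phi> x))" for x
    by (subst euclidean_inner) (simp add: sum_distrib_left sum_distrib_right mult_ac)
  have "(\<integral>x. u x * frechet_derivative \<phi> (at x) b \<partial>lborel) = (\<Sum>i\<in>Basis. (b \<bullet> i) * (\<integral>x. u x * frechet_derivative \<phi> (at x) i \<partial>lborel))"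
    unfolding e1 using wgrad_integrable[OF w t] by (subst Bochner_Integration.integral_sum) auto
  also have "\<dots> = (\<Sum>i\<in>Basis. - ((b \<bullet> i) * (\<integral>x. (g x \<bullet> i) * \<phi> x \<partial>lborel)))"
    using wgrad_test[OF w t] by (intro sum.cong) auto
  also have "\<dots> = - (\<integral>x. (g x \<bullet> b) * \<phi> x \<partial>lborel)"
    unfolding e2 using wgrad_integrable[OF w t] by (subst Bochner_Integration.integral_sum) (auto simp: sum_negf)
  finally show ?thesis .
qed

lemma wgrad_loc_int_direction:
  assumes w: "wgrad u g" shows "loc_int (\<lambda>x. g x \<bullet> b)"
proof (rule loc_int_bound)
  note [measurable] = wgrad_measurable[OF w]
  show "(\<lambda>x. g x \<bullet> b) \<in> borel_measurable borel" by measurable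
  show "loc_int (\<lambda>x. norm b * (1 + (norm (g x))\<^sup>2))"
    using w by (intro loc_int_cmult loc_int_add loc_int_const integrable_imp_loc_int) (simp add: wgrad_def)
  show "AE x in lborel. \<bar>g x \<bullet> b\<bar> \<le> norm b * (1 + (norm (g x))\<^sup>2)"
  proof (rule AE_I2)
    fix x
    have "0 \<le> (norm (g x) - 1)\<^sup>2" "0 \<le> (norm (g x))\<^sup>2" by simp_all
    then have "2 * norm (g x) \<le> 1 + (norm (g x))\<^sup>2" by (simp only: power2_diff) simp
    then have "norm (g x) \<le> 1 + (norm (g x))\<^sup>2" using norm_ge_zero[of "g x"] by linarith
    then have "norm (g x) * norm b \<le> (1 + (norm (g x))\<^sup>2) * norm b" by (intro mult_right_mono) auto
    then show "\<bar>g x \<bullet> b\<bar> \<le> norm b * (1 + (norm (g x))\<^sup>2)"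
      using Cauchy_Schwarz_ineq2[of "g x" b] by (simp add: mult.commute)
  qed
qed

lemma mean_wgrad_direction:
  assumes w: "wgrad u g" and t: "t > 0"
  shows "((\<lambda>s. mean t u (x + s *\<^sub>R b)) has_real_derivative mean t (\<lambda>y. g y \<bullet> b) (x + s *\<^sub>R b)) (at s)"
proof -
  have "(\<integral>y. - frechet_derivative (moll t (x + s *\<^sub>R b)) (at y) b * u y \<partial>lborel) = mean t (\<lambda>y. g y \<bullet> b) (x + s *\<^sub>R b)"
    using wgrad_test_direction[OF w test_function_moll[OF t], of "x + s *\<^sub>R b" b] by (simp add: mean_def mult.commute)
  with mean_has_derivative_direction[OF wgrad_loc_int(1)[OF w] t, of x b s] show ?thesis by simp
qed

text \<open>In contrast to dominated convergence the majorant varies with \<open>n\<close>, and its integral tends to zero.\<close>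
lemma tendsto_integral_0_if_dominated:
  fixes f :: "nat \<Rightarrow> 'a::euclidean_space \<Rightarrow> real"
  assumes bd: "\<And>n x. \<bar>f n x\<bar> \<le> B * h n x" and B: "0 \<le> B"
    and h: "\<And>n. integrable lborel (h n)" "(\<lambda>n. \<integral>x. h n x \<partial>lborel) \<longlonglongrightarrow> 0"
    and [measurable]: "\<And>n. f n \<in> borel_measurable borel"
  shows "(\<lambda>n. \<integral>x. f n x \<partial>lborel) \<longlonglongrightarrow> 0"
proof (rule Lim_null_comparison)
  show "\<forall>\<^sub>F n in sequentially. norm (\<integral>x. f n x \<partial>lborel) \<le> B * (\<integral>x. h n x \<partial>lborel)"
  proof (intro always_eventually allI)
    fix n
    have i: "integrable lborel (\<lambda>x. B * h n x)" using h(1) by simp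
    have fi: "integrable lborel (f n)"
      by (rule Bochner_Integration.integrable_bound[OF i]) (auto intro!: AE_I2 order_trans[OF bd])
    have "norm (\<integral>x. f n x \<partial>lborel) \<le> (\<integral>x. \<bar>f n x\<bar> \<partial>lborel)" by simp
    also have "\<dots> \<le> (\<integral>x. B * h n x \<partial>lborel)" using fi by (intro integral_mono i bd) auto
    finally show "norm (\<integral>x. f n x \<partial>lborel) \<le> B * (\<integral>x. h n x \<partial>lborel)" by simp
  qed
  show "(\<lambda>n. B * (\<integral>x. h n x \<partial>lborel)) \<longlonglongrightarrow> 0" using tendsto_mult_right_zero[OF h(2)] .
qed

section \<open>Reflections and polarization\<close>

text \<open>A smooth approximation of the absolute value that vanishes at $0$, so that it vanishes on the
hyperplane when applied to the antisymmetric part of a function.\<close>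
definition smooth_abs :: "real \<Rightarrow> real \<Rightarrow> real" where "smooth_abs \<eta> a = sqrt (a\<^sup>2 + \<eta>\<^sup>2) - \<eta>"
definition smooth_sgn :: "real \<Rightarrow> real \<Rightarrow> real" where "smooth_sgn \<eta> a = a / sqrt (a\<^sup>2 + \<eta>\<^sup>2)"

context
  fixes \<eta> :: real
  assumes \<eta>: "\<eta> > 0"
begin

lemma sqrt_pos: "0 < sqrt (a\<^sup>2 + \<eta>\<^sup>2)" using \<eta> by (simp add: add_nonneg_pos)

lemma smooth_abs_derivative: "(smooth_abs \<eta> has_real_derivative smooth_sgn \<eta> a) (at a)"
proof -
  have "0 < a\<^sup>2 + \<eta>\<^sup>2" using \<eta> by (simp add: add_nonneg_pos)
  then show ?thesis unfolding smooth_abs_def smooth_sgn_def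
    by (auto intro!: derivative_eq_intros simp: field_simps)
qed

lemma abs_smooth_sgn_le: "\<bar>smooth_sgn \<eta> a\<bar> \<le> 1"
proof -
  have "\<bar>a\<bar> = sqrt (a\<^sup>2)" by simp
  also have "\<dots> \<le> sqrt (a\<^sup>2 + \<eta>\<^sup>2)" by (rule real_sqrt_le_mono) simp
  finally show ?thesis using sqrt_pos[of a] by (simp add: smooth_sgn_def divide_le_eq abs_divide)
qed

lemma smooth_abs_lipschitz: "\<bar>smooth_abs \<eta> a - smooth_abs \<eta> b\<bar> \<le> \<bar>a - b\<bar>"
proof -
  have "norm (smooth_abs \<eta> a - smooth_abs \<eta> b) \<le> 1 * norm (a - b)"
    by (rule field_differentiable_bound[of UNIV "smooth_abs \<eta>" "smooth_sgn \<eta>"])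
       (use smooth_abs_derivative abs_smooth_sgn_le in auto)
  then show ?thesis by simp
qed

lemma smooth_0 [simp]: "smooth_abs \<eta> 0 = 0" "smooth_sgn \<eta> 0 = 0"
  using \<eta> by (auto simp: smooth_abs_def smooth_sgn_def)

lemma continuous_smooth_abs: "continuous_on UNIV (smooth_abs \<eta>)"
  unfolding smooth_abs_def by (intro continuous_intros)

lemma continuous_smooth_sgn: "continuous_on UNIV (smooth_sgn \<eta>)"
  unfolding smooth_sgn_def using sqrt_pos by (intro continuous_intros) (auto simp: less_imp_neq[THEN not_sym])

end

lemma smooth_abs_measurable [measurable]: "smooth_abs \<eta> \<in> borel_measurable borel"
  unfolding smooth_abs_def[abs_def] by measurable
lemma smooth_sgn_measurable [measurable]: "smooth_sgn \<eta> \<in> borel_measurable borel"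
  unfolding smooth_sgn_def[abs_def] by measurable

lemma smooth_abs_tendsto: "h \<longlonglongrightarrow> 0 \<Longrightarrow> (\<lambda>n. smooth_abs (h n) a) \<longlonglongrightarrow> \<bar>a\<bar>"
proof -
  assume h: "h \<longlonglongrightarrow> 0"
  have "(\<lambda>n. sqrt (a\<^sup>2 + (h n)\<^sup>2) - h n) \<longlonglongrightarrow> sqrt (a\<^sup>2 + 0\<^sup>2) - 0" by (intro tendsto_intros h)
  then show ?thesis by (simp add: smooth_abs_def)
qed

lemma smooth_sgn_tendsto: "h \<longlonglongrightarrow> 0 \<Longrightarrow> (\<lambda>n. smooth_sgn (h n) a) \<longlonglongrightarrow> sgn a"
proof (cases "a = 0")
  case False
  assume h: "h \<longlonglongrightarrow> 0"
  have "(\<lambda>n. a / sqrt (a\<^sup>2 + (h n)\<^sup>2)) \<longlonglongrightarrow> a / sqrt (a\<^sup>2 + 0\<^sup>2)" using False by (intro tendsto_intros h) auto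
  then show ?thesis using False by (simp add: smooth_sgn_def sgn_if abs_if split: if_splits)
qed (simp add: smooth_sgn_def)

locale reflection =
  fixes e :: "'a::euclidean_space"
  assumes e: "norm e = 1"
begin

definition refl :: "'a \<Rightarrow> 'a" where "refl x = x - (2 * (x \<bullet> e)) *\<^sub>R e"
definition side :: "'a \<Rightarrow> real" where "side x = sgn (x \<bullet> e)"
definition sym_part :: "('a \<Rightarrow> real) \<Rightarrow> 'a \<Rightarrow> real" where "sym_part u x = (u x + u (refl x)) / 2"
definition anti_part :: "('a \<Rightarrow> real) \<Rightarrow> 'a \<Rightarrow> real" where "anti_part u x = (u x - u (refl x)) / 2"
definition polar :: "('a \<Rightarrow> real) \<Rightarrow> 'a \<Rightarrow> real" where "polar u x = sym_part u x + side x * \<bar>anti_part u x\<bar>"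
definition sym_grad :: "('a \<Rightarrow> 'a) \<Rightarrow> 'a \<Rightarrow> 'a" where "sym_grad g x = (1/2) *\<^sub>R (g x + refl (g (refl x)))"
definition anti_grad :: "('a \<Rightarrow> 'a) \<Rightarrow> 'a \<Rightarrow> 'a" where "anti_grad g x = (1/2) *\<^sub>R (g x - refl (g (refl x)))"
definition polar_grad :: "('a \<Rightarrow> real) \<Rightarrow> ('a \<Rightarrow> 'a) \<Rightarrow> 'a \<Rightarrow> 'a" where
  "polar_grad u g x = sym_grad g x + (side x * sgn (anti_part u x)) *\<^sub>R anti_grad g x"

lemma ee: "e \<bullet> e = 1" using e by (simp add: norm_eq_1)

lemma refl_linear: "linear refl"
  by (rule linearI) (auto simp: refl_def inner_simps algebra_simps)

lemma refl_inner: "refl x \<bullet> y = x \<bullet> refl y"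
  by (simp add: refl_def inner_simps inner_commute)

lemma refl_refl [simp]: "refl (refl x) = x"
  by (simp add: refl_def inner_simps ee algebra_simps)

lemma norm_refl [simp]: "norm (refl x) = norm x"
  by (simp add: norm_eq_sqrt_inner refl_inner)

lemma refl_side: "refl x \<bullet> e = - (x \<bullet> e)"
  by (simp add: refl_def inner_simps ee)

lemma refl_fixed: "x \<bullet> e = 0 \<Longrightarrow> refl x = x" by (simp add: refl_def)

lemma side_refl [simp]: "side (refl x) = - side x" by (simp add: side_def refl_side sgn_minus)

lemma refl_simps: "refl (x + y) = refl x + refl y" "refl (c *\<^sub>R x) = c *\<^sub>R refl x" "refl (x - y) = refl x - refl y"
  using refl_linear by (auto simp: linear_add linear_scale linear_diff)

lemma refl_continuous: "continuous_on A refl" unfolding refl_def by (intro continuous_intros)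

lemma refl_measurable [measurable]: "refl \<in> borel_measurable borel"
  by (intro borel_measurable_continuous_onI refl_continuous)

lemma side_measurable [measurable]: "side \<in> borel_measurable borel"
  unfolding side_def[abs_def] by measurable

lemma distr_refl: "distr lborel borel refl = lborel"
  by (rule distr_lborel_isometry[OF refl_linear]) simp

lemma integral_refl:
  fixes f :: "'a \<Rightarrow> real"
  assumes [measurable]: "f \<in> borel_measurable borel"
  shows "(\<integral>x. f (refl x) \<partial>lborel) = (\<integral>x. f x \<partial>lborel)" "integrable lborel (\<lambda>x. f (refl x)) \<longleftrightarrow> integrable lborel f"
proof -
  have "integral\<^sup>L (distr lborel borel refl) f = (\<integral>x. f (refl x) \<partial>lborel)" by (rule integral_distr) auto
  then show "(\<integral>x. f (refl x) \<partial>lborel) = (\<integral>x. f x \<partial>lborel)" by (simp only: distr_refl)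
  have "integrable (distr lborel borel refl) f \<longleftrightarrow> integrable lborel (\<lambda>x. f (refl x))" by (rule integrable_distr_eq) auto
  then show "integrable lborel (\<lambda>x. f (refl x)) \<longleftrightarrow> integrable lborel f" by (simp only: distr_refl)
qed

lemma AE_refl:
  assumes "AE x in lborel. P x" shows "AE x in lborel. P (refl x)"
proof (rule AE_distrD[of refl lborel borel])
  show "AE x in distr lborel borel refl. P x" unfolding distr_refl by fact
qed measurable

lemma loc_int_refl:
  assumes f: "loc_int f" shows "loc_int (\<lambda>x. f (refl x))"
  unfolding loc_int_def
proof (intro conjI allI)
  have [measurable]: "f \<in> borel_measurable borel" using f by measurable
  show "(\<lambda>x. f (refl x)) \<in> borel_measurable borel" by measurable
  fix r
  have [measurable]: "cball (0::'a) r \<in> sets borel" by simp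
  have "integrable lborel (\<lambda>x. indicator (cball 0 r) (refl x) * f (refl x))"
    by (subst integral_refl(2)[of "\<lambda>x. indicator (cball 0 r) x * f x"]) (use f in \<open>auto simp: loc_int_def\<close>)
  then show "integrable lborel (\<lambda>x. indicator (cball 0 r) x * f (refl x))" by (simp add: indicator_def)
qed

text \<open>The larger of the two values at a pair of mirror points is placed on the side that \<open>e\<close> points to. The
definition by symmetric and antisymmetric part is the one that can be differentiated.\<close>
lemma polar_cases:
  "polar u x = (if x \<bullet> e > 0 then max (u x) (u (refl x)) else if x \<bullet> e < 0 then min (u x) (u (refl x)) else u x)"
  by (auto simp: polar_def sym_part_def anti_part_def side_def max_def min_def abs_if refl_fixed field_simps)

lemma anti_part_refl: "anti_part u (refl x) = - anti_part u x" by (simp add: anti_part_def field_simps)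

lemma anti_part_zero: "x \<bullet> e = 0 \<Longrightarrow> anti_part u x = 0" by (simp add: anti_part_def refl_fixed)

lemma continuous_on_comp_refl: "continuous_on UNIV f \<Longrightarrow> continuous_on UNIV (\<lambda>x. f (refl x))"
  by (rule continuous_on_compose2[OF _ refl_continuous]) auto

lemma continuous_on_side_mult:
  fixes k :: "'a \<Rightarrow> real"
  assumes k: "continuous_on UNIV k" and z: "\<And>x. x \<bullet> e = 0 \<Longrightarrow> k x = 0"
  shows "continuous_on UNIV (\<lambda>x. side x * k x)"
proof (rule continuous_at_imp_continuous_on, rule ballI)
  fix x
  have kx: "isCont k x" using k by (simp add: continuous_on_eq_continuous_at)
  show "isCont (\<lambda>x. side x * k x) x"
  proof (cases "x \<bullet> e = 0")
    case True
    have "(k \<longlongrightarrow> 0) (at x)" using kx z[OF True] by (simp add: isCont_def)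
    then have "((\<lambda>y. \<bar>k y\<bar>) \<longlongrightarrow> 0) (at x)" by (rule tendsto_rabs_zero)
    then have "((\<lambda>y. side y * k y) \<longlongrightarrow> 0) (at x)"
      by (rule Lim_null_comparison[rotated]) (auto intro!: always_eventually simp: side_def abs_mult abs_sgn_eq)
    then show ?thesis using z[OF True] by (simp add: isCont_def)
  next
    case False
    have "isCont side x" unfolding side_def using False by (intro continuous_intros)
    then show ?thesis using kx by (intro continuous_intros)
  qed
qed

text \<open>Multiplication by the sign of $x \cdot e$ does not destroy differentiability of a function
which vanishes on the hyperplane together with its derivative: at a point of the hyperplane the
difference quotient only changes its sign.\<close>
lemma side_mult_derivative:
  assumes d: "((\<lambda>s. h (x + s *\<^sub>R b)) has_real_derivative D (x + s *\<^sub>R b)) (at s)"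
    and z: "\<And>x. x \<bullet> e = 0 \<Longrightarrow> h x = 0" "\<And>x. x \<bullet> e = 0 \<Longrightarrow> D x = 0"
  shows "((\<lambda>s. side (x + s *\<^sub>R b) * h (x + s *\<^sub>R b)) has_real_derivative side (x + s *\<^sub>R b) * D (x + s *\<^sub>R b)) (at s)"
proof (cases "(x + s *\<^sub>R b) \<bullet> e = 0")
  case True
  have "((\<lambda>r. h (x + r *\<^sub>R b) / (r - s)) \<longlongrightarrow> 0) (at s)"
    using d z[OF True] by (simp add: has_field_derivative_iff)
  then have "((\<lambda>r. \<bar>h (x + r *\<^sub>R b) / (r - s)\<bar>) \<longlongrightarrow> 0) (at s)" by (rule tendsto_rabs_zero)
  then have "((\<lambda>r. side (x + r *\<^sub>R b) * h (x + r *\<^sub>R b) / (r - s)) \<longlongrightarrow> 0) (at s)"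
    by (rule Lim_null_comparison[rotated])
       (auto intro!: always_eventually simp: side_def abs_mult abs_divide abs_sgn_eq)
  then show ?thesis using z[OF True] by (simp add: has_field_derivative_iff)
next
  case False
  have "((\<lambda>r. (x + r *\<^sub>R b) \<bullet> e) \<longlongrightarrow> (x + s *\<^sub>R b) \<bullet> e) (nhds s)"
    by (intro tendsto_intros filterlim_ident)
  then have "\<forall>\<^sub>F r in nhds s. side (x + r *\<^sub>R b) = side (x + s *\<^sub>R b)"
    using False
  proof (cases "(x + s *\<^sub>R b) \<bullet> e > 0")
    case True
    with \<open>((\<lambda>r. (x + r *\<^sub>R b) \<bullet> e) \<longlongrightarrow> (x + s *\<^sub>R b) \<bullet> e) (nhds s)\<close>
    have "\<forall>\<^sub>F r in nhds s. (x + r *\<^sub>R b) \<bullet> e > 0" by (rule order_tendstoD(1))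
    then show ?thesis by eventually_elim (use True in \<open>simp add: side_def\<close>)
  next
    case neg: False
    then have l: "(x + s *\<^sub>R b) \<bullet> e < 0" using False by linarith
    with \<open>((\<lambda>r. (x + r *\<^sub>R b) \<bullet> e) \<longlongrightarrow> (x + s *\<^sub>R b) \<bullet> e) (nhds s)\<close>
    have "\<forall>\<^sub>F r in nhds s. (x + r *\<^sub>R b) \<bullet> e < 0" by (rule order_tendstoD(2))
    then show ?thesis by eventually_elim (use l in \<open>simp add: side_def\<close>)
  qed
  then have ev: "\<forall>\<^sub>F r in nhds s. side (x + r *\<^sub>R b) * h (x + r *\<^sub>R b) = side (x + s *\<^sub>R b) * h (x + r *\<^sub>R b)"
    by eventually_elim simp
  show ?thesis
    by (rule DERIV_cong_ev[THEN iffD2, OF _ ev _ DERIV_cmult[OF d, of "side (x + s *\<^sub>R b)"]]) auto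
qed

lemma inner_sym_grad: "sym_grad g x \<bullet> b = (g x \<bullet> b + g (refl x) \<bullet> refl b) / 2"
  by (simp add: sym_grad_def inner_simps refl_inner)

lemma inner_anti_grad: "anti_grad g x \<bullet> b = (g x \<bullet> b - g (refl x) \<bullet> refl b) / 2"
  by (simp add: anti_grad_def inner_simps refl_inner)

text \<open>The gradient of the symmetric part plus or minus that of the antisymmetric part: by the parallelogram
identity the signs do not affect the sum over the two mirror points. It is an inequality
only because the sign factor may vanish.\<close>
lemma polar_grad_norm:
  "(norm (polar_grad u g x))\<^sup>2 + (norm (polar_grad u g (refl x)))\<^sup>2 \<le> (norm (g x))\<^sup>2 + (norm (g (refl x)))\<^sup>2"
proof -
  define \<tau> where "\<tau> = side x * sgn (anti_part u x)"
  have t: "\<tau>\<^sup>2 \<le> 1" by (auto simp: \<tau>_def side_def sgn_if)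
  have 1: "polar_grad u g x = sym_grad g x + \<tau> *\<^sub>R anti_grad g x" by (simp add: polar_grad_def \<tau>_def)
  have 2: "polar_grad u g (refl x) = refl (sym_grad g x - \<tau> *\<^sub>R anti_grad g x)"
    by (simp add: polar_grad_def \<tau>_def anti_part_refl sgn_minus sym_grad_def anti_grad_def refl_simps algebra_simps)
  have 3: "norm (g (refl x)) = norm (sym_grad g x - anti_grad g x)"
  proof -
    have "sym_grad g x - anti_grad g x = refl (g (refl x))"
      by (simp add: sym_grad_def anti_grad_def algebra_simps scaleR_left.add[symmetric])
    then show ?thesis by simp
  qed
  have 4: "g x = sym_grad g x + anti_grad g x"
    by (simp add: sym_grad_def anti_grad_def algebra_simps scaleR_left.add[symmetric])
  then have gx: "norm (g x) = norm (sym_grad g x + anti_grad g x)" by simp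
  have par: "(norm (a + c *\<^sub>R b))\<^sup>2 + (norm (a - c *\<^sub>R b))\<^sup>2 = 2 * (norm a)\<^sup>2 + c\<^sup>2 * (2 * (norm b)\<^sup>2)" for a b :: 'a and c
    unfolding power2_norm_eq_inner by (simp add: inner_simps inner_commute power2_eq_square algebra_simps)
  have "(norm (polar_grad u g x))\<^sup>2 + (norm (polar_grad u g (refl x)))\<^sup>2 = 2 * (norm (sym_grad g x))\<^sup>2 + \<tau>\<^sup>2 * (2 * (norm (anti_grad g x))\<^sup>2)"
    unfolding 1 2 norm_refl by (rule par)
  also have "\<dots> \<le> 2 * (norm (sym_grad g x))\<^sup>2 + 1 * (2 * (norm (anti_grad g x))\<^sup>2)"
    by (intro add_left_mono mult_right_mono t) auto
  also have "\<dots> = (norm (g x))\<^sup>2 + (norm (g (refl x)))\<^sup>2"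
    using par[of "sym_grad g x" 1 "anti_grad g x"] unfolding 3 gx by simp
  finally show ?thesis .
qed

lemma mean_refl_derivative:
  assumes w: "wgrad u g" and t: "t > 0"
  shows "((\<lambda>s. mean t u (refl (x + s *\<^sub>R b))) has_real_derivative mean t (\<lambda>y. g y \<bullet> refl b) (refl (x + s *\<^sub>R b))) (at s)"
  using mean_wgrad_direction[OF w t, of "refl x" "refl b" s] by (simp add: refl_simps)

text \<open>The polarization with the absolute value replaced by \<open>smooth_abs\<close>; its formal derivative in a
direction, when \<open>d\<close> and \<open>d'\<close> are the derivatives of \<open>u\<close> in that direction and in the
reflected one, is \<open>smooth_polar_deriv\<close>.\<close>
definition smooth_polar :: "real \<Rightarrow> ('a \<Rightarrow> real) \<Rightarrow> 'a \<Rightarrow> real" where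
  "smooth_polar \<eta> u x = sym_part u x + side x * smooth_abs \<eta> (anti_part u x)"

definition smooth_polar_deriv :: "real \<Rightarrow> ('a \<Rightarrow> real) \<Rightarrow> ('a \<Rightarrow> real) \<Rightarrow> ('a \<Rightarrow> real) \<Rightarrow> 'a \<Rightarrow> real" where
  "smooth_polar_deriv \<eta> u d d' x = (d x + d' (refl x)) / 2 + side x * (smooth_sgn \<eta> (anti_part u x) * ((d x - d' (refl x)) / 2))"

lemma abs_side_le: "\<bar>side x * c\<bar> \<le> \<bar>c\<bar>"
  by (auto simp: side_def abs_mult abs_sgn_eq)

lemma abs_half_sum_le:
  fixes a b z :: real
  assumes "\<bar>z\<bar> \<le> \<bar>(a - b) / 2\<bar>" shows "\<bar>(a + b) / 2 + z\<bar> \<le> \<bar>a\<bar> + \<bar>b\<bar>"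
proof -
  have "\<bar>(a + b) / 2\<bar> + \<bar>(a - b) / 2\<bar> \<le> \<bar>a\<bar> + \<bar>b\<bar>"
    by (auto simp: abs_if field_simps split: if_splits)
  then show ?thesis using assms abs_triangle_ineq[of "(a + b) / 2" z] by linarith
qed

lemma smooth_polar_diff:
  assumes \<eta>: "\<eta> > 0"
  shows "\<bar>smooth_polar \<eta> u x - smooth_polar \<eta> v x\<bar> \<le> \<bar>u x - v x\<bar> + \<bar>u (refl x) - v (refl x)\<bar>"
proof -
  have "\<bar>side x * (smooth_abs \<eta> (anti_part u x) - smooth_abs \<eta> (anti_part v x))\<bar> \<le> \<bar>anti_part u x - anti_part v x\<bar>"
    using abs_side_le smooth_abs_lipschitz[OF \<eta>] by (rule order_trans)
  also have "anti_part u x - anti_part v x = ((u x - v x) - (u (refl x) - v (refl x))) / 2"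
    by (simp add: anti_part_def field_simps)
  finally have "\<bar>((u x - v x) + (u (refl x) - v (refl x))) / 2 + side x * (smooth_abs \<eta> (anti_part u x) - smooth_abs \<eta> (anti_part v x))\<bar>
    \<le> \<bar>u x - v x\<bar> + \<bar>u (refl x) - v (refl x)\<bar>" by (rule abs_half_sum_le)
  moreover have "smooth_polar \<eta> u x - smooth_polar \<eta> v x =
    ((u x - v x) + (u (refl x) - v (refl x))) / 2 + side x * (smooth_abs \<eta> (anti_part u x) - smooth_abs \<eta> (anti_part v x))"
    by (simp add: smooth_polar_def sym_part_def right_diff_distrib) (simp add: field_simps)
  ultimately show ?thesis by simp
qed

lemma smooth_polar_bound: "\<eta> > 0 \<Longrightarrow> \<bar>smooth_polar \<eta> u x\<bar> \<le> \<bar>u x\<bar> + \<bar>u (refl x)\<bar>"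
  using smooth_polar_diff[of \<eta> u x "\<lambda>_. 0"] by (simp add: smooth_polar_def sym_part_def anti_part_def)

lemma smooth_polar_deriv_bound:
  assumes \<eta>: "\<eta> > 0" shows "\<bar>smooth_polar_deriv \<eta> u d d' x\<bar> \<le> \<bar>d x\<bar> + \<bar>d' (refl x)\<bar>"
proof -
  have "\<bar>side x * (smooth_sgn \<eta> (anti_part u x) * ((d x - d' (refl x)) / 2))\<bar> \<le> \<bar>smooth_sgn \<eta> (anti_part u x) * ((d x - d' (refl x)) / 2)\<bar>"
    by (rule abs_side_le)
  also have "\<dots> \<le> 1 * \<bar>(d x - d' (refl x)) / 2\<bar>" unfolding abs_mult by (intro mult_right_mono abs_smooth_sgn_le \<eta>) auto
  finally show ?thesis unfolding smooth_polar_deriv_def by (intro abs_half_sum_le) simp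
qed

text \<open>For a mollification of \<open>u\<close> the smoothed polarization is classically differentiable along lines, by
\<open>side_mult_derivative\<close>, and one integrates by parts.\<close>
lemma smooth_polar_mean_integral:
  assumes w: "wgrad u g" and t: "t > 0" and \<eta>: "\<eta> > 0" and \<phi>: "test_function \<phi>" and b: "b \<in> Basis"
  defines "d \<equiv> mean t (\<lambda>y. g y \<bullet> b)" and "d' \<equiv> mean t (\<lambda>y. g y \<bullet> refl b)"
  shows "(\<integral>x. smooth_polar \<eta> (mean t u) x * frechet_derivative \<phi> (at x) b + smooth_polar_deriv \<eta> (mean t u) d d' x * \<phi> x \<partial>lborel) = 0"
    and "integrable lborel (\<lambda>x. smooth_polar \<eta> (mean t u) x * frechet_derivative \<phi> (at x) b + smooth_polar_deriv \<eta> (mean t u) d d' x * \<phi> x)"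
proof -
  let ?U = "mean t u"
  obtain r where r: "\<And>y. r < norm y \<Longrightarrow> \<phi> y = 0" "\<And>y b. r < norm y \<Longrightarrow> frechet_derivative \<phi> (at y) b = 0" using test_support[OF \<phi>] by blast
  have cU: "continuous_on UNIV ?U" and cd: "continuous_on UNIV d" "continuous_on UNIV d'"
    unfolding d_def d'_def by (intro continuous_mean wgrad_loc_int(1)[OF w] wgrad_loc_int_direction[OF w] t)+
  note cr = continuous_on_comp_refl
  have ca: "continuous_on UNIV (anti_part ?U)" unfolding anti_part_def by (intro continuous_intros cU cr) auto
  have cs: "continuous_on UNIV (sym_part ?U)" unfolding sym_part_def by (intro continuous_intros cU cr) auto
  have c1: "continuous_on UNIV (smooth_polar \<eta> ?U)"
    unfolding smooth_polar_def using \<eta>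
    by (intro continuous_intros cs continuous_on_side_mult continuous_on_compose2[OF continuous_smooth_abs[OF \<eta>] ca])
       (auto simp: anti_part_zero)
  have c2: "continuous_on UNIV (smooth_polar_deriv \<eta> ?U d d')"
    unfolding smooth_polar_deriv_def using \<eta>
    by (intro continuous_on_add continuous_on_side_mult continuous_on_mult continuous_on_divide continuous_on_diff continuous_on_const
          continuous_on_compose2[OF continuous_smooth_sgn[OF \<eta>] ca] cd cr)
       (auto simp: anti_part_zero)
  have D: "((\<lambda>s. smooth_polar \<eta> ?U (x + s *\<^sub>R b)) has_real_derivative smooth_polar_deriv \<eta> ?U d d' (x + s *\<^sub>R b)) (at s)" for x s
  proof -
    note d1 = mean_wgrad_direction[OF w t, of x b s, folded d_def]
    note d2 = mean_refl_derivative[OF w t, of x b s, folded d'_def]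
    have a: "((\<lambda>s. anti_part ?U (x + s *\<^sub>R b)) has_real_derivative (d (x + s *\<^sub>R b) - d' (refl (x + s *\<^sub>R b))) / 2) (at s)"
      unfolding anti_part_def by (intro DERIV_cdivide DERIV_diff d1 d2)
    have sy: "((\<lambda>s. sym_part ?U (x + s *\<^sub>R b)) has_real_derivative (d (x + s *\<^sub>R b) + d' (refl (x + s *\<^sub>R b))) / 2) (at s)"
      unfolding sym_part_def by (intro DERIV_cdivide DERIV_add d1 d2)
    have "((\<lambda>s. side (x + s *\<^sub>R b) * smooth_abs \<eta> (anti_part ?U (x + s *\<^sub>R b))) has_real_derivative
      side (x + s *\<^sub>R b) * (smooth_sgn \<eta> (anti_part ?U (x + s *\<^sub>R b)) * ((d (x + s *\<^sub>R b) - d' (refl (x + s *\<^sub>R b))) / 2))) (at s)"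
      by (rule side_mult_derivative[where h="\<lambda>x. smooth_abs \<eta> (anti_part ?U x)" and
           D="\<lambda>x. smooth_sgn \<eta> (anti_part ?U x) * ((d x - d' (refl x)) / 2)", OF DERIV_chain2[OF smooth_abs_derivative[OF \<eta>] a]])
         (auto simp: anti_part_zero \<eta>)
    from DERIV_add[OF sy this] show ?thesis unfolding smooth_polar_def smooth_polar_deriv_def .
  qed
  have cQ: "continuous_on UNIV (\<lambda>x. smooth_polar \<eta> ?U x * frechet_derivative \<phi> (at x) b + smooth_polar_deriv \<eta> ?U d d' x * \<phi> x)"
    by (intro continuous_on_add continuous_on_mult c1 c2 test_continuous[OF \<phi>] test_derivative_continuous[OF \<phi> b])
  show "(\<integral>x. smooth_polar \<eta> ?U x * frechet_derivative \<phi> (at x) b + smooth_polar_deriv \<eta> ?U d d' x * \<phi> x \<partial>lborel) = 0"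
  proof (rule integral_direction_derivative_eq_0[where f="\<lambda>x. smooth_polar \<eta> ?U x * \<phi> x" and b=b and r=r])
    show "((\<lambda>s. smooth_polar \<eta> ?U (x + s *\<^sub>R b) * \<phi> (x + s *\<^sub>R b)) has_real_derivative
      smooth_polar \<eta> ?U (x + s *\<^sub>R b) * frechet_derivative \<phi> (at (x + s *\<^sub>R b)) b + smooth_polar_deriv \<eta> ?U d d' (x + s *\<^sub>R b) * \<phi> (x + s *\<^sub>R b)) (at s)" for x s
      by (rule DERIV_cong[OF DERIV_mult[OF D test_direction_derivative[OF \<phi>]]]) simp
    show "continuous_on UNIV (\<lambda>x. smooth_polar \<eta> ?U x * \<phi> x)"
      by (intro continuous_on_mult c1 test_continuous \<phi>)
    show "continuous_on UNIV (\<lambda>x. smooth_polar \<eta> ?U x * frechet_derivative \<phi> (at x) b + smooth_polar_deriv \<eta> ?U d d' x * \<phi> x)" by (rule cQ)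
  qed (use r in auto)
  have "integrable lborel (\<lambda>x. (smooth_polar \<eta> ?U x * frechet_derivative \<phi> (at x) b + smooth_polar_deriv \<eta> ?U d d' x * \<phi> x) * 1)"
    by (rule loc_int_mult_compact[OF loc_int_const cQ, of r]) (simp add: r)
  then show "integrable lborel (\<lambda>x. smooth_polar \<eta> ?U x * frechet_derivative \<phi> (at x) b + smooth_polar_deriv \<eta> ?U d d' x * \<phi> x)" by simp
qed

lemma parts_measurable [measurable]:
  assumes [measurable]: "u \<in> borel_measurable borel"
  shows "sym_part u \<in> borel_measurable borel" "anti_part u \<in> borel_measurable borel"
  unfolding sym_part_def[abs_def] anti_part_def[abs_def] by measurable

lemma smooth_polar_measurable [measurable]:
  assumes [measurable]: "u \<in> borel_measurable borel"
  shows "smooth_polar \<eta> u \<in> borel_measurable borel"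
  unfolding smooth_polar_def[abs_def] by measurable

lemma smooth_polar_deriv_measurable [measurable]:
  assumes [measurable]: "u \<in> borel_measurable borel" "d \<in> borel_measurable borel" "d' \<in> borel_measurable borel"
  shows "smooth_polar_deriv \<eta> u d d' \<in> borel_measurable borel"
  unfolding smooth_polar_deriv_def[abs_def] by measurable

lemma smooth_polar_loc_int: "loc_int u \<Longrightarrow> \<eta> > 0 \<Longrightarrow> loc_int (smooth_polar \<eta> u)"
  by (rule loc_int_bound[OF loc_int_add[OF loc_int_abs loc_int_abs[OF loc_int_refl]]])
     (auto intro!: AE_I2 smooth_polar_bound simp: loc_int_measurable)

lemma smooth_polar_deriv_loc_int:
  "loc_int u \<Longrightarrow> loc_int d \<Longrightarrow> loc_int d' \<Longrightarrow> \<eta> > 0 \<Longrightarrow> loc_int (smooth_polar_deriv \<eta> u d d')"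
  by (rule loc_int_bound[OF loc_int_add[OF loc_int_abs[of d] loc_int_abs[OF loc_int_refl[of d']]]])
     (auto intro!: AE_I2 smooth_polar_deriv_bound simp: loc_int_measurable)

text \<open>Passage to the limit in \<open>smooth_polar_mean_integral\<close> as the radius tends to zero. The terms that are
Lipschitz in the mollified functions converge by local $L^1$ convergence; the
coefficient \<open>smooth_sgn\<close> is only bounded and converges almost everywhere along a subsequence, which
is enough against the fixed locally integrable derivatives.\<close>
lemma smooth_polar_weak_derivative:
  assumes w: "wgrad u g" and \<eta>: "\<eta> > 0" and \<phi>: "test_function \<phi>" and b: "b \<in> Basis"
  defines "d \<equiv> \<lambda>y. g y \<bullet> b" and "d' \<equiv> \<lambda>y. g y \<bullet> refl b"
  shows "(\<integral>x. smooth_polar \<eta> u x * frechet_derivative \<phi> (at x) b + smooth_polar_deriv \<eta> u d d' x * \<phi> x \<partial>lborel) = 0"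
proof -
  let ?Z = "moll_mass TYPE('a)"
  have Z: "?Z > 0" by (rule moll_mass_pos)
  \<comment> \<open>compensates for the mollifier having mass \<open>?Z\<close> instead of $1$\<close>
  have w1: "wgrad (\<lambda>x. u x / ?Z) (\<lambda>x. (1 / ?Z) *\<^sub>R g x)"
    using wgrad_lincomb[OF w w, of "1 / ?Z" 0] by simp
  note [measurable] = wgrad_measurable[OF w] wgrad_measurable[OF w1] test_measurable[OF \<phi>] test_measurable[OF test_function_derivative[OF \<phi> b]]
  have [measurable]: "d \<in> borel_measurable borel" "d' \<in> borel_measurable borel" unfolding d_def d'_def by measurable
  obtain r where r: "\<And>y. r < norm y \<Longrightarrow> \<phi> y = 0" "\<And>y b. r < norm y \<Longrightarrow> frechet_derivative \<phi> (at y) b = 0" using test_support[OF \<phi>] by blast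
  obtain B1 where B1: "B1 \<ge> 0" "\<And>y. \<bar>\<phi> y\<bar> \<le> B1" using compactly_supported_bounded[OF test_continuous[OF \<phi>] r(1)] by blast
  obtain B2 where B2: "B2 \<ge> 0" "\<And>y. \<bar>frechet_derivative \<phi> (at y) b\<bar> \<le> B2"
    using compactly_supported_bounded[OF test_derivative_continuous[OF \<phi> b] r(2)] by blast
  have lu: "loc_int u" "loc_int d" "loc_int d'"
    unfolding d_def d'_def by (intro wgrad_loc_int(1)[OF w] wgrad_loc_int_direction[OF w])+
  have lu1: "loc_int (\<lambda>x. u x / ?Z)" "loc_int (\<lambda>y. ((1 / ?Z) *\<^sub>R g y) \<bullet> b)" "loc_int (\<lambda>y. ((1 / ?Z) *\<^sub>R g y) \<bullet> refl b)"
    by (intro wgrad_loc_int(1)[OF w1] wgrad_loc_int_direction[OF w1])+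
  define t0 where "t0 n = 1 / real (Suc n)" for n
  have t0: "t0 n > 0" "t0 n \<le> 1" for n by (auto simp: t0_def)
  have t0l: "t0 \<longlonglongrightarrow> 0" unfolding t0_def by (rule inverse_Suc_tendsto_0)
  obtain s where s: "strict_mono s" "AE x in lborel. norm x \<le> r \<longrightarrow> (\<lambda>n. mean (t0 (s n)) (\<lambda>x. u x / ?Z) x) \<longlonglongrightarrow> ?Z * (u x / ?Z)"
    by (rule mean_tendsto_AE_subseq[OF lu1(1) t0 t0l])
  define t where "t n = t0 (s n)" for n
  have t: "t n > 0" "t n \<le> 1" for n by (auto simp: t_def t0)
  have tl: "t \<longlonglongrightarrow> 0" unfolding t_def using LIMSEQ_subseq_LIMSEQ[OF t0l s(1)] by (simp add: o_def)
  define U where "U n = mean (t n) (\<lambda>x. u x / ?Z)" for n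
  define P where "P n = mean (t n) (\<lambda>y. ((1 / ?Z) *\<^sub>R g y) \<bullet> b)" for n
  define P' where "P' n = mean (t n) (\<lambda>y. ((1 / ?Z) *\<^sub>R g y) \<bullet> refl b)" for n
  have [measurable]: "U n \<in> borel_measurable borel" "P n \<in> borel_measurable borel" "P' n \<in> borel_measurable borel" for n
    unfolding U_def P_def P'_def by measurable
  have Ulim: "AE x in lborel. norm x \<le> r \<longrightarrow> (\<lambda>n. U n x) \<longlonglongrightarrow> u x"
    using s(2) Z by (simp add: U_def t_def)
  define H where "H f n x = indicator (cball 0 r) x * \<bar>f n x\<bar>" for f :: "nat \<Rightarrow> 'a \<Rightarrow> real" and n x
  have H1: "integrable lborel (H (\<lambda>n x. U n x - u x) n)" "(\<lambda>n. \<integral>x. H (\<lambda>n x. U n x - u x) n x \<partial>lborel) \<longlonglongrightarrow> 0" for n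
    using mean_tendsto_local_L1[OF lu1(1) t tl, of r] Z unfolding H_def U_def by simp_all
  have H2: "integrable lborel (H (\<lambda>n x. P n x - d x) n)" "(\<lambda>n. \<integral>x. H (\<lambda>n x. P n x - d x) n x \<partial>lborel) \<longlonglongrightarrow> 0" for n
    using mean_tendsto_local_L1[OF lu1(2) t tl, of r] Z unfolding H_def P_def d_def by simp_all
  have H3: "integrable lborel (H (\<lambda>n x. P' n x - d' x) n)" "(\<lambda>n. \<integral>x. H (\<lambda>n x. P' n x - d' x) n x \<partial>lborel) \<longlonglongrightarrow> 0" for n
    using mean_tendsto_local_L1[OF lu1(3) t tl, of r] Z unfolding H_def P'_def d'_def by simp_all
  have Hrefl: "integrable lborel (\<lambda>x. H f n (refl x))" "(\<lambda>n. \<integral>x. H f n (refl x) \<partial>lborel) \<longlonglongrightarrow> 0"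
    if h: "\<And>n. integrable lborel (H f n)" "(\<lambda>n. \<integral>x. H f n x \<partial>lborel) \<longlonglongrightarrow> 0" for f n
  proof -
    have m: "H f n \<in> borel_measurable borel" for n using borel_measurable_integrable[OF h(1)[of n]] by simp
    show "integrable lborel (\<lambda>x. H f n (refl x))" using integral_refl(2)[OF m] h(1) by simp
    show "(\<lambda>n. \<integral>x. H f n (refl x) \<partial>lborel) \<longlonglongrightarrow> 0" using h(2) by (simp add: integral_refl(1)[OF m])
  qed
  define h where "h n x = (H (\<lambda>n x. U n x - u x) n x + H (\<lambda>n x. U n x - u x) n (refl x)) +
      (H (\<lambda>n x. P n x - d x) n x + H (\<lambda>n x. P' n x - d' x) n (refl x))" for n x
  note hint = H1(1) H2(1) Hrefl(1)[OF H1] Hrefl(1)[OF H3]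
  have h1: "integrable lborel (h n)" for n
    unfolding h_def[abs_def] by (intro Bochner_Integration.integrable_add hint)
  have heq: "(\<integral>x. h n x \<partial>lborel) = ((\<integral>x. H (\<lambda>n x. U n x - u x) n x \<partial>lborel) + (\<integral>x. H (\<lambda>n x. U n x - u x) n (refl x) \<partial>lborel)) +
      ((\<integral>x. H (\<lambda>n x. P n x - d x) n x \<partial>lborel) + (\<integral>x. H (\<lambda>n x. P' n x - d' x) n (refl x) \<partial>lborel))" for n
    unfolding h_def using hint
    by (subst Bochner_Integration.integral_add, simp, simp, subst Bochner_Integration.integral_add, simp, simp,
        subst Bochner_Integration.integral_add) simp_all
  have h2: "(\<lambda>n. \<integral>x. h n x \<partial>lborel) \<longlonglongrightarrow> 0"
    unfolding heq using tendsto_add[OF tendsto_add[OF H1(2) Hrefl(2)[OF H1]] tendsto_add[OF H2(2) Hrefl(2)[OF H3]]] by simp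
  define \<alpha> where "\<alpha> x = (d x - d' (refl x)) / 2" for x
  have [measurable]: "\<alpha> \<in> borel_measurable borel" unfolding \<alpha>_def by measurable
  have la: "loc_int \<alpha>"
    unfolding \<alpha>_def using loc_int_cmult[OF loc_int_diff[OF lu(2) loc_int_refl[OF lu(3)]], of "1/2"] by simp
  define F where "F n x = smooth_sgn \<eta> (anti_part (U n) x)" for n x
  define F0 where "F0 x = smooth_sgn \<eta> (anti_part u x)" for x
  have [measurable]: "F n \<in> borel_measurable borel" "F0 \<in> borel_measurable borel" for n unfolding F_def F0_def by measurable
  \<comment> \<open>the part of the error coming from the coefficient, which converges only almost everywhere\<close>
  define \<psi> where "\<psi> n x = side x * (F n x - F0 x) * \<phi> x" for n x
  have [measurable]: "\<psi> n \<in> borel_measurable borel" for n unfolding \<psi>_def by measurable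
  \<comment> \<open>the part of the error that is Lipschitz in the mollified functions\<close>
  define f where "f n x = (smooth_polar \<eta> (U n) x - smooth_polar \<eta> u x) * frechet_derivative \<phi> (at x) b
     + (smooth_polar_deriv \<eta> (U n) (P n) (P' n) x - smooth_polar_deriv \<eta> (U n) d d' x) * \<phi> x" for n x
  have f_bound: "\<bar>f n x\<bar> \<le> (B1 + B2) * h n x" for n x
  proof (cases "norm x \<le> r")
    case True
    have e1: "\<bar>smooth_polar \<eta> (U n) x - smooth_polar \<eta> u x\<bar> \<le> \<bar>U n x - u x\<bar> + \<bar>U n (refl x) - u (refl x)\<bar>" by (rule smooth_polar_diff[OF \<eta>])
    have "smooth_polar_deriv \<eta> (U n) (P n) (P' n) x - smooth_polar_deriv \<eta> (U n) d d' x =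
      smooth_polar_deriv \<eta> (U n) (\<lambda>x. P n x - d x) (\<lambda>x. P' n x - d' x) x"
      unfolding smooth_polar_deriv_def by (simp add: field_simps)
    then have e2: "\<bar>smooth_polar_deriv \<eta> (U n) (P n) (P' n) x - smooth_polar_deriv \<eta> (U n) d d' x\<bar> \<le> \<bar>P n x - d x\<bar> + \<bar>P' n (refl x) - d' (refl x)\<bar>"
      using smooth_polar_deriv_bound[OF \<eta>, of "U n" "\<lambda>x. P n x - d x" "\<lambda>x. P' n x - d' x" x] by simp
    have "\<bar>f n x\<bar> \<le> \<bar>(smooth_polar \<eta> (U n) x - smooth_polar \<eta> u x) * frechet_derivative \<phi> (at x) b\<bar> + \<bar>(smooth_polar_deriv \<eta> (U n) (P n) (P' n) x - smooth_polar_deriv \<eta> (U n) d d' x) * \<phi> x\<bar>"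
      unfolding f_def by (rule abs_triangle_ineq)
    also have "\<dots> \<le> (\<bar>U n x - u x\<bar> + \<bar>U n (refl x) - u (refl x)\<bar>) * B2 + (\<bar>P n x - d x\<bar> + \<bar>P' n (refl x) - d' (refl x)\<bar>) * B1"
      unfolding abs_mult by (intro add_mono mult_mono e1 e2 B1 B2) auto
    also have "\<dots> \<le> (\<bar>U n x - u x\<bar> + \<bar>U n (refl x) - u (refl x)\<bar>) * (B1 + B2) + (\<bar>P n x - d x\<bar> + \<bar>P' n (refl x) - d' (refl x)\<bar>) * (B1 + B2)"
      using B1 B2 by (intro add_mono mult_left_mono) auto
    also have "\<dots> = (B1 + B2) * h n x" using True by (simp add: h_def H_def algebra_simps)
    finally show ?thesis .
  next
    case False
    then show ?thesis using r B1 B2 by (simp add: f_def h_def H_def)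
  qed
  have f_lim: "(\<lambda>n. \<integral>x. f n x \<partial>lborel) \<longlonglongrightarrow> 0"
    by (rule tendsto_integral_0_if_dominated[OF f_bound _ h1 h2]) (use B1 B2 in \<open>auto simp: f_def[abs_def]\<close>)
  have F_le: "\<bar>F n x\<bar> \<le> 1" "\<bar>F0 x\<bar> \<le> 1" for n x unfolding F_def F0_def by (rule abs_smooth_sgn_le[OF \<eta>])+
  have psi_lim: "(\<lambda>n. \<integral>x. \<psi> n x * \<alpha> x \<partial>lborel) \<longlonglongrightarrow> (\<integral>x. 0 * \<alpha> x \<partial>lborel)"
  proof (rule tendsto_integral_compact_support_AE[OF la, where B="2 * B1" and r=r])
    show "\<bar>\<psi> n x\<bar> \<le> 2 * B1" for n x
    proof -
      have "\<bar>F n x - F0 x\<bar> \<le> 2" using F_le(1)[of n x] F_le(2)[of x] by linarith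
      then have "\<bar>side x * (F n x - F0 x)\<bar> \<le> 2" using abs_side_le order_trans by blast
      then show ?thesis unfolding \<psi>_def abs_mult[of _ "\<phi> x"] using B1 by (intro mult_mono) auto
    qed
    show "AE x in lborel. norm x \<le> r \<longrightarrow> (\<lambda>n. \<psi> n x) \<longlonglongrightarrow> 0"
      using Ulim AE_refl[OF Ulim]
    proof eventually_elim
      case (elim x)
      show ?case
      proof
        assume x: "norm x \<le> r"
        have "(\<lambda>n. anti_part (U n) x) \<longlonglongrightarrow> anti_part u x"
          unfolding anti_part_def using elim x by (intro tendsto_intros) auto
        then have "(\<lambda>n. F n x) \<longlonglongrightarrow> F0 x"
          unfolding F_def F0_def by (rule continuous_on_tendsto_compose[OF continuous_smooth_sgn[OF \<eta>]]) auto
        then have "(\<lambda>n. side x * (F n x - F0 x) * \<phi> x) \<longlonglongrightarrow> side x * (F0 x - F0 x) * \<phi> x"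
          by (intro tendsto_intros)
        then show "(\<lambda>n. \<psi> n x) \<longlonglongrightarrow> 0" by (simp add: \<psi>_def)
      qed
    qed
  qed (use r in \<open>auto simp: \<psi>_def\<close>)
  define I where "I = (\<integral>x. smooth_polar \<eta> u x * frechet_derivative \<phi> (at x) b + smooth_polar_deriv \<eta> u d d' x * \<phi> x \<partial>lborel)"
  have i0: "integrable lborel (\<lambda>x. smooth_polar \<eta> u x * frechet_derivative \<phi> (at x) b + smooth_polar_deriv \<eta> u d d' x * \<phi> x)"
    using loc_int_mult_compact[OF smooth_polar_loc_int[OF lu(1) \<eta>] test_derivative_continuous[OF \<phi> b] r(2)]
      loc_int_mult_compact[OF smooth_polar_deriv_loc_int[OF lu \<eta>] test_continuous[OF \<phi>] r(1)]
    by (simp add: mult.commute)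
  have "(\<integral>x. f n x \<partial>lborel) + (\<integral>x. \<psi> n x * \<alpha> x \<partial>lborel) = - I" for n
  proof -
    note sm = smooth_polar_mean_integral[OF w1 t(1)[of n] \<eta> \<phi> b, folded U_def P_def P'_def]
    have if': "integrable lborel (f n)"
      by (rule Bochner_Integration.integrable_bound[of _ "\<lambda>x. (B1 + B2) * h n x"])
         (use h1 f_bound in \<open>auto intro!: AE_I2 intro: order_trans[OF _ abs_ge_self] simp: f_def[abs_def]\<close>)
    have eq: "f n x + \<psi> n x * \<alpha> x = (smooth_polar \<eta> (U n) x * frechet_derivative \<phi> (at x) b + smooth_polar_deriv \<eta> (U n) (P n) (P' n) x * \<phi> x) -
       (smooth_polar \<eta> u x * frechet_derivative \<phi> (at x) b + smooth_polar_deriv \<eta> u d d' x * \<phi> x)" for x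
      unfolding f_def \<psi>_def F_def F0_def \<alpha>_def smooth_polar_deriv_def by (simp add: algebra_simps)
    have ip: "integrable lborel (\<lambda>x. \<psi> n x * \<alpha> x)"
    proof -
      have "\<psi> n x * \<alpha> x = ((smooth_polar \<eta> (U n) x * frechet_derivative \<phi> (at x) b + smooth_polar_deriv \<eta> (U n) (P n) (P' n) x * \<phi> x) -
       (smooth_polar \<eta> u x * frechet_derivative \<phi> (at x) b + smooth_polar_deriv \<eta> u d d' x * \<phi> x)) - f n x" for x
        using eq[of x] by simp
      then show ?thesis using sm(2) i0 if' by simp
    qed
    have "(\<integral>x. f n x \<partial>lborel) + (\<integral>x. \<psi> n x * \<alpha> x \<partial>lborel) = (\<integral>x. f n x + \<psi> n x * \<alpha> x \<partial>lborel)"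
      using if' ip by simp
    also have "\<dots> = 0 - I"
      unfolding eq I_def using sm i0 by (subst Bochner_Integration.integral_diff) auto
    finally show ?thesis by simp
  qed
  then have "(\<lambda>n. - I) \<longlonglongrightarrow> 0" using tendsto_add[OF f_lim psi_lim] by simp
  then have "I = 0" by (simp add: LIMSEQ_const_iff)
  then show ?thesis by (simp add: I_def)
qed

end

section \<open>Polarization in the Sobolev space\<close>

text \<open>Nonempty open sets have positive measure; this turns statements almost everywhere about continuous
functions into statements everywhere.\<close>
lemma open_empty_if_AE_avoided:
  fixes S :: "'a::euclidean_space set"
  assumes "open S" "AE x in lborel. x \<notin> S" shows "S = {}"
proof (rule ccontr)
  assume "S \<noteq> {}"
  then obtain x where "x \<in> S" by blast
  then obtain r where r: "r > 0" "ball x r \<subseteq> S" using assms(1) by (meson openE)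
  have "AE y in lborel. y \<notin> ball x r" using assms(2) by eventually_elim (use r in auto)
  then have "ball x r \<in> null_sets lborel" by (subst AE_iff_null_sets) auto
  then have "unit_ball_vol (real DIM('a)) * r ^ DIM('a) \<le> 0" using r by (simp add: null_sets_def emeasure_ball ennreal_eq_0_iff)
  moreover have "0 < unit_ball_vol (real DIM('a)) * r ^ DIM('a)" using r by (intro mult_pos_pos) auto
  ultimately show False by linarith
qed

context reflection
begin

lemma polar_measurable [measurable]:
  assumes [measurable]: "u \<in> borel_measurable borel" shows "polar u \<in> borel_measurable borel"
  unfolding polar_def[abs_def] by measurable

lemma polar_grad_measurable [measurable]:
  assumes [measurable]: "u \<in> borel_measurable borel" "g \<in> borel_measurable borel"
  shows "polar_grad u g \<in> borel_measurable borel"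
  unfolding polar_grad_def[abs_def] sym_grad_def anti_grad_def by measurable

lemma polar_mem: "polar u x = u x \<or> polar u x = u (refl x)"
  by (auto simp: polar_cases max_def min_def)

lemma polar_rearrange_pointwise:
  "f (polar u x) + f (polar u (refl x)) = f (u x) + (f (u (refl x)) :: real)"
  by (auto simp: polar_cases max_def min_def refl_side refl_fixed)

text \<open>At two mirror points a function and its polarization take the same pair of values, so that integrals
with a symmetric integrand agree after symmetrization. This covers the modular and the potential
energy.\<close>
lemma polar_rearrange:
  fixes f :: "'a \<Rightarrow> real \<Rightarrow> real"
  assumes inv: "AE x in lborel. \<forall>r. f (refl x) r = f x r"
    and i: "integrable lborel (\<lambda>x. f x (u x))" and m[measurable]: "(\<lambda>x. f x (polar u x)) \<in> borel_measurable borel"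
  shows "integrable lborel (\<lambda>x. f x (polar u x))" "(\<integral>x. f x (polar u x) \<partial>lborel) = (\<integral>x. f x (u x) \<partial>lborel)"
proof -
  have mu[measurable]: "(\<lambda>x. f x (u x)) \<in> borel_measurable borel" using borel_measurable_integrable[OF i] by simp
  have ir: "integrable lborel (\<lambda>x. f (refl x) (u (refl x)))" using integral_refl(2)[OF mu] i by simp
  show ip: "integrable lborel (\<lambda>x. f x (polar u x))"
  proof (rule Bochner_Integration.integrable_bound)
    show "integrable lborel (\<lambda>x. \<bar>f x (u x)\<bar> + \<bar>f (refl x) (u (refl x))\<bar>)" using i ir by auto
    show "AE x in lborel. norm (f x (polar u x)) \<le> norm (\<bar>f x (u x)\<bar> + \<bar>f (refl x) (u (refl x))\<bar>)"
      using inv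
    proof eventually_elim
      case (elim x) then show ?case using polar_mem[of u x] by auto
    qed
  qed measurable
  have ipr: "integrable lborel (\<lambda>x. f (refl x) (polar u (refl x)))" using integral_refl(2)[OF m] ip by simp
  have "2 * (\<integral>x. f x (polar u x) \<partial>lborel) = (\<integral>x. f x (polar u x) + f (refl x) (polar u (refl x)) \<partial>lborel)"
    using ip ipr integral_refl(1)[OF m] by simp
  also have "\<dots> = (\<integral>x. f x (u x) + f (refl x) (u (refl x)) \<partial>lborel)"
  proof (rule integral_cong_AE)
    show "(\<lambda>x. f x (polar u x) + f (refl x) (polar u (refl x))) \<in> borel_measurable lborel"
      "(\<lambda>x. f x (u x) + f (refl x) (u (refl x))) \<in> borel_measurable lborel"
      using ip ipr i ir by (auto intro: borel_measurable_add borel_measurable_integrable)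
    show "AE x in lborel. f x (polar u x) + f (refl x) (polar u (refl x)) = f x (u x) + f (refl x) (u (refl x))"
      using inv
    proof eventually_elim
      case (elim x) then show ?case using polar_rearrange_pointwise[of "f x" u x] by simp
    qed
  qed
  also have "\<dots> = 2 * (\<integral>x. f x (u x) \<partial>lborel)" using i ir integral_refl(1)[OF mu] by simp
  finally show "(\<integral>x. f x (polar u x) \<partial>lborel) = (\<integral>x. f x (u x) \<partial>lborel)" by simp
qed

lemma polar_grad_integral:
  assumes [measurable]: "u \<in> borel_measurable borel" "g \<in> borel_measurable borel" and i: "integrable lborel (\<lambda>x. (norm (g x))\<^sup>2)"
  shows "integrable lborel (\<lambda>x. (norm (polar_grad u g x))\<^sup>2)"
    "(\<integral>x. (norm (polar_grad u g x))\<^sup>2 \<partial>lborel) \<le> (\<integral>x. (norm (g x))\<^sup>2 \<partial>lborel)"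
proof -
  have mg: "(\<lambda>x. (norm (g x))\<^sup>2) \<in> borel_measurable borel" by measurable
  have mp: "(\<lambda>x. (norm (polar_grad u g x))\<^sup>2) \<in> borel_measurable borel" by measurable
  have ir: "integrable lborel (\<lambda>x. (norm (g (refl x)))\<^sup>2)" using integral_refl(2)[OF mg] i by simp
  show ip: "integrable lborel (\<lambda>x. (norm (polar_grad u g x))\<^sup>2)"
  proof (rule Bochner_Integration.integrable_bound)
    show "integrable lborel (\<lambda>x. (norm (g x))\<^sup>2 + (norm (g (refl x)))\<^sup>2)" using i ir by auto
    show "AE x in lborel. norm ((norm (polar_grad u g x))\<^sup>2) \<le> norm ((norm (g x))\<^sup>2 + (norm (g (refl x)))\<^sup>2)"
    proof (rule AE_I2)
      fix x
      have "(norm (polar_grad u g x))\<^sup>2 \<le> (norm (polar_grad u g x))\<^sup>2 + (norm (polar_grad u g (refl x)))\<^sup>2" by simp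
      also note polar_grad_norm[of u g x]
      finally show "norm ((norm (polar_grad u g x))\<^sup>2) \<le> norm ((norm (g x))\<^sup>2 + (norm (g (refl x)))\<^sup>2)" by simp
    qed
  qed (use mp in simp)
  have ipr: "integrable lborel (\<lambda>x. (norm (polar_grad u g (refl x)))\<^sup>2)" using integral_refl(2)[OF mp] ip by simp
  have "2 * (\<integral>x. (norm (polar_grad u g x))\<^sup>2 \<partial>lborel) = (\<integral>x. (norm (polar_grad u g x))\<^sup>2 + (norm (polar_grad u g (refl x)))\<^sup>2 \<partial>lborel)"
    using ip ipr integral_refl(1)[OF mp] by simp
  also have "\<dots> \<le> (\<integral>x. (norm (g x))\<^sup>2 + (norm (g (refl x)))\<^sup>2 \<partial>lborel)"
    using ip ipr i ir polar_grad_norm by (intro integral_mono) auto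
  also have "\<dots> = 2 * (\<integral>x. (norm (g x))\<^sup>2 \<partial>lborel)" using i ir integral_refl(1)[OF mg] by simp
  finally show "(\<integral>x. (norm (polar_grad u g x))\<^sup>2 \<partial>lborel) \<le> (\<integral>x. (norm (g x))\<^sup>2 \<partial>lborel)" by simp
qed

text \<open>The smoothing parameter of \<open>smooth_polar_weak_derivative\<close> tends to zero; the bounds of the smoothed
quantities do not depend on it.\<close>
theorem polar_wgrad:
  assumes w: "wgrad u g"
  shows "wgrad (polar u) (polar_grad u g)"
  unfolding wgrad_def
proof (intro conjI allI impI ballI)
  note [measurable] = wgrad_measurable[OF w]
  show m1: "polar u \<in> borel_measurable borel" and m2: "polar_grad u g \<in> borel_measurable borel" by measurable
  show i1: "integrable lborel (\<lambda>x. (polar u x)\<^sup>2)"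
    using w by (intro polar_rearrange(1)[of "\<lambda>x r. r\<^sup>2"]) (auto simp: wgrad_def)
  show i2: "integrable lborel (\<lambda>x. (norm (polar_grad u g x))\<^sup>2)"
    using w by (intro polar_grad_integral) (auto simp: wgrad_def)
  fix \<phi> :: "'a \<Rightarrow> real" and b :: 'a assume \<phi>: "test_function \<phi>" and b: "b \<in> Basis"
  note [measurable] = test_measurable[OF \<phi>] test_measurable[OF test_function_derivative[OF \<phi> b]]
  obtain r where r: "\<And>y. r < norm y \<Longrightarrow> \<phi> y = 0" "\<And>y b. r < norm y \<Longrightarrow> frechet_derivative \<phi> (at y) b = 0" using test_support[OF \<phi>] by blast
  let ?d = "\<lambda>y. g y \<bullet> b" and ?d' = "\<lambda>y. g y \<bullet> refl b" and ?D = "\<lambda>x. frechet_derivative \<phi> (at x) b"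
  have [measurable]: "?d \<in> borel_measurable borel" "?d' \<in> borel_measurable borel" by measurable
  define t where "t n = 1 / real (Suc n)" for n
  have t: "t n > 0" for n by (simp add: t_def)
  have tl: "t \<longlonglongrightarrow> 0" unfolding t_def by (rule inverse_Suc_tendsto_0)
  have pg: "polar_grad u g x \<bullet> b = (?d x + ?d' (refl x)) / 2 + side x * (sgn (anti_part u x) * ((?d x - ?d' (refl x)) / 2))" for x
    by (simp add: polar_grad_def inner_add_left inner_sym_grad inner_anti_grad)
  have "(\<lambda>n. \<integral>x. smooth_polar (t n) u x * ?D x + smooth_polar_deriv (t n) u ?d ?d' x * \<phi> x \<partial>lborel) \<longlonglongrightarrow>
    (\<integral>x. polar u x * ?D x + (polar_grad u g x \<bullet> b) * \<phi> x \<partial>lborel)"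
  proof (rule integral_dominated_convergence)
    have "integrable lborel (\<lambda>x. \<bar>?D x\<bar> * (\<bar>u x\<bar> + \<bar>u (refl x)\<bar>) + \<bar>\<phi> x\<bar> * (\<bar>?d x\<bar> + \<bar>?d' (refl x)\<bar>))"
    proof (intro Bochner_Integration.integrable_add)
      show "integrable lborel (\<lambda>x. \<bar>?D x\<bar> * (\<bar>u x\<bar> + \<bar>u (refl x)\<bar>))"
        by (rule loc_int_mult_compact[OF loc_int_add[OF loc_int_abs loc_int_abs[OF loc_int_refl]], of _ _ _ r])
           (use r wgrad_loc_int(1)[OF w] in \<open>auto intro!: continuous_on_rabs test_derivative_continuous[OF \<phi> b]\<close>)
      show "integrable lborel (\<lambda>x. \<bar>\<phi> x\<bar> * (\<bar>?d x\<bar> + \<bar>?d' (refl x)\<bar>))"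
        by (rule loc_int_mult_compact[OF loc_int_add[OF loc_int_abs[of ?d] loc_int_abs[OF loc_int_refl[of ?d']]], of _ r])
           (use r wgrad_loc_int_direction[OF w] in \<open>auto intro!: continuous_on_rabs test_continuous[OF \<phi>]\<close>)
    qed
    then show "integrable lborel (\<lambda>x. (\<bar>u x\<bar> + \<bar>u (refl x)\<bar>) * \<bar>?D x\<bar> + (\<bar>?d x\<bar> + \<bar>?d' (refl x)\<bar>) * \<bar>\<phi> x\<bar>)"
      by (simp add: mult.commute)
    show "AE x in lborel. norm (smooth_polar (t n) u x * ?D x + smooth_polar_deriv (t n) u ?d ?d' x * \<phi> x) \<le> (\<bar>u x\<bar> + \<bar>u (refl x)\<bar>) * \<bar>?D x\<bar> + (\<bar>?d x\<bar> + \<bar>?d' (refl x)\<bar>) * \<bar>\<phi> x\<bar>" for n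
    proof (rule AE_I2)
      fix x
      have "\<bar>smooth_polar (t n) u x * ?D x\<bar> \<le> (\<bar>u x\<bar> + \<bar>u (refl x)\<bar>) * \<bar>?D x\<bar>"
        unfolding abs_mult by (intro mult_right_mono smooth_polar_bound t) auto
      moreover have "\<bar>smooth_polar_deriv (t n) u ?d ?d' x * \<phi> x\<bar> \<le> (\<bar>?d x\<bar> + \<bar>?d' (refl x)\<bar>) * \<bar>\<phi> x\<bar>"
        unfolding abs_mult by (intro mult_right_mono smooth_polar_deriv_bound t) auto
      ultimately show "norm (smooth_polar (t n) u x * ?D x + smooth_polar_deriv (t n) u ?d ?d' x * \<phi> x) \<le> (\<bar>u x\<bar> + \<bar>u (refl x)\<bar>) * \<bar>?D x\<bar> + (\<bar>?d x\<bar> + \<bar>?d' (refl x)\<bar>) * \<bar>\<phi> x\<bar>"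
        unfolding real_norm_def by (rule order_trans[OF abs_triangle_ineq add_mono])
    qed
    show "AE x in lborel. (\<lambda>n. smooth_polar (t n) u x * ?D x + smooth_polar_deriv (t n) u ?d ?d' x * \<phi> x) \<longlonglongrightarrow> polar u x * ?D x + (polar_grad u g x \<bullet> b) * \<phi> x"
      unfolding smooth_polar_def smooth_polar_deriv_def polar_def pg
      by (intro AE_I2 tendsto_add tendsto_mult tendsto_const smooth_abs_tendsto smooth_sgn_tendsto tl)
  qed measurable
  then have 0: "(\<integral>x. polar u x * ?D x + (polar_grad u g x \<bullet> b) * \<phi> x \<partial>lborel) = 0"
    using smooth_polar_weak_derivative[OF w t \<phi> b] by (simp add: LIMSEQ_const_iff)
  have ib: "integrable lborel (\<lambda>x. (polar_grad u g x \<bullet> b)\<^sup>2)"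
    by (rule Bochner_Integration.integrable_bound[OF i2]) (use norm_inner_Basis_square_le[OF b] in \<open>auto intro!: AE_I2\<close>)
  have "integrable lborel (\<lambda>x. ?D x * polar u x)" "integrable lborel (\<lambda>x. \<phi> x * (polar_grad u g x \<bullet> b))"
    using loc_int_mult_compact[OF square_integrable_imp_loc_int[OF m1 i1] test_derivative_continuous[OF \<phi> b] r(2)]
      loc_int_mult_compact[OF square_integrable_imp_loc_int[OF _ ib] test_continuous[OF \<phi>] r(1)] by auto
  then have "(\<integral>x. polar u x * ?D x + (polar_grad u g x \<bullet> b) * \<phi> x \<partial>lborel) = (\<integral>x. polar u x * ?D x \<partial>lborel) + (\<integral>x. (polar_grad u g x \<bullet> b) * \<phi> x \<partial>lborel)"
    by (intro Bochner_Integration.integral_add) (simp_all add: mult.commute)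
  with 0 show "(\<integral>x. polar u x * ?D x \<partial>lborel) = - (\<integral>x. (polar_grad u g x \<bullet> b) * \<phi> x \<partial>lborel)" by simp
qed

lemma continuous_polar:
  assumes u: "continuous_on UNIV u"
  shows "continuous_on UNIV (polar u)"
proof -
  note r = continuous_on_comp_refl[OF u]
  have s: "continuous_on UNIV (\<lambda>x. (u x + u (refl x)) / 2)" and a: "continuous_on UNIV (\<lambda>x. \<bar>(u x - u (refl x)) / 2\<bar>)"
    by (intro continuous_on_rabs continuous_on_divide continuous_on_add continuous_on_diff u r continuous_on_const; simp)+
  have "continuous_on UNIV (\<lambda>x. side x * \<bar>(u x - u (refl x)) / 2\<bar>)"
    by (rule continuous_on_side_mult[OF a]) (simp add: refl_fixed)
  from continuous_on_add[OF s this] show ?thesis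
    unfolding polar_def sym_part_def anti_part_def .
qed

end

section \<open>The strong maximum principle\<close>

lemma mean_tendsto_continuous:
  fixes v :: "'a::euclidean_space \<Rightarrow> real"
  assumes v: "loc_int v" and c: "isCont v x"
  shows "((\<lambda>t. mean t v x) \<longlongrightarrow> moll_mass TYPE('a) * v x) (at_right 0)"
proof (rule tendstoI)
  fix \<epsilon> :: real assume \<epsilon>: "\<epsilon> > 0"
  let ?Z = "moll_mass TYPE('a)"
  have Z: "?Z > 0" by (rule moll_mass_pos)
  have "\<epsilon> / (2 * ?Z) > 0" using \<epsilon> Z by simp
  then obtain \<delta> where \<delta>: "\<delta> > 0" "\<And>y. dist y x < \<delta> \<Longrightarrow> dist (v y) (v x) < \<epsilon> / (2 * ?Z)"
    using c unfolding continuous_at_eps_delta by blast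
  have "dist (mean t v x) (?Z * v x) < \<epsilon>" if t: "0 < t" "t < \<delta>" for t
  proof -
    have im: "integrable lborel (\<lambda>y. moll t x y)" using integrable_moll[OF loc_int_const[of 1] t(1), of x] by simp
    have id: "integrable lborel (\<lambda>y. moll t x y * (v y - v x))"
      by (rule integrable_moll[OF loc_int_diff[OF v loc_int_const] t(1)])
    have "mean t v x - ?Z * v x = mean t v x - mean t (\<lambda>_. v x) x"
      using integral_moll[OF t(1), of x] by (simp add: mean_def)
    also have "\<dots> = (\<integral>y. moll t x y * (v y - v x) \<partial>lborel)"
      using mean_diff[OF v loc_int_const[of "v x"] t(1), of x] by (simp add: mean_def)
    also have "\<bar>\<dots>\<bar> \<le> (\<integral>y. \<bar>moll t x y * (v y - v x)\<bar> \<partial>lborel)" by simp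
    also have "\<dots> \<le> (\<integral>y. moll t x y * (\<epsilon> / (2 * ?Z)) \<partial>lborel)"
    proof (rule integral_mono)
      fix y
      show "\<bar>moll t x y * (v y - v x)\<bar> \<le> moll t x y * (\<epsilon> / (2 * ?Z))"
      proof (cases "norm (y - x) < t")
        case True
        then have "\<bar>v y - v x\<bar> \<le> \<epsilon> / (2 * ?Z)" using \<delta>(2)[of y] t by (simp add: dist_norm less_imp_le)
        from mult_left_mono[OF this moll_nonneg[OF t(1), of x y]] show ?thesis
          by (simp only: abs_mult abs_of_nonneg[OF moll_nonneg[OF t(1)]])
      qed (simp add: moll_eq_0 t not_less)
    qed (use id im in auto)
    also have "\<dots> = \<epsilon> / 2" using integral_moll[OF t(1), of x] Z by simp
    finally show ?thesis using \<epsilon> by (simp add: dist_real_def)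
  qed
  then show "\<forall>\<^sub>F t in at_right 0. dist (mean t v x) (?Z * v x) < \<epsilon>"
    unfolding eventually_at_right_field using \<delta>(1) by blast
qed

text \<open>If $-\Delta v \ge - C v$ and $v \ge 0$ near \<open>x\<close>, then the mollification $A(t)$ of \<open>v\<close> at \<open>x\<close> satisfies
$A' \le \frac{C T}{2} A$, because $pot_t \le \frac{t}{2}\, moll_t$. By Gronwall's inequality and
$A(0+) = const \cdot v(x) = 0$ it vanishes, and since the mollifier is positive in the ball of radius
\<open>t\<close>, so does \<open>v\<close>. The vanishing reaches the whole ball in which the hypotheses hold, however
large \<open>C\<close> and \<open>T\<close> are.\<close>
lemma zero_propagation:
  fixes v f :: "'a::euclidean_space \<Rightarrow> real"
  assumes ws: "weak_solution v f" and c: "continuous_on UNIV v" and C: "0 \<le> C"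
    and v0: "\<And>y. norm (y - x) < T \<Longrightarrow> 0 \<le> v y"
    and f: "\<And>y. norm (y - x) < T \<Longrightarrow> - f y \<le> C * v y"
    and zero: "v x = 0" and y: "norm (y - x) < T"
  shows "v y = 0"
proof -
  have lv: "loc_int v" and lf: "loc_int f" using ws by (auto simp: weak_solution_def)
  have T: "0 < T" using y norm_ge_zero[of "y - x"] by linarith
  let ?k = "C * T / 2"
  have k: "0 \<le> ?k" using C T by simp
  have nonneg: "0 \<le> moll t x z * v z" if "0 < t" "t < T" for t z
    using v0[of z] moll_nonneg[of t x z] moll_eq_0[of t z x] that by (cases "norm (z - x) < t") (auto simp: not_less)
  have A0: "0 \<le> mean t v x" if "0 < t" "t < T" for t
    unfolding mean_def using nonneg[OF that] by (rule Bochner_Integration.integral_nonneg)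
  have A': "- (\<integral>z. pot t x z * f z \<partial>lborel) \<le> ?k * mean t v x" if t: "0 < t" "t < T" for t
  proof -
    have "- (\<integral>z. pot t x z * f z \<partial>lborel) = (\<integral>z. - (pot t x z * f z) \<partial>lborel)" by simp
    also have "\<dots> \<le> (\<integral>z. ?k * (moll t x z * v z) \<partial>lborel)"
    proof (rule integral_mono)
      show "integrable lborel (\<lambda>z. - (pot t x z * f z))" using integrable_pot[OF lf t(1)] by simp
      show "integrable lborel (\<lambda>z. ?k * (moll t x z * v z))" using integrable_moll[OF lv t(1)] by simp
      fix z
      show "- (pot t x z * f z) \<le> ?k * (moll t x z * v z)"
      proof (cases "norm (z - x) < t")
        case True
        then have z: "norm (z - x) < T" using t by simp
        have "- (pot t x z * f z) = pot t x z * (- f z)" by simp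
        also have "\<dots> \<le> pot t x z * (C * v z)" by (intro mult_left_mono f z pot_nonneg t)
        also have "\<dots> \<le> (t / 2 * moll t x z) * (C * v z)" using C v0[OF z] by (intro mult_right_mono pot_le_moll t) auto
        also have "\<dots> = t / 2 * (C * (moll t x z * v z))" by simp
        also have "\<dots> \<le> T / 2 * (C * (moll t x z * v z))" using t C nonneg[OF t] by (intro mult_right_mono) auto
        finally show ?thesis by (simp add: mult_ac)
      qed (simp add: moll_eq_0 pot_eq_0 t not_less)
    qed
    also have "\<dots> = ?k * mean t v x" by (simp add: mean_def)
    finally show ?thesis .
  qed
  obtain t where t: "norm (y - x) < t" "t < T" using dense[OF y] by blast
  have t0: "0 < t" using t(1) norm_ge_zero[of "y - x"] by linarith
  have mono: "mean t v x * exp (- (?k * t)) \<le> mean s v x * exp (- (?k * s))" if s: "0 < s" "s \<le> t" for s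
  proof (rule DERIV_nonpos_imp_nonincreasing[OF s(2)])
    fix r assume r: "s \<le> r" "r \<le> t"
    have r0: "0 < r" "r < T" using r s t by auto
    have d: "((\<lambda>t. mean t v x * exp (- (?k * t))) has_real_derivative
       mean r v x * (exp (- (?k * r)) * - ?k) + - (\<integral>z. pot r x z * f z \<partial>lborel) * exp (- (?k * r))) (at r)"
      by (rule DERIV_cong[OF DERIV_mult[OF weak_solution_mean_derivative[OF ws r0(1)] DERIV_chain2[OF DERIV_exp DERIV_minus[OF DERIV_cmult_Id]]]]) simp
    have "mean r v x * (exp (- (?k * r)) * - ?k) + - (\<integral>z. pot r x z * f z \<partial>lborel) * exp (- (?k * r)) =
      (- (\<integral>z. pot r x z * f z \<partial>lborel) - ?k * mean r v x) * exp (- (?k * r))" by (simp add: algebra_simps)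
    also have "\<dots> \<le> 0" using A'[OF r0] by (intro mult_nonpos_nonneg) auto
    finally show "\<exists>y. ((\<lambda>t. mean t v x * exp (- (?k * t))) has_real_derivative y) (at r) \<and> y \<le> 0" using d by blast
  qed
  have lim: "((\<lambda>s. mean s v x * exp (- (?k * s))) \<longlongrightarrow> (moll_mass TYPE('a) * v x) * exp (- (?k * 0))) (at_right 0)"
    using c by (intro tendsto_mult mean_tendsto_continuous lv tendsto_intros) (auto simp: continuous_on_eq_continuous_at)
  have "mean t v x * exp (- (?k * t)) \<le> (moll_mass TYPE('a) * v x) * exp (- (?k * 0))"
  proof (rule tendsto_lowerbound[OF lim])
    show "\<forall>\<^sub>F s in at_right 0. mean t v x * exp (- (?k * t)) \<le> mean s v x * exp (- (?k * s))"
      unfolding eventually_at_right_field using mono t0 by (intro exI[of _ t]) auto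
  qed simp
  then have "mean t v x * exp (- (?k * t)) \<le> 0" using zero by simp
  then have "mean t v x \<le> 0" by (simp add: mult_le_0_iff not_le[symmetric])
  then have "(\<integral>z. moll t x z * v z \<partial>lborel) = 0" using A0[OF t0 t(2)] by (simp add: mean_def)
  then have ae: "AE z in lborel. moll t x z * v z = 0"
    using integral_nonneg_eq_0_iff_AE[OF integrable_moll[OF lv t0]] nonneg[OF t0 t(2)] by simp
  let ?S = "{z. norm (z - x) < t} \<inter> {z. 0 < v z}"
  have "open ?S" using c by (intro open_Int open_Collect_less continuous_intros)
  moreover have "AE z in lborel. z \<notin> ?S"
    using ae by eventually_elim (use moll_pos[OF t0] in force)
  ultimately have "?S = {}" by (rule open_empty_if_AE_avoided)
  then have "\<not> 0 < v y" using t(1) by blast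
  then show ?thesis using v0[OF y] by linarith
qed

section \<open>Reflection symmetry of minimizers\<close>

lemma has_real_derivative_nl:
  assumes q: "q > 2"
  shows "(nl q has_real_derivative (q - 1) * \<bar>r\<bar> powr (q - 2)) (at r)"
proof -
  consider "r > 0" | "r < 0" | "r = 0" by linarith
  then show ?thesis
  proof cases
    case 1
    have "((\<lambda>r. r powr (q - 1)) has_real_derivative (q - 1) * \<bar>r\<bar> powr (q - 2)) (at r)"
      using 1 by (auto intro!: derivative_eq_intros)
    then show ?thesis
    proof (rule has_field_derivative_transform_within_open[where S="{0<..}"])
      show "z powr (q - 1) = nl q z" if "z \<in> {0<..}" for z
        using abs_nl[of q z] that by (simp add: nl_def abs_mult)
    qed (use 1 in auto)
  next
    case 2
    have "((\<lambda>r. - ((- r) powr (q - 1))) has_real_derivative (q - 1) * \<bar>r\<bar> powr (q - 2)) (at r)"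
      using 2 by (auto intro!: derivative_eq_intros)
    then show ?thesis
    proof (rule has_field_derivative_transform_within_open[where S="{..<0}"])
      show "- ((- z) powr (q - 1)) = nl q z" if "z \<in> {..<0}" for z
        using abs_nl[of q z] that by (simp add: nl_def abs_mult)
    qed (use 2 in auto)
  next
    case 3
    have "((\<lambda>h::real. \<bar>h\<bar> powr (q - 2)) \<longlongrightarrow> \<bar>0\<bar> powr (q - 2)) (at 0)"
      using q by (intro tendsto_intros tendsto_powr') auto
    then have l: "((\<lambda>h::real. \<bar>h\<bar> powr (q - 2)) \<longlongrightarrow> 0) (at 0)" by simp
    have "((\<lambda>h. nl q h / h) \<longlongrightarrow> 0) (at 0)"
      by (rule Lim_null_comparison[OF _ l]) (auto intro!: always_eventually simp: nl_def)
    then show ?thesis using 3 by (simp add: has_field_derivative_iff nl_def)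
  qed
qed

context variable_exponent
begin

text \<open>Since $p > 2$ the nonlinearity is $C^1$, so that a difference of two bounded solutions satisfies a
linear differential inequality.\<close>
lemma nl_lipschitz:
  assumes "\<bar>a\<bar> \<le> B" "\<bar>b\<bar> \<le> B"
  shows "\<bar>nl (p x) a - nl (p x) b\<bar> \<le> pmax * max 1 B powr pmax * \<bar>a - b\<bar>"
proof -
  have "norm (nl (p x) a - nl (p x) b) \<le> pmax * max 1 B powr pmax * norm (a - b)"
  proof (rule field_differentiable_bound[of "{-B..B}" "nl (p x)" "\<lambda>r. (p x - 1) * \<bar>r\<bar> powr (p x - 2)"])
    fix z assume z: "z \<in> {-B..B}"
    show "(nl (p x) has_field_derivative (p x - 1) * \<bar>z\<bar> powr (p x - 2)) (at z within {-B..B})"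
      by (rule has_field_derivative_at_within[OF has_real_derivative_nl[OF p_gt_2]])
    have "\<bar>z\<bar> powr (p x - 2) \<le> max 1 B powr (p x - 2)" using z p_gt_2[of x] by (intro powr_mono2) auto
    also have "\<dots> \<le> max 1 B powr pmax" using p_le[of x] by (intro powr_mono) auto
    finally have "(p x - 1) * \<bar>z\<bar> powr (p x - 2) \<le> pmax * max 1 B powr pmax"
      using p_gt_2[of x] p_le[of x] by (intro mult_mono) auto
    then show "norm ((p x - 1) * \<bar>z\<bar> powr (p x - 2)) \<le> pmax * max 1 B powr pmax"
      using p_gt_2[of x] by (simp add: abs_mult)
  qed (use assms in auto)
  then show ?thesis by simp
qed

end

lemma weak_solution_diff:
  fixes u v :: "'a::euclidean_space \<Rightarrow> real"
  assumes a: "weak_solution u f" and b: "weak_solution v h"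
  shows "weak_solution (\<lambda>x. u x - v x) (\<lambda>x. f x - h x)"
  unfolding weak_solution_def
proof (intro conjI allI impI)
  have l: "loc_int u" "loc_int f" "loc_int v" "loc_int h" using a b by (auto simp: weak_solution_def)
  show "loc_int (\<lambda>x. u x - v x)" "loc_int (\<lambda>x. f x - h x)" by (intro loc_int_diff l)+
  fix \<phi> :: "'a \<Rightarrow> real" assume t: "test_function \<phi>"
  obtain r where r: "\<And>y. r < norm y \<Longrightarrow> \<phi> y = 0" "\<And>y b. r < norm y \<Longrightarrow> frechet_derivative \<phi> (at y) b = 0" using test_support[OF t] by blast
  have lap: "integrable lborel (\<lambda>x. laplacian \<phi> x * k x)" if k: "loc_int k" for k
  proof -
    have "integrable lborel (\<lambda>x. frechet_derivative (\<lambda>z. frechet_derivative \<phi> (at z) b) (at x) b * k x)" if b: "b \<in> Basis" for b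
    proof -
      note tb = test_function_derivative[OF t b]
      obtain s where s: "\<And>y. s < norm y \<Longrightarrow> frechet_derivative \<phi> (at y) b = 0"
         "\<And>y c. s < norm y \<Longrightarrow> frechet_derivative (\<lambda>z. frechet_derivative \<phi> (at z) b) (at y) c = 0" using test_support[OF tb] by blast
      show ?thesis by (rule loc_int_mult_compact[OF k test_derivative_continuous[OF tb b] s(2)])
    qed
    then show ?thesis unfolding laplacian_def sum_distrib_right by (intro Bochner_Integration.integrable_sum)
  qed
  have ph: "integrable lborel (\<lambda>x. \<phi> x * k x)" if k: "loc_int k" for k
    by (rule loc_int_mult_compact[OF k test_continuous[OF t] r(1)])
  have "(\<integral>x. laplacian \<phi> x * (u x - v x) \<partial>lborel) = (\<integral>x. laplacian \<phi> x * u x \<partial>lborel) - (\<integral>x. laplacian \<phi> x * v x \<partial>lborel)"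
    unfolding right_diff_distrib using lap l by (intro Bochner_Integration.integral_diff)
  also have "\<dots> = - (\<integral>x. \<phi> x * f x \<partial>lborel) + (\<integral>x. \<phi> x * h x \<partial>lborel)" using a b t by (simp add: weak_solution_def)
  also have "\<dots> = - (\<integral>x. \<phi> x * (f x - h x) \<partial>lborel)"
    unfolding right_diff_distrib using ph l by (subst Bochner_Integration.integral_diff) auto
  finally show "(\<integral>x. laplacian \<phi> x * (u x - v x) \<partial>lborel) = - (\<integral>x. \<phi> x * (f x - h x) \<partial>lborel)" .
qed

locale reflected_minimization = minimization p pmin pmax V V0 Vmax R + reflection e
  for p :: "'a::euclidean_space \<Rightarrow> real" and pmin pmax V V0 Vmax R and e :: 'a +
  assumes p_refl: "p (refl x) = p x" and V0_refl: "AE x in lborel. V0 (refl x) = V0 x"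
begin

text \<open>Polarization preserves the modular and the potential energy as both \<open>p\<close> and \<open>V\<close> are symmetric under
the reflection, and it does not increase the Dirichlet integral. So it produces another minimizer,
and the multiplier is determined by quantities that are preserved.\<close>
lemma minimizer_polar:
  assumes m: "minimizer u g"
  shows "minimizer (polar u) (polar_grad u g)" "multiplier (polar u) = multiplier u"
proof -
  have w: "wgrad u g" and mod: "modular u = 1" and E: "energy u g = lambda1 V p" using m by (auto simp: minimizer_def)
  note [measurable] = wgrad_measurable[OF w]
  note pu = minimizer_powr_integrable[OF m]
  note wp = polar_wgrad[OF w]
  have mpol[measurable]: "polar u \<in> borel_measurable borel" by measurable
  have i0: "integrable lborel (\<lambda>x. \<bar>u x\<bar> powr p x)" using pu by (simp add: powr_integrable_def)
  have r1: "integrable lborel (\<lambda>x. \<bar>polar u x\<bar> powr p x)" "(\<integral>x. \<bar>polar u x\<bar> powr p x \<partial>lborel) = (\<integral>x. \<bar>u x\<bar> powr p x \<partial>lborel)"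
    by (rule polar_rearrange[of "\<lambda>x r. \<bar>r\<bar> powr p x", OF _ i0]; simp add: p_refl)+
  have r2: "(\<integral>x. \<bar>polar u x\<bar> powr p x / p x \<partial>lborel) = (\<integral>x. \<bar>u x\<bar> powr p x / p x \<partial>lborel)"
    by (rule polar_rearrange[of "\<lambda>x r. \<bar>r\<bar> powr p x / p x", OF _ powr_integrable_divide[OF pu]]; simp add: p_refl)
  have pp: "powr_integrable (polar u)" using r1 mpol by (simp add: powr_integrable_def)
  have modp: "modular (polar u) = 1" using modular_integral[OF pp] modular_integral[OF pu] mod r2 by simp
  have i2: "integrable lborel (\<lambda>x. (u x)\<^sup>2)" "integrable lborel (\<lambda>x. (norm (g x))\<^sup>2)" using w by (auto simp: wgrad_def)
  have iV: "integrable lborel (\<lambda>x. V0 x * (u x)\<^sup>2)" by (intro V0_integrable i2) measurable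
  have inv: "AE x in lborel. \<forall>r. V0 (refl x) * r\<^sup>2 = V0 x * r\<^sup>2" using V0_refl by eventually_elim simp
  have r3: "integrable lborel (\<lambda>x. V0 x * (polar u x)\<^sup>2)" "(\<integral>x. V0 x * (polar u x)\<^sup>2 \<partial>lborel) = (\<integral>x. V0 x * (u x)\<^sup>2 \<partial>lborel)"
    by (rule polar_rearrange[of "\<lambda>x r. V0 x * r\<^sup>2", OF inv iV]; measurable)+
  note pg = polar_grad_integral[OF wgrad_measurable[OF w] i2(2)]
  have "energy (polar u) (polar_grad u g) = (\<integral>x. (norm (polar_grad u g x))\<^sup>2 \<partial>lborel) + (\<integral>x. V0 x * (polar u x)\<^sup>2 \<partial>lborel)"
    unfolding energy_def using pg(1) r3(1) by (rule Bochner_Integration.integral_add)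
  also have "\<dots> \<le> (\<integral>x. (norm (g x))\<^sup>2 \<partial>lborel) + (\<integral>x. V0 x * (u x)\<^sup>2 \<partial>lborel)" using pg(2) r3(2) by simp
  also have "\<dots> = energy u g" unfolding energy_def using i2(2) iV by (rule Bochner_Integration.integral_add[symmetric])
  finally have le: "energy (polar u) (polar_grad u g) \<le> lambda1 V p" using E by simp
  have "polar u \<in> M p" using wgrad_imp_H1[OF wp] Lux_eq_1[OF mpol modp] by (simp add: M_def)
  from lambda1_le_J[OF this] have "lambda1 V p \<le> energy (polar u) (polar_grad u g)" by (simp add: J_eq_energy[OF wp])
  with le wp modp show "minimizer (polar u) (polar_grad u g)" by (simp add: minimizer_def)
  show "multiplier (polar u) = multiplier u" unfolding multiplier_def r1(2) ..
qed

text \<open>The polarization and \<open>W\<close> solve the same equation with the same multiplier, so that their difference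
\<open>v\<close>, which is nonnegative on the half space, satisfies $-\Delta v \ge - C v$ locally. By
\<open>zero_propagation\<close> its zero set in the half space is open, and it is closed; hence it is
empty or everything.\<close>
lemma reflection_dichotomy:
  assumes m: "minimizer W g" and c: "continuous_on UNIV W"
  shows "(\<forall>x. 0 < x \<bullet> e \<longrightarrow> W (refl x) \<le> W x) \<or> (\<forall>x. 0 < x \<bullet> e \<longrightarrow> W x < W (refl x))"
proof -
  let ?P = "polar W" and ?\<mu> = "multiplier W"
  define v where "v x = ?P x - W x" for x
  define f where "f x = source ?\<mu> ?P x - source ?\<mu> W x" for x
  have cP: "continuous_on UNIV ?P" by (rule continuous_polar[OF c])
  have cv: "continuous_on UNIV v" unfolding v_def by (intro continuous_intros cP c)
  have ws: "weak_solution v f"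
    unfolding v_def[abs_def] f_def[abs_def]
    using weak_solution_diff[OF minimizer_weak_solution[OF minimizer_polar(1)[OF m]] minimizer_weak_solution[OF m]] minimizer_polar(2)[OF m] by simp
  have v_half: "v x = max (W x) (W (refl x)) - W x" if "0 < x \<bullet> e" for x using that by (simp add: v_def polar_cases)
  define Z where "Z = {x. 0 < x \<bullet> e \<and> v x = 0}"
  let ?H = "{x. 0 < x \<bullet> e}"
  have spread: "\<And>x y. x \<in> Z \<Longrightarrow> norm (y - x) < x \<bullet> e \<Longrightarrow> v y = 0"
  proof -
    fix x y assume x: "x \<in> Z" and y: "norm (y - x) < x \<bullet> e"
    have half: "0 < z \<bullet> e" if "norm (z - x) < x \<bullet> e" for z
    proof -
      have "\<bar>(z - x) \<bullet> e\<bar> \<le> norm (z - x)" using Cauchy_Schwarz_ineq2[of "z - x" e] e by simp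
      then show ?thesis using that by (simp add: inner_diff_left)
    qed
    \<comment> \<open>the ball of radius $x \cdot e$ around \<open>x\<close> is the largest one inside the half space; it lies in
      the ball of radius \<open>r\<close> around $0$, where \<open>W\<close> is bounded\<close>
    define r where "r = norm x + x \<bullet> e"
    have "compact (W ` cball 0 r)" by (intro compact_continuous_image continuous_on_subset[OF c]) auto
    then obtain B where B: "\<And>z. norm z \<le> r \<Longrightarrow> \<bar>W z\<bar> \<le> B"
      by (metis bounded_iff compact_imp_bounded image_eqI mem_cball_0 real_norm_def)
    have BP: "\<bar>?P z\<bar> \<le> B" if "norm z \<le> r" for z using polar_mem[of W z] B[of z] B[of "refl z"] that by auto
    \<comment> \<open>Lipschitz constant of the right-hand side of the equation for values bounded by \<open>B\<close>\<close>
    define C where "C = \<bar>?\<mu>\<bar> * (pmax * max 1 B powr pmax) + Vmax"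
    show "v y = 0"
    proof (rule zero_propagation[OF ws cv, of C x "x \<bullet> e"])
      show "0 \<le> C" unfolding C_def using Vmax_nonneg pmax_gt by simp
      show "v x = 0" using x by (simp add: Z_def)
      show "norm (y - x) < x \<bullet> e" by fact
      fix z assume z: "norm (z - x) < x \<bullet> e"
      show vz: "0 \<le> v z" using v_half[OF half[OF z]] by simp
      have nz: "norm z \<le> r" using norm_triangle_sub[of z x] z by (simp add: r_def)
      have "\<bar>f z\<bar> \<le> \<bar>?\<mu> * (nl (p z) (?P z) - nl (p z) (W z))\<bar> + \<bar>V0 z * (?P z - W z)\<bar>"
      proof -
        have "f z = ?\<mu> * (nl (p z) (?P z) - nl (p z) (W z)) - V0 z * (?P z - W z)"
          by (simp add: f_def source_def algebra_simps)
        then show ?thesis by (simp only: abs_triangle_ineq4)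
      qed
      also have "\<dots> \<le> \<bar>?\<mu>\<bar> * (pmax * max 1 B powr pmax * \<bar>?P z - W z\<bar>) + Vmax * \<bar>?P z - W z\<bar>"
        unfolding abs_mult[of ?\<mu>] abs_mult[of "V0 z"]
        by (intro add_mono mult_left_mono mult_right_mono nl_lipschitz BP B nz V0_bound) auto
      also have "\<dots> = C * v z" using vz by (simp add: C_def v_def algebra_simps)
      finally show "- f z \<le> C * v z" by linarith
    qed
  qed
  have openZ: "open Z"
    unfolding open_dist
  proof
    fix x assume x: "x \<in> Z"
    then have xe: "0 < x \<bullet> e" by (simp add: Z_def)
    show "\<exists>d>0. \<forall>y. dist y x < d \<longrightarrow> y \<in> Z"
    proof (intro exI conjI allI impI)
      show "0 < x \<bullet> e" by fact
      fix y assume y: "dist y x < x \<bullet> e"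
      then have ny: "norm (y - x) < x \<bullet> e" by (simp add: dist_norm)
      have "\<bar>(y - x) \<bullet> e\<bar> \<le> norm (y - x)" using Cauchy_Schwarz_ineq2[of "y - x" e] e by simp
      then have "0 < y \<bullet> e" using ny by (simp add: inner_diff_left)
      then show "y \<in> Z" using spread[OF x ny] by (simp add: Z_def)
    qed
  qed
  have conn: "connected ?H"
  proof -
    have "?H = {x. e \<bullet> x > 0}" by (simp add: inner_commute)
    then show ?thesis using convex_halfspace_gt[of 0 e] by (simp add: convex_connected)
  qed
  have "Z = {} \<or> Z = ?H"
  proof -
    have "openin (top_of_set ?H) Z" using openZ by (auto simp: Z_def intro!: open_subset)
    moreover have "closedin (top_of_set ?H) Z"
    proof -
      have "closedin (top_of_set ?H) (?H \<inter> v -` {0})"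
        by (intro continuous_closedin_preimage continuous_on_subset[OF cv]) auto
      moreover have "?H \<inter> v -` {0} = Z" by (auto simp: Z_def)
      ultimately show ?thesis by simp
    qed
    ultimately show ?thesis using conn unfolding connected_clopen by blast
  qed
  then show ?thesis
  proof
    assume "Z = {}"
    then have "W x < W (refl x)" if "0 < x \<bullet> e" for x using v_half[OF that] that by (auto simp: Z_def max_def split: if_splits)
    then show ?thesis by blast
  next
    assume "Z = ?H"
    have "W (refl x) \<le> W x" if x: "0 < x \<bullet> e" for x
    proof -
      have "x \<in> Z" using \<open>Z = ?H\<close> x by simp
      then have "v x = 0" by (simp add: Z_def)
      then show ?thesis using v_half[OF x] by simp
    qed
    then show ?thesis by blast
  qed
qed

end

lemma (in reflection) reflection_uminus: "reflection (- e)"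
  using e by unfold_locales simp

lemma (in reflection) refl_uminus: "reflection.refl (- e) = refl"
  by (rule ext) (simp add: reflection.refl_def[OF reflection_uminus] refl_def)

context reflected_minimization
begin

text \<open>The dichotomy for both orientations of the normal vector.\<close>
lemma reflection_trichotomy:
  assumes m: "minimizer W g" and c: "continuous_on UNIV W"
  shows "(\<forall>x. W (refl x) = W x) \<or> (\<forall>x. 0 < x \<bullet> e \<longrightarrow> W (refl x) < W x) \<or> (\<forall>x. 0 < x \<bullet> e \<longrightarrow> W x < W (refl x))"
proof -
  interpret neg: reflected_minimization p pmin pmax V V0 Vmax R "- e"
    by (intro reflected_minimization.intro reflected_minimization_axioms.intro minimization_axioms reflection_uminus)
       (simp_all add: refl_uminus p_refl V0_refl)
  have nr: "neg.refl = refl" by (rule refl_uminus)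
  have D1: "(\<forall>x. 0 < x \<bullet> e \<longrightarrow> W (refl x) \<le> W x) \<or> (\<forall>x. 0 < x \<bullet> e \<longrightarrow> W x < W (refl x))"
    by (rule reflection_dichotomy[OF m c])
  have "(\<forall>x. 0 < x \<bullet> (- e) \<longrightarrow> W (refl x) \<le> W x) \<or> (\<forall>x. 0 < x \<bullet> (- e) \<longrightarrow> W x < W (refl x))"
    using neg.reflection_dichotomy[OF m c] unfolding nr .
  then have D2: "(\<forall>x. 0 < x \<bullet> e \<longrightarrow> W x \<le> W (refl x)) \<or> (\<forall>x. 0 < x \<bullet> e \<longrightarrow> W (refl x) < W x)"
  proof
    assume *: "\<forall>x. 0 < x \<bullet> (- e) \<longrightarrow> W (refl x) \<le> W x"
    have "W x \<le> W (refl x)" if "0 < x \<bullet> e" for x using *[rule_format, of "refl x"] that by (simp add: refl_side)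
    then show ?thesis by blast
  next
    assume *: "\<forall>x. 0 < x \<bullet> (- e) \<longrightarrow> W x < W (refl x)"
    have "W (refl x) < W x" if "0 < x \<bullet> e" for x using *[rule_format, of "refl x"] that by (simp add: refl_side)
    then show ?thesis by blast
  qed
  show ?thesis
  proof (cases "\<forall>x. 0 < x \<bullet> e \<longrightarrow> W (refl x) = W x")
    case True
    have "W (refl x) = W x" for x
    proof -
      consider "0 < x \<bullet> e" | "x \<bullet> e < 0" | "x \<bullet> e = 0" by linarith
      then show ?thesis
      proof cases
        case 1 then show ?thesis using True by blast
      next
        case 2 then show ?thesis using True[rule_format, of "refl x"] by (simp add: refl_side)
      next
        case 3 then show ?thesis by (simp add: refl_fixed)
      qed
    qed
    then show ?thesis by blast
  next
    case False
    then show ?thesis using D1 D2 by (metis antisym)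
  qed
qed

text \<open>Pairing mirror points turns the integrand into $(x \cdot e)(W(x) - W(\sigma x))$ with the reflection
$\sigma$, which is positive off the hyperplane.\<close>
lemma moment_positive:
  assumes c: "continuous_on UNIV W" and lt: "\<And>x. 0 < x \<bullet> e \<Longrightarrow> W (refl x) < W x"
  shows "0 < (\<integral>x. indicator (cball 0 1) x * (W x * (x \<bullet> e)) \<partial>lborel)"
proof -
  let ?k = "\<lambda>x. indicator (cball 0 1) x * (W x * (x \<bullet> e))"
  have ik: "integrable lborel ?k"
  proof -
    have "continuous_on (cball 0 1) (\<lambda>x. W x * (x \<bullet> e))"
      by (intro continuous_on_mult continuous_on_subset[OF c] continuous_on_inner continuous_on_id continuous_on_const) auto
    then show ?thesis using borel_integrable_compact[of "cball 0 1" "\<lambda>x. W x * (x \<bullet> e)"] by simp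
  qed
  have mk: "?k \<in> borel_measurable borel" using borel_measurable_integrable[OF ik] by simp
  have ikr: "integrable lborel (\<lambda>x. ?k (refl x))" using integral_refl(2)[OF mk] ik by simp
  let ?q = "\<lambda>x. ?k x + ?k (refl x)"
  have q: "?q x = indicator (cball 0 1) x * ((x \<bullet> e) * (W x - W (refl x)))" for x
    by (simp add: indicator_def refl_side algebra_simps)
  have q0: "0 \<le> (x \<bullet> e) * (W x - W (refl x))" for x
  proof -
    consider "0 < x \<bullet> e" | "x \<bullet> e < 0" | "x \<bullet> e = 0" by linarith
    then show ?thesis
    proof cases
      case 1 then show ?thesis using lt[OF 1] by simp
    next
      case 2
      then have "W x < W (refl x)" using lt[of "refl x"] by (simp add: refl_side)
      then show ?thesis using 2 by (intro mult_nonpos_nonpos) auto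
    qed simp
  qed
  have qn: "0 \<le> ?q x" for x unfolding q using q0[of x] by simp
  have iq: "integrable lborel ?q" using ik ikr by (rule Bochner_Integration.integrable_add)
  have two: "(\<integral>x. ?q x \<partial>lborel) = 2 * (\<integral>x. ?k x \<partial>lborel)"
    using ik ikr integral_refl(1)[OF mk] by simp
  have "(\<integral>x. ?q x \<partial>lborel) \<noteq> 0"
  proof
    assume "(\<integral>x. ?q x \<partial>lborel) = 0"
    then have ae: "AE x in lborel. ?q x = 0" using integral_nonneg_eq_0_iff_AE[OF iq] qn by simp
    let ?S = "ball 0 1 \<inter> {x. 0 < x \<bullet> e}"
    have "open ?S" by (intro open_Int open_Collect_less continuous_intros) auto
    moreover have "AE x in lborel. x \<notin> ?S"
      using ae
    proof eventually_elim
      case (elim x)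
      show ?case
      proof
        assume x: "x \<in> ?S"
        then have "0 < (x \<bullet> e) * (W x - W (refl x))" using lt[of x] by simp
        moreover have "?q x = (x \<bullet> e) * (W x - W (refl x))" unfolding q using x by simp
        ultimately show False using elim by simp
      qed
    qed
    ultimately have "?S = {}" by (rule open_empty_if_AE_avoided)
    moreover have "(1/2) *\<^sub>R e \<in> ?S" using e ee by simp
    ultimately show False by blast
  qed
  moreover have "0 \<le> (\<integral>x. ?q x \<partial>lborel)" using qn by (rule Bochner_Integration.integral_nonneg)
  ultimately show ?thesis using two by linarith
qed

end

section \<open>Axial symmetry\<close>

text \<open>The candidate for the direction of the axis. The truncation to a ball centred at the origin makes the
integral converge and is compatible with all reflections.\<close>
definition first_moment :: "('a::euclidean_space \<Rightarrow> real) \<Rightarrow> 'a" where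
  "first_moment W = (\<integral>x. indicator (cball 0 1) x *\<^sub>R (W x *\<^sub>R x) \<partial>lborel)"

lemma inner_first_moment:
  assumes c: "continuous_on UNIV W"
  shows "first_moment W \<bullet> e = (\<integral>x. indicator (cball 0 1) x * (W x * (x \<bullet> e)) \<partial>lborel)"
proof -
  have "integrable lborel (\<lambda>x. indicator (cball 0 1) x *\<^sub>R (W x *\<^sub>R x))"
    by (rule borel_integrable_compact) (auto intro!: continuous_intros continuous_on_subset[OF c])
  then show ?thesis
    unfolding first_moment_def
    using integral_inner_left[of e lborel "\<lambda>x. indicator (cball 0 1) x *\<^sub>R (W x *\<^sub>R x)"] by (simp add: mult.assoc)
qed

text \<open>Strict inequality between \<open>W\<close> and its reflection, in either direction, would make the component of
the first moment along \<open>e\<close> nonzero.\<close>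
lemma (in reflected_minimization) symmetric_if_orthogonal_first_moment:
  assumes m: "minimizer W g" and c: "continuous_on UNIV W" and o: "first_moment W \<bullet> e = 0"
  shows "W (refl x) = W x"
proof -
  have k0: "(\<integral>x. indicator (cball 0 1) x * (W x * (x \<bullet> e)) \<partial>lborel) = 0" using inner_first_moment[OF c] o by simp
  have "\<not> (\<forall>x. 0 < x \<bullet> e \<longrightarrow> W (refl x) < W x)" using moment_positive[OF c] k0 by auto
  moreover have "\<not> (\<forall>x. 0 < x \<bullet> e \<longrightarrow> W x < W (refl x))"
  proof
    assume *: "\<forall>x. 0 < x \<bullet> e \<longrightarrow> W x < W (refl x)"
    have "0 < (\<integral>x. indicator (cball 0 1) x * (- W x * (x \<bullet> e)) \<partial>lborel)"
      by (rule moment_positive) (use * in \<open>auto intro!: continuous_intros c\<close>)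
    then show False using k0 by simp
  qed
  ultimately show ?thesis using reflection_trichotomy[OF m c] by blast
qed

lemma orth_proj_span:
  assumes a: "a \<noteq> 0"
  shows "orth_proj (span {a}) x = ((x \<bullet> a) / (a \<bullet> a)) *\<^sub>R a"
  unfolding orth_proj_def
proof (rule the_equality)
  have aa: "a \<bullet> a \<noteq> 0" using a by simp
  show "(x \<bullet> a / (a \<bullet> a)) *\<^sub>R a \<in> span {a} \<and> (\<forall>z\<in>span {a}. orthogonal (x - (x \<bullet> a / (a \<bullet> a)) *\<^sub>R a) z)"
    using aa by (auto simp: span_singleton orthogonal_def inner_diff_left)
  fix y assume y: "y \<in> span {a} \<and> (\<forall>z\<in>span {a}. orthogonal (x - y) z)"
  then obtain k where k: "y = k *\<^sub>R a" by (auto simp: span_singleton)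
  have "a \<in> span {a}" by (rule span_base) simp
  then have "(x - y) \<bullet> a = 0" using y by (auto simp: orthogonal_def)
  then have "k = x \<bullet> a / (a \<bullet> a)" using aa by (simp add: k inner_diff_left field_simps)
  then show "y = (x \<bullet> a / (a \<bullet> a)) *\<^sub>R a" using k by simp
qed

text \<open>Two distinct points with the same projection to the axis and the same distance from it are mirror images
under the reflection along their difference, which is orthogonal to the axis.\<close>
lemma axially_symmetric_if_reflections:
  fixes W :: "'a::euclidean_space \<Rightarrow> real"
  assumes a: "a \<noteq> 0" and refl: "\<And>e x. norm e = 1 \<Longrightarrow> a \<bullet> e = 0 \<Longrightarrow> W (x - (2 * (x \<bullet> e)) *\<^sub>R e) = W x"
  obtains wt where "\<And>x. W x = wt (orth_proj (span {a}) x) (norm (x - orth_proj (span {a}) x))"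
proof -
  let ?P = "orth_proj (span {a})"
  have key: "W x = W y" if P: "?P x = ?P y" and N: "norm (x - ?P x) = norm (y - ?P y)" for x y
  proof (cases "x = y")
    case False
    define d where "d = x - y"
    have d: "d \<noteq> 0" using False by (simp add: d_def)
    define e where "e = (1 / norm d) *\<^sub>R d"
    have ne: "norm e = 1" using d by (simp add: e_def)
    have "x \<bullet> a / (a \<bullet> a) = y \<bullet> a / (a \<bullet> a)" using P a unfolding orth_proj_span[OF a] by simp
    then have xa: "x \<bullet> a = y \<bullet> a" using a by simp
    then have ae: "a \<bullet> e = 0" by (simp add: e_def d_def inner_simps inner_commute)
    have "(norm (x - ?P x))\<^sup>2 = (norm (y - ?P x))\<^sup>2" using N P by simp
    then have "x \<bullet> x - 2 * (x \<bullet> ?P x) = y \<bullet> y - 2 * (y \<bullet> ?P x)"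
      unfolding power2_norm_eq_inner by (simp add: inner_simps inner_commute algebra_simps)
    moreover have "x \<bullet> ?P x = y \<bullet> ?P x" unfolding orth_proj_span[OF a] using xa by simp
    ultimately have xx: "x \<bullet> x = y \<bullet> y" by simp
    have "2 * (x \<bullet> d) = d \<bullet> d" using xx by (simp add: d_def inner_simps inner_commute algebra_simps)
    then have "2 * (x \<bullet> e) = norm d"
      using d by (simp add: e_def power2_norm_eq_inner[symmetric] power2_eq_square field_simps)
    then have "x - (2 * (x \<bullet> e)) *\<^sub>R e = y" using d by (simp add: e_def d_def)
    with refl[OF ne ae, of x] show ?thesis by simp
  qed simp
  define wt where "wt l r = W (SOME x. ?P x = l \<and> norm (x - ?P x) = r)" for l r
  have "W x = wt (?P x) (norm (x - ?P x))" for x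
  proof -
    have "\<exists>y. ?P y = ?P x \<and> norm (y - ?P y) = norm (x - ?P x)" by blast
    from someI_ex[OF this] show ?thesis unfolding wt_def by (intro key) auto
  qed
  then show thesis by (rule that)
qed

lemma (in minimization) minimizer_AE_cong:
  assumes m: "minimizer u g" and [measurable]: "W \<in> borel_measurable borel" and ae: "AE x in lborel. W x = u x"
  shows "minimizer W g"
proof -
  have u: "wgrad u g" and mod: "modular u = 1" and E: "energy u g = lambda1 V p" using m by (auto simp: minimizer_def)
  note [measurable] = wgrad_measurable[OF u]
  have "AE x in lborel. u x = W x" using ae by eventually_elim simp
  then have w: "wgrad W g"
    using wgrad_iff_L2_weak_gradient[of W g u g] wgrad_iff_L2_weak_gradient[of u g u g] u by simp
  have "modular W = modular u" unfolding modular_def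
  proof (rule nn_integral_cong_AE)
    show "AE x in lborel. ennreal (\<bar>W x\<bar> powr p x / p x) = ennreal (\<bar>u x\<bar> powr p x / p x)" using ae by eventually_elim simp
  qed
  moreover have "energy W g = energy u g" using J_eq_energy[OF w] J_eq_energy[OF u] AE_eq_cong(2)[OF ae] by simp
  ultimately show ?thesis using w mod E by (simp add: minimizer_def)
qed

lemma bounded_if_limit_at_infinity:
  fixes p :: "'a::euclidean_space \<Rightarrow> real"
  assumes c: "continuous_on UNIV p" and l: "(p \<longlongrightarrow> l) at_infinity"
  shows "bounded (range p)"
proof -
  have "\<forall>\<^sub>F x in at_infinity. dist (p x) l < 1" using l by (rule tendstoD) simp
  then obtain b where b: "\<And>x. b \<le> norm x \<Longrightarrow> dist (p x) l < 1" unfolding eventually_at_infinity by blast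
  have "bounded (p ` cball 0 b)"
    by (intro compact_imp_bounded compact_continuous_image continuous_on_subset[OF c]) auto
  moreover have "p ` (- cball 0 b) \<subseteq> ball l 1" using b by (auto simp: dist_commute)
  then have "bounded (p ` (- cball 0 b))" using bounded_ball bounded_subset by blast
  ultimately have "bounded (p ` (cball 0 b \<union> - cball 0 b))" by (simp only: image_Un bounded_Un)
  then show ?thesis by (simp only: Compl_partition)
qed

theorem corollary1p3:
  fixes V p :: "real ^ 'n \<Rightarrow> real" and Vinf pinf :: real and w :: "real ^ 'n \<Rightarrow> real"
  assumes "CARD('n) \<ge> 3"
    and "essentially_bounded V"
    and "ess_tendsto_at_infinity V Vinf" and "Vinf > 0"
    and "continuous_on UNIV p"
    and "2 < (INF x. p x)"
    and "(SUP x. p x) < 2 * real CARD('n) / (real CARD('n) - 2)"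
    and "(p \<longlongrightarrow> pinf) at_infinity"
    and "ess_radial V" and "radial p"
    and "lambda1 V p <
           ((INF x. p x) / pinf) powr (2 / pinf) * lambda1_inf TYPE(real ^ 'n) Vinf pinf"
    and "w \<in> M p" and "J V w = lambda1 V p"
  shows "\<exists>w'. continuous_on UNIV w' \<and> (AE x in lebesgue. w' x = w x) \<and>
    (\<exists>L :: (real ^ 'n) set. subspace L \<and> dim L = 1 \<and>
      (\<exists>wt :: real ^ 'n \<Rightarrow> real \<Rightarrow> real.
        \<forall>x. w' x = wt (orth_proj L x) (norm (x - orth_proj L x))))"
proof -
  have bp: "bounded (range p)" by (rule bounded_if_limit_at_infinity[OF assms(5) assms(8)])
  obtain C where V: "V \<in> borel_measurable lebesgue" "AE x in lborel. \<bar>V x\<bar> \<le> C"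
    using assms(2) by (auto simp: essentially_bounded_def AE_completion_iff)
  obtain V1 where V1[measurable]: "V1 \<in> borel_measurable borel" and VV1: "AE x in lborel. V x = V1 x"
    using lebesgue_borel_representative[OF V(1)] by blast
  \<comment> \<open>truncation makes the essential bound valid everywhere\<close>
  define V0 where "V0 x = max (- \<bar>C\<bar>) (min \<bar>C\<bar> (V1 x))" for x
  have VV0: "AE x in lborel. V x = V0 x"
    using V(2) VV1 by eventually_elim (auto simp: V0_def)
  \<comment> \<open>closer than \<open>Vinf\<close> to the limit the potential is positive\<close>
  obtain R where R: "AE x in lborel. R \<le> norm x \<longrightarrow> \<bar>V x - Vinf\<bar> < Vinf"
    using assms(3,4) by (auto simp: ess_tendsto_at_infinity_def AE_completion_iff)
  interpret minimization p "INF x. p x" "SUP x. p x" V V0 "\<bar>C\<bar>" R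
  proof
    show "(INF x. p x) \<le> p x" "p x \<le> (SUP x. p x)" for x
      using bp by (auto intro!: cINF_lower cSUP_upper bounded_imp_bdd_below bounded_imp_bdd_above)
    show "V0 \<in> borel_measurable borel" unfolding V0_def[abs_def] by measurable
    show "AE x in lborel. R \<le> norm x \<longrightarrow> 0 \<le> V0 x"
      using R VV0 by eventually_elim auto
  qed (use assms VV0 in \<open>auto simp: V0_def\<close>)
  obtain h where h: "AE x in lborel. V x = h (norm x)" using assms(9) by (auto simp: ess_radial_def AE_completion_iff)
  have V0h: "AE x in lborel. V0 x = h (norm x)" using h VV0 by eventually_elim simp
  obtain k where k: "\<And>x. p x = k (norm x)" using assms(10) by (auto simp: radial_def)
  obtain u g where ug: "wgrad u g" "AE x in lborel. w x = u x" "Lux p u = 1" using M_representative[OF assms(12)] by blast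
  have mu: "minimizer u g"
    using ug(1) modular_eq_1[OF wgrad_measurable(1)[OF ug(1)] ug(3)] J_eq_energy[OF ug(1)] AE_eq_cong(2)[OF ug(2), of V] assms(13)
    by (simp add: minimizer_def)
  have dim: "3 \<le> DIM(real ^ 'n)" "(SUP x. p x) < 2 * DIM(real ^ 'n) / (DIM(real ^ 'n) - 2)"
    using assms(1,7) by (simp_all add: of_nat_diff)
  obtain W where W: "continuous_on UNIV W" "AE x in lborel. W x = u x"
    using minimizer_continuous_representative[OF dim mu] by blast
  have mW: "minimizer W g" by (rule minimizer_AE_cong[OF mu borel_measurable_continuous_onI[OF W(1)] W(2)])
  \<comment> \<open>if the moment vanishes, every reflection is a symmetry and every axis will do\<close>
  define a where "a = (if first_moment W = 0 then axis undefined 1 else first_moment W)"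
  have a: "a \<noteq> 0" by (simp add: a_def axis_eq_0_iff)
  have sym: "W (x - (2 * (x \<bullet> e)) *\<^sub>R e) = W x" if he: "norm e = 1" "a \<bullet> e = 0" for e x
  proof -
    interpret reflection e by unfold_locales (rule he(1))
    interpret reflected_minimization p "INF x. p x" "SUP x. p x" V V0 "\<bar>C\<bar>" R e
    proof
      show "p (refl x) = p x" for x by (simp add: k)
      show "AE x in lborel. V0 (refl x) = V0 x" using V0h AE_refl[OF V0h] by eventually_elim simp
    qed
    have "first_moment W \<bullet> e = 0" using he(2) by (auto simp: a_def split: if_splits)
    from symmetric_if_orthogonal_first_moment[OF mW W(1) this, of x] show ?thesis by (simp add: refl_def)
  qed
  obtain wt where wt: "\<And>x. W x = wt (orth_proj (span {a}) x) (norm (x - orth_proj (span {a}) x))"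
    using axially_symmetric_if_reflections[OF a sym] by blast
  have "AE x in lborel. W x = w x" using W(2) ug(2) by eventually_elim simp
  moreover have "dim (span {a}) = 1" using a by (simp add: dim_insert)
  ultimately show ?thesis
    using W(1) wt by (intro exI[of _ W] conjI exI[of _ "span {a}"] exI[of _ wt]) (auto simp: AE_completion_iff)
qed

end
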